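(* Let $G$ be a finite group and let $s\in\mathbb{Z}^{+}$. (i) If $V_G$ is a graded $G$-module giving weak moonshine for $G$, then this weak moonshine extends to width $s$ weak moonshine: for every $1\le r\le s$ and every $\underline{g}\in G^{(r)}$, the width $r$ McKay-Thompson series $T(r,\underline{g};\tau)$ formed from $V_G$ is a weakly holomorphic modular function. (ii) Moreover, for every $s\in\mathbb{Z}^{+}$, $G$ admits asymptotically regular width $s$ weak moonshine; that is, there exists an asymptotically regular module $V_G$ giving weak moonshine for $G$ such that $T(r,\underline{g};\tau)$ is a weakly holomorphic modular function for every $1\le r\le s$ and every $\underline{g}\in G^{(r)}$.
   Context: Notation: $\tau$ lies in the complex upper half-plane $\mathbb{H}$ and $q=e^{2\pi i\tau}$. A weakly holomorphic modular function is a holomorphic function on $\mathbb{H}$ that is invariant (weight $0$) under a congruence subgroup of $\mathrm{SL}_2(\mathbb{Z})$ and is meromorphic at all cusps (poles at cusps are allowed). Let $\rho_1,\dots,\rho_t$ be the irreducible complex representations of the finite group $G$ (one per isomorphism class), with characters $\chi_1,\dots,\chi_t$; write $\dim\chi_i=\chi_i(1)$. For $r\in\mathbb{Z}^{+}$ let $G^{(r)}=G\times\cdots\times G$ ($r$ copies). Frobenius $r$-characters: for an irreducible character $\chi$ of $G$, put $\chi^{(1)}(g)=\chi(g)$, $\chi^{(2)}(g_1,g_2)=\chi(g_1)\chi(g_2)-\chi(g_1g_2)$, and for $r\ge 3$ define $\chi^{(r)}:G^{(r)}\to\mathbb{C}$ recursively by $$\chi^{(r)}(g_1,\dots,g_r)=\chi(g_1)\chi^{(r-1)}(g_2,\dots,g_r)-\chi^{(r-1)}(g_1g_2,g_3,\dots,g_r)-\chi^{(r-1)}(g_2,g_1g_3,\dots,g_r)-\cdots-\chi^{(r-1)}(g_2,\dots,g_1g_r).$$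 Weak moonshine: an infinite-dimensional graded complex $G$-module $V_G=\bigoplus_{n\in\{-d\}\cup\mathbb{Z}^{+}}V_G(n)$, for some integer $d>0$, with each $V_G(n)$ a finite-dimensional representation of $G$, gives weak moonshine for $G$ if for each $g\in G$ the McKay-Thompson series $T_g(\tau)=\sum_{n}\mathrm{Tr}(g\mid V_G(n))q^n$ is a weakly holomorphic modular function. Let $m_i(n)$ be the multiplicity of $\rho_i$ in $V_G(n)$. For $r\ge1$ and $\underline{g}\in G^{(r)}$ define $\mathrm{Frob}_r(\underline{g};n)=\sum_{1\le i\le t}m_i(n)\chi_i^{(r)}(\underline{g})$ and the width $r$ McKay-Thompson series $T(r,\underline{g};\tau)=\sum_{n}\mathrm{Frob}_r(\underline{g};n)q^n$ (so $T(1,g;\tau)=T_g(\tau)$). Width $s$ weak moonshine for $G$ means that, for each $1\le r\le s$ and each $\underline{g}\in G^{(r)}$, $T(r,\underline{g};\tau)$ is a weakly holomorphic modular function. The module $V_G$ is asymptotically regular if for each $1\le i\le t$, $$\lim_{n\to\infty}\frac{m_i(n)}{\sum_{j=1}^{t}m_j(n)}=\frac{\dim\chi_i}{\sum_{j=1}^{t}\dim\chi_j}.$$ *)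

theory Defs
  imports
    "HOL-Complex_Analysis.Complex_Analysis"
    "HOL-Number_Theory.Cong"
    "Jordan_Normal_Form.VS_Connect"
begin

definition GL :: "nat \<Rightarrow> complex mat monoid" where
  "GL d = units_of (ring_mat TYPE(complex) d ())"

text \<open>
  Finite-dimensional complex representations are taken in matrix form, with values on the
  carrier of the group only. The zero representation (\<open>d = 0\<close>) is included.
\<close>

definition representation :: "('g, 'b) monoid_scheme \<Rightarrow> nat \<Rightarrow> ('g \<Rightarrow> complex mat) \<Rightarrow> bool" where
  "representation G d \<sigma> \<longleftrightarrow> \<sigma> \<in> hom G (GL d)"

definition rep_dim :: "('g, 'b) monoid_scheme \<Rightarrow> ('g \<Rightarrow> complex mat) \<Rightarrow> nat" where
  "rep_dim G \<sigma> = dim_row (\<sigma> \<one>\<^bsub>G\<^esub>)"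

definition mat_trace :: "'a :: comm_monoid_add mat \<Rightarrow> 'a" where
  "mat_trace A = (\<Sum>i<dim_row A. A $$ (i, i))"

definition character :: "('g \<Rightarrow> complex mat) \<Rightarrow> 'g \<Rightarrow> complex" where
  "character \<sigma> g = mat_trace (\<sigma> g)"

definition irreducible_rep :: "('g, 'b) monoid_scheme \<Rightarrow> nat \<Rightarrow> ('g \<Rightarrow> complex mat) \<Rightarrow> bool" where
  "irreducible_rep G d \<sigma> \<longleftrightarrow>
     representation G d \<sigma> \<and> d > 0 \<and>
     (\<forall>W. VectorSpace.subspace class_ring W (module_vec TYPE(complex) d) \<and>
          (\<forall>g\<in>carrier G. \<forall>w\<in>W. \<sigma> g *\<^sub>v w \<in> W)
          \<longrightarrow> W = {0\<^sub>v d} \<or> W = carrier_vec d)"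

definition rep_iso ::
  "('g, 'b) monoid_scheme \<Rightarrow> ('g \<Rightarrow> complex mat) \<Rightarrow> ('g \<Rightarrow> complex mat) \<Rightarrow> bool" where
  "rep_iso G \<sigma> \<tau> \<longleftrightarrow> (\<exists>P Q. \<forall>g\<in>carrier G. similar_mat_wit (\<sigma> g) (\<tau> g) P Q)"

definition irreps_system ::
  "('g, 'b) monoid_scheme \<Rightarrow> nat \<Rightarrow> (nat \<Rightarrow> 'g \<Rightarrow> complex mat) \<Rightarrow> bool" where
  "irreps_system G t \<rho> \<longleftrightarrow>
     (\<forall>i<t. irreducible_rep G (rep_dim G (\<rho> i)) (\<rho> i)) \<and>
     (\<forall>i<t. \<forall>j<t. i \<noteq> j \<longrightarrow> \<not> rep_iso G (\<rho> i) (\<rho> j)) \<and>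
     (\<forall>d \<sigma>. irreducible_rep G d \<sigma> \<longrightarrow> (\<exists>i<t. rep_iso G \<sigma> (\<rho> i)))"

text \<open>The direct sum of \<open>m 0\<close> copies of \<open>\<rho> 0\<close>, \<open>m 1\<close> copies of \<open>\<rho> 1\<close>, ...\<close>

definition direct_sum_rep ::
  "nat \<Rightarrow> (nat \<Rightarrow> 'g \<Rightarrow> complex mat) \<Rightarrow> (nat \<Rightarrow> nat) \<Rightarrow> 'g \<Rightarrow> complex mat" where
  "direct_sum_rep t \<rho> m g =
     diag_block_mat (concat (map (\<lambda>i. replicate (m i) (\<rho> i g)) [0..<t]))"

text \<open>
  For a representation \<open>\<sigma>\<close> of a finite group and a complete system \<open>\<rho>\<close> of irreducible
  representations, the vector \<open>m\<close> below exists by complete reducibility and is unique.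
  It is set to \<open>0\<close> beyond \<open>t\<close> so that it is unique as a function on all of \<open>nat\<close>.
\<close>

definition multiplicity_in ::
  "('g, 'b) monoid_scheme \<Rightarrow> nat \<Rightarrow> (nat \<Rightarrow> 'g \<Rightarrow> complex mat) \<Rightarrow> ('g \<Rightarrow> complex mat) \<Rightarrow> nat \<Rightarrow> nat"
  where
  "multiplicity_in G t \<rho> \<sigma> =
     (THE m. rep_iso G \<sigma> (direct_sum_rep t \<rho> m) \<and> (\<forall>i\<ge>t. m i = 0))"

text \<open>Tuples are lists; the value on the empty list is never used.\<close>

function frobenius_character ::
  "('g, 'b) monoid_scheme \<Rightarrow> ('g \<Rightarrow> complex) \<Rightarrow> 'g list \<Rightarrow> complex" where
  "frobenius_character G \<psi> [] = 1"
| "frobenius_character G \<psi> [g] = \<psi> g"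
| "frobenius_character G \<psi> [g, h] = \<psi> g * \<psi> h - \<psi> (g \<otimes>\<^bsub>G\<^esub> h)"
| "frobenius_character G \<psi> (g # h # k # gs) =
     (let hs = h # k # gs in
       \<psi> g * frobenius_character G \<psi> hs -
       (\<Sum>j<length hs. frobenius_character G \<psi> (hs[j := g \<otimes>\<^bsub>G\<^esub> (hs ! j)])))"
  by pat_completeness auto
termination
  by (relation "Wellfounded.measure (\<lambda>(G, \<psi>, gs). length gs)")
     (simp_all del: list_update.simps)

definition upper_half_plane :: "complex set" where
  "upper_half_plane = {\<tau>. Im \<tau> > 0}"

definition SL2Z :: "int mat monoid" where
  "SL2Z = \<lparr>carrier = {A \<in> carrier_mat 2 2. Determinant.det A = 1}, mult = (*), one = 1\<^sub>m 2\<rparr>"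

definition principal_congruence_subgroup :: "nat \<Rightarrow> int mat set" where
  "principal_congruence_subgroup N =
     {A \<in> carrier SL2Z. \<forall>i<2. \<forall>j<2. [A $$ (i, j) = 1\<^sub>m 2 $$ (i, j)] (mod int N)}"

definition congruence_subgroup :: "int mat set \<Rightarrow> bool" where
  "congruence_subgroup \<Gamma> \<longleftrightarrow>
     subgroup \<Gamma> SL2Z \<and> (\<exists>N>0. principal_congruence_subgroup N \<subseteq> \<Gamma>)"

definition moebius_action :: "int mat \<Rightarrow> complex \<Rightarrow> complex" where
  "moebius_action A \<tau> =
     (of_int (A $$ (0, 0)) * \<tau> + of_int (A $$ (0, 1))) /
     (of_int (A $$ (1, 0)) * \<tau> + of_int (A $$ (1, 1)))"

text \<open>
  Meromorphy at \<open>i\<infinity>\<close>: as a function of the local parameter \<open>exp (2\<pi>i\<tau>/N)\<close> for some \<open>N > 0\<close>,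
  \<open>f\<close> is meromorphic at \<open>0\<close>. The existence of \<open>F\<close> subsumes the periodicity of \<open>f\<close> with period \<open>N\<close>.
\<close>

definition meromorphic_at_infinity_cusp :: "(complex \<Rightarrow> complex) \<Rightarrow> bool" where
  "meromorphic_at_infinity_cusp f \<longleftrightarrow>
     (\<exists>N::nat. N > 0 \<and> (\<exists>F. F meromorphic_on {0} \<and>
        (\<forall>\<tau>\<in>upper_half_plane. f \<tau> = F (exp (2 * of_real pi * \<i> * \<tau> / of_nat N)))))"

text \<open>Every cusp is of the form \<open>A(i\<infinity>)\<close> with \<open>A\<close> in \<open>SL2Z\<close>.\<close>

definition weakly_holomorphic_modular_function :: "(complex \<Rightarrow> complex) \<Rightarrow> bool" where
  "weakly_holomorphic_modular_function f \<longleftrightarrow>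
     f holomorphic_on upper_half_plane \<and>
     (\<exists>\<Gamma>. congruence_subgroup \<Gamma> \<and>
        (\<forall>A\<in>\<Gamma>. \<forall>\<tau>\<in>upper_half_plane. f (moebius_action A \<tau>) = f \<tau>)) \<and>
     (\<forall>A\<in>carrier SL2Z. meromorphic_at_infinity_cusp (\<lambda>\<tau>. f (moebius_action A \<tau>)))"

definition degrees :: "int \<Rightarrow> int set" where
  "degrees d = insert (- d) {0<..}"

definition q_term :: "(int \<Rightarrow> complex) \<Rightarrow> complex \<Rightarrow> int \<Rightarrow> complex" where
  "q_term c \<tau> n = c n * exp (2 * of_real pi * \<i> * \<tau>) powi n"

definition q_series :: "int \<Rightarrow> (int \<Rightarrow> complex) \<Rightarrow> complex \<Rightarrow> complex" where
  "q_series d c \<tau> = (\<Sum>\<^sub>\<infinity>n\<in>degrees d. q_term c \<tau> n)"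

text \<open>
  Since \<open>infsum\<close> is \<open>0\<close> for a series that is not summable, convergence is demanded explicitly.
\<close>

definition q_series_modular :: "int \<Rightarrow> (int \<Rightarrow> complex) \<Rightarrow> bool" where
  "q_series_modular d c \<longleftrightarrow>
     (\<forall>\<tau>\<in>upper_half_plane. q_term c \<tau> summable_on degrees d) \<and>
     weakly_holomorphic_modular_function (q_series d c)"

text \<open>
  A graded module is a family \<open>V\<close> of representations, of which only the members with index in
  \<open>degrees d\<close> matter.
\<close>

definition infinite_graded_module ::
  "('g, 'b) monoid_scheme \<Rightarrow> int \<Rightarrow> (int \<Rightarrow> 'g \<Rightarrow> complex mat) \<Rightarrow> bool" where
  "infinite_graded_module G d V \<longleftrightarrow>
     d > 0 \<and>
     (\<forall>n\<in>degrees d. representation G (rep_dim G (V n)) (V n)) \<and>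
     infinite {n \<in> degrees d. rep_dim G (V n) > 0}"

definition weak_moonshine ::
  "('g, 'b) monoid_scheme \<Rightarrow> int \<Rightarrow> (int \<Rightarrow> 'g \<Rightarrow> complex mat) \<Rightarrow> bool" where
  "weak_moonshine G d V \<longleftrightarrow>
     infinite_graded_module G d V \<and>
     (\<forall>g\<in>carrier G. q_series_modular d (\<lambda>n. mat_trace (V n g)))"

definition Frob ::
  "('g, 'b) monoid_scheme \<Rightarrow> nat \<Rightarrow> (nat \<Rightarrow> 'g \<Rightarrow> complex mat) \<Rightarrow> (int \<Rightarrow> 'g \<Rightarrow> complex mat) \<Rightarrow>
     'g list \<Rightarrow> int \<Rightarrow> complex" where
  "Frob G t \<rho> V gs n =
     (\<Sum>i<t. of_nat (multiplicity_in G t \<rho> (V n) i) * frobenius_character G (character (\<rho> i)) gs)"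

definition width_weak_moonshine ::
  "('g, 'b) monoid_scheme \<Rightarrow> nat \<Rightarrow> (nat \<Rightarrow> 'g \<Rightarrow> complex mat) \<Rightarrow> nat \<Rightarrow> int \<Rightarrow>
     (int \<Rightarrow> 'g \<Rightarrow> complex mat) \<Rightarrow> bool" where
  "width_weak_moonshine G t \<rho> s d V \<longleftrightarrow>
     infinite_graded_module G d V \<and>
     (\<forall>r\<in>{1..s}. \<forall>gs. length gs = r \<and> set gs \<subseteq> carrier G \<longrightarrow>
        q_series_modular d (Frob G t \<rho> V gs))"

definition asymptotically_regular ::
  "('g, 'b) monoid_scheme \<Rightarrow> nat \<Rightarrow> (nat \<Rightarrow> 'g \<Rightarrow> complex mat) \<Rightarrow> (int \<Rightarrow> 'g \<Rightarrow> complex mat) \<Rightarrow> bool"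
  where
  "asymptotically_regular G t \<rho> V \<longleftrightarrow>
     (\<forall>i<t. (\<lambda>n::nat. real (multiplicity_in G t \<rho> (V (int n)) i) /
                       (\<Sum>j<t. real (multiplicity_in G t \<rho> (V (int n)) j)))
            \<longlonglongrightarrow> real (rep_dim G (\<rho> i)) / (\<Sum>j<t. real (rep_dim G (\<rho> j))))"

end

theory Submission
  imports Defs "Jordan_Normal_Form.Spectral_Radius"
begin

text \<open>
  By character orthogonality the multiplicity \<open>m\<^sub>i(n)\<close> is a fixed linear combination of the traces
  \<open>Tr(g | V(n))\<close>, so every \<open>T(r, g; \<tau>)\<close> is a linear combination of the \<open>T\<^sub>g\<close>, and weakly holomorphic
  modular functions are closed under linear combinations. This gives part (i).

  For part (ii) take \<open>V(n)\<close> to be \<open>a(n)\<close> copies of the regular representation, so that \<open>T\<^sub>g = 0\<close> for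
  \<open>g \<noteq> 1\<close>, \<open>T\<^sub>1 = |G| f\<close> with \<open>f = \<Sum> a(n) q\<^sup>n\<close>, and the multiplicities are exactly proportional to
  the dimensions of the irreducible representations. The function used is
  \<open>f = 2\<^sup>1\<^sup>6 q\<^sup>2 \<Prod>(1 + q\<^sup>n)\<^sup>4\<^sup>8 = \<theta>\<^sub>2\<^sup>1\<^sup>6 / (\<theta>\<^sub>3 \<theta>\<^sub>4)\<^sup>8\<close>, which is invariant under \<open>\<Gamma>(2)\<close> and has
  positive integral coefficients from \<open>q\<^sup>2\<close> on; here \<open>d = 1\<close> and \<open>V(-1)\<close> is zero. The three theta
  constants are values of one entire function of \<open>z\<close>, given by its product, at the half periods.
  Its behaviour under \<open>\<tau> \<mapsto> -1/\<tau>\<close> follows from Liouville's theorem, because the quotient of the two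
  sides is elliptic without poles. The eighth powers are taken to remove the roots of unity from the
  transformation laws.
\<close>

text \<open>The three theta constants enter only through quotients of degree zero, so every factor
  common to the three cancels. For this reason the constant left open by the Liouville argument is
  never evaluated, no automorphy factor occurs, and the product \<Prod>(1 - q^n) is left out of the
  theta function. The full modular group then merely permutes three quotients, through its action on
  half periods modulo 2, so the behaviour at every cusp is known at once.

  What has to be found is a function of weight 0 with natural, eventually positive coefficients, no
  constant term (the grading skips degree 0) and no poles in the upper half-plane. The theta
  products have no zeros in the punctured disc, which settles the poles. Positivity is threatened by
  the denominator; Euler's identity \<Prod>(1 + q^n) \<Prod>(1 - q^(2n-1)) = 1 turns it into 16
  further copies of the positive product \<Prod>(1 + q^n), next to the 32 of the numerator. The
  factor 2^16 is the square of the 2^8 in the eighth power of \<theta>_2.\<close>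

section \<open>Infinite products of the form \<Prod>(1 + f n)\<close>

lemma
  fixes f :: "nat \<Rightarrow> complex"
  assumes "summable (\<lambda>n. norm (f n))"
  shows convergent_prod_one_plus: "convergent_prod (\<lambda>n. 1 + f n)"
    and prodinf_one_plus_LIMSEQ: "(\<lambda>N. \<Prod>n<N. 1 + f n) \<longlonglongrightarrow> (\<Prod>n. 1 + f n)"
proof -
  have "abs_convergent_prod (\<lambda>n. 1 + f n)"
    using assms by (intro summable_imp_abs_convergent_prod) simp
  then show *: "convergent_prod (\<lambda>n. 1 + f n)"
    by (rule abs_convergent_prod_imp_convergent_prod)
  show "(\<lambda>N. \<Prod>n<N. 1 + f n) \<longlonglongrightarrow> (\<Prod>n. 1 + f n)"
    using convergent_prod_LIMSEQ[OF *] LIMSEQ_lessThan_iff_atMost by blast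
qed

lemma prodinf_one_plus_eq_0_iff:
  fixes f :: "nat \<Rightarrow> complex"
  assumes "summable (\<lambda>n. norm (f n))"
  shows "(\<Prod>n. 1 + f n) = 0 \<longleftrightarrow> (\<exists>n. 1 + f n = 0)"
proof
  assume "\<exists>n. 1 + f n = 0"
  then have "\<forall>\<^sub>F N in sequentially. (\<Prod>n<N. 1 + f n) = 0"
    unfolding eventually_sequentially by (metis finite_lessThan lessThan_iff less_le_trans lessI prod_zero Suc_le_eq)
  then have "(\<lambda>N. \<Prod>n<N. 1 + f n) \<longlonglongrightarrow> 0"
    by (rule tendsto_eventually)
  then show "(\<Prod>n. 1 + f n) = 0"
    using prodinf_one_plus_LIMSEQ[OF assms] LIMSEQ_unique by blast
qed (use prodinf_nonzero[OF convergent_prod_one_plus[OF assms]] in auto)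

lemma uniform_limit_prodinf_one_plus:
  fixes f :: "nat \<Rightarrow> complex \<Rightarrow> complex"
  assumes "\<And>n. f n holomorphic_on S" "compact S" "summable M"
    and "\<And>n z. z \<in> S \<Longrightarrow> norm (f n z) \<le> M n"
  shows "uniform_limit S (\<lambda>N z. \<Prod>n<N. 1 + f n z) (\<lambda>z. \<Prod>n. 1 + f n z) sequentially"
proof -
  have "uniformly_convergent_on S (\<lambda>N z. \<Sum>n<N. norm (f n z))"
    by (rule Weierstrass_m_test'[OF _ assms(3)]) (use assms(4) in auto)
  then have "uniformly_convergent_on S (\<lambda>N z. \<Prod>n<N. 1 + f n z)"
    by (intro uniformly_convergent_on_prod holomorphic_on_imp_continuous_on assms)
  then obtain l where l: "uniform_limit S (\<lambda>N z. \<Prod>n<N. 1 + f n z) l sequentially"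
    by (auto simp: uniformly_convergent_on_def)
  have "l z = (\<Prod>n. 1 + f n z)" if "z \<in> S" for z
  proof -
    have "summable (\<lambda>n. norm (f n z))"
      by (rule summable_comparison_test'[OF assms(3)]) (use assms(4) that in auto)
    then show ?thesis
      by (rule LIMSEQ_unique[OF tendsto_uniform_limitI[OF l that] prodinf_one_plus_LIMSEQ])
  qed
  then show ?thesis
    using l by (simp cong: uniform_limit_cong')
qed

lemma holomorphic_on_prodinf_one_plus:
  fixes f :: "nat \<Rightarrow> complex \<Rightarrow> complex"
  assumes holo: "\<And>n. f n holomorphic_on S" and "open S"
    and bound: "\<And>K. compact K \<Longrightarrow> K \<subseteq> S \<Longrightarrow>
      \<exists>M. summable M \<and> (\<forall>n. \<forall>z\<in>K. norm (f n z) \<le> M n)"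
  shows "(\<lambda>z. \<Prod>n. 1 + f n z) holomorphic_on S"
proof (rule holomorphic_uniform_sequence[OF \<open>open S\<close>])
  show "(\<lambda>z. \<Prod>n<N. 1 + f n z) holomorphic_on S" for N
    by (intro holomorphic_intros holo)
  fix x assume "x \<in> S"
  then obtain d where d: "d > 0" "cball x d \<subseteq> S"
    using \<open>open S\<close> open_contains_cball by blast
  obtain M where M: "summable M" "\<forall>n. \<forall>z\<in>cball x d. norm (f n z) \<le> M n"
    using bound[of "cball x d"] d by auto
  have "uniform_limit (cball x d) (\<lambda>N z. \<Prod>n<N. 1 + f n z) (\<lambda>z. \<Prod>n. 1 + f n z) sequentially"
  proof (rule uniform_limit_prodinf_one_plus[OF _ _ M(1)])
    show "f n holomorphic_on cball x d" for n
      using holo d(2) by (rule holomorphic_on_subset)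
    show "norm (f n z) \<le> M n" if "z \<in> cball x d" for n z
      using M(2) that by blast
  qed simp
  then show "\<exists>d>0. cball x d \<subseteq> S \<and> uniform_limit (cball x d) (\<lambda>N z. \<Prod>n<N. 1 + f n z)
      (\<lambda>z. \<Prod>n. 1 + f n z) sequentially"
    using d by (intro exI[of _ d]) simp
qed

section \<open>The q-Pochhammer symbol (a; q)_\<infinity>\<close>

definition qpoch :: "complex \<Rightarrow> complex \<Rightarrow> complex" where
  "qpoch a q = (\<Prod>n. 1 - a * q ^ n)"

lemma summable_qpoch:
  fixes a q :: complex
  assumes "norm q < 1"
  shows "summable (\<lambda>n. norm (- (a * q ^ n)))"
  using assms by (auto simp: norm_mult norm_power intro!: summable_mult summable_geometric)

lemma qpoch_altdef: "qpoch a q = (\<Prod>n. 1 + - (a * q ^ n))"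
  by (simp add: qpoch_def)

lemma qpoch_eq_0_iff:
  assumes "norm q < 1"
  shows "qpoch a q = 0 \<longleftrightarrow> (\<exists>n. a * q ^ n = 1)"
  using prodinf_one_plus_eq_0_iff[OF summable_qpoch[OF assms], of a]
  by (simp add: qpoch_altdef eq_commute[of 1])

lemma qpoch_rec:
  assumes "norm q < 1"
  shows "qpoch a q = (1 - a) * qpoch (a * q) q"
proof -
  have "(\<lambda>N. \<Prod>n<Suc N. 1 + - (a * q ^ n)) \<longlonglongrightarrow> qpoch a q"
    unfolding qpoch_altdef
    by (rule LIMSEQ_Suc[OF prodinf_one_plus_LIMSEQ[OF summable_qpoch[OF assms]]])
  moreover have "(\<lambda>N. (1 - a) * (\<Prod>n<N. 1 + - (a * q * q ^ n))) \<longlonglongrightarrow> (1 - a) * qpoch (a * q) q"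
    unfolding qpoch_altdef
    by (intro tendsto_mult tendsto_const prodinf_one_plus_LIMSEQ[OF summable_qpoch[OF assms]])
  moreover have "(\<Prod>n<Suc N. 1 + - (a * q ^ n)) = (1 - a) * (\<Prod>n<N. 1 + - (a * q * q ^ n))" for N
    by (subst prod.lessThan_Suc_shift) (simp add: mult_ac)
  ultimately show ?thesis
    using LIMSEQ_unique by auto
qed

lemma holomorphic_qpoch: 
  assumes "norm q < 1"
  shows "(\<lambda>a. qpoch a q) holomorphic_on UNIV"
  unfolding qpoch_altdef
proof (rule holomorphic_on_prodinf_one_plus)
  fix K :: "complex set" assume "compact K"
  then obtain B where "\<forall>z\<in>K. norm z \<le> B"
    using bounded_iff compact_imp_bounded by blast
  then show "\<exists>M. summable M \<and> (\<forall>n. \<forall>z\<in>K. norm (- (z * q ^ n)) \<le> M n)"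
    using assms
    by (intro exI[of _ "\<lambda>n. B * norm q ^ n"])
       (auto simp: norm_mult norm_power intro!: summable_mult summable_geometric mult_right_mono)
qed (auto intro!: holomorphic_intros)

text \<open>Here the nome varies, not just the first argument. On a compact subset of the disc the
  norm of w is at most some r < 1, and \<open>k > 0\<close> bounds the n-th term by a multiple of
  r^n. That w = 0 is included later yields meromorphy at the cusps and the power series in
  q.\<close>

lemma holomorphic_qpoch_nome:
  assumes "l > 0" "k > 0"
  shows "(\<lambda>w. qpoch (c * w ^ l) (w ^ k)) holomorphic_on ball 0 1"
  unfolding qpoch_altdef
proof (rule holomorphic_on_prodinf_one_plus)
  fix K :: "complex set" assume K: "compact K" "K \<subseteq> ball 0 1"
  obtain r where r: "0 \<le> r" "r < 1" "\<And>w. w \<in> K \<Longrightarrow> norm w \<le> r"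
  proof (cases "K = {}")
    case False
    then obtain x where "x \<in> K" "\<forall>y\<in>K. norm y \<le> norm x"
      using continuous_attains_sup[OF K(1), of norm] by (auto intro: continuous_intros)
    then show ?thesis
      using K that[of "norm x"] by auto
  qed (use that[of 0] in auto)
  show "\<exists>M. summable M \<and> (\<forall>n. \<forall>w\<in>K. norm (- (c * w ^ l * (w ^ k) ^ n)) \<le> M n)"
  proof (intro exI conjI allI ballI)
    show "summable (\<lambda>n. norm c * r ^ n)"
      using r by (intro summable_mult summable_geometric) auto
    fix n w assume "w \<in> K"
    then have w: "norm w \<le> r" "norm w \<le> 1"
      using r by force+
    have "norm w ^ (l + k * n) \<le> norm w ^ n"
      using w \<open>k > 0\<close> by (intro power_decreasing) (auto simp: trans_le_add2)
    also have "\<dots> \<le> r ^ n"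
      using w by (intro power_mono) auto
    finally show "norm (- (c * w ^ l * (w ^ k) ^ n)) \<le> norm c * r ^ n"
      by (auto simp: norm_mult norm_power power_add power_mult mult_left_mono mult.assoc)
  qed
qed (auto intro!: holomorphic_intros)

text \<open>The factors are 1 - c w^(l + k n) with positive exponents, and a number of norm less
  than 1 is not 1.\<close>

lemma qpoch_nome_nonzero:
  assumes "norm c = 1" "l > 0" "k > 0" "norm w < 1"
  shows "qpoch (c * w ^ l) (w ^ k) \<noteq> 0"
proof -
  have less: "norm (w ^ m) < 1" if "m > 0" for m
    using assms that by (auto simp: norm_power power_less_one_iff)
  have "c * w ^ l * (w ^ k) ^ n \<noteq> 1" for n
  proof
    assume "c * w ^ l * (w ^ k) ^ n = 1"
    then have "c * w ^ (l + k * n) = 1"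
      by (simp add: power_add power_mult mult.assoc)
    then have "norm (w ^ (l + k * n)) = 1"
      using assms(1) by (metis mult_1 norm_mult norm_one)
    then show False
      using less[of "l + k * n"] \<open>l > 0\<close> by simp
  qed
  then show ?thesis
    using less[OF \<open>k > 0\<close>] by (simp add: qpoch_eq_0_iff)
qed

section \<open>The theta function and elliptic functions\<close>

text \<open>The variable q is \<open>ee \<tau>\<close>; the theta constants are written in the nome
  w = \<open>ee (\<tau> / 2)\<close>, a square root of q.\<close>

definition ee :: "complex \<Rightarrow> complex" where
  "ee z = exp (2 * of_real pi * \<i> * z)"

lemma ee_add: "ee (x + y) = ee x * ee y"
  by (simp add: ee_def exp_add ring_distribs)

lemma ee_diff: "ee (x - y) = ee x / ee y"
  by (simp add: ee_def exp_diff ring_distribs)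

lemma ee_minus: "ee (- x) = inverse (ee x)"
  by (simp add: ee_def exp_minus)

lemma ee_nonzero [simp]: "ee x \<noteq> 0"
  by (simp add: ee_def)

lemma ee_0 [simp]: "ee 0 = 1"
  by (simp add: ee_def)

lemma ee_power: "ee x ^ n = ee (of_nat n * x)"
  by (simp add: ee_def mult_ac flip: exp_of_nat_mult)

lemma ee_of_int [simp]: "ee (of_int n) = 1"
  by (simp add: ee_def exp_eq_1)

lemma ee_1 [simp]: "ee 1 = 1"
  using ee_of_int[of 1] by simp

lemma ee_numeral [simp]: "ee (numeral n) = 1"
  using ee_of_int[of "numeral n"] by simp

lemma ee_half [simp]: "ee (1 / 2) = -1"
  by (simp add: ee_def)

lemma ee_eq_1_iff: "ee z = 1 \<longleftrightarrow> (\<exists>n. z = of_int n)"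
proof
  assume "ee z = 1"
  then obtain n :: int where n: "Re (2 * of_real pi * \<i> * z) = 0"
    "Im (2 * of_real pi * \<i> * z) = real_of_int (2 * n) * pi"
    unfolding ee_def exp_eq_1 by blast
  then have "Im z = 0" "Re z = of_int n"
    by (auto simp: field_simps)
  then show "\<exists>n. z = of_int n"
    by (intro exI[of _ n]) (simp add: complex_eq_iff)
qed auto

lemma norm_ee: "norm (ee z) = exp (- (2 * pi * Im z))"
  by (simp add: ee_def)

lemma norm_ee_less_1: "Im z > 0 \<Longrightarrow> norm (ee z) < 1"
  by (simp add: norm_ee)

lemma holomorphic_on_ee [holomorphic_intros]:
  "f holomorphic_on A \<Longrightarrow> (\<lambda>z. ee (f z)) holomorphic_on A"
  unfolding ee_def by (intro holomorphic_intros)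

lemma periodic_of_int:
  fixes f :: "complex \<Rightarrow> 'a"
  assumes "\<And>z. f (z + p) = f z"
  shows "f (z + of_int n * p) = f z"
proof (induction n rule: int_induct[where k = 0])
  case (step1 i)
  show ?case using assms[of "z + of_int i * p"] step1 by (simp add: algebra_simps)
next
  case (step2 i)
  show ?case using assms[of "z + of_int i * p - p"] step2 by (simp add: algebra_simps)
qed simp

text \<open>All values are already taken on the compact fundamental parallelogram \<open>P\<close>,
  so the function is bounded and Liouville's theorem applies.\<close>

lemma doubly_periodic_entire_imp_constant:
  assumes holo: "f holomorphic_on UNIV" and \<tau>: "Im \<tau> > 0"
    and 1: "\<And>z. f (z + 1) = f z" and 2: "\<And>z. f (z + \<tau>) = f z"
  shows "\<exists>c. \<forall>z. f z = c"
proof -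
  have per1: "f (z + of_int n) = f z" for z n
    using periodic_of_int[of f 1, OF 1] by simp
  have per2: "f (z + of_int n * \<tau>) = f z" for z n
    using periodic_of_int[of f \<tau>, OF 2] .
  define P where "P = (\<lambda>(a, b). of_real a * \<tau> + of_real b) ` ({0..1} \<times> {0..1})"
  have "compact P"
    unfolding P_def by (intro compact_continuous_image compact_Times)
      (auto intro!: continuous_intros simp: case_prod_unfold)
  then have "bounded (f ` P)"
    using holo by (intro compact_imp_bounded compact_continuous_image holomorphic_on_imp_continuous_on)
      (auto intro: holomorphic_on_subset)
  moreover have "range f \<subseteq> f ` P"
  proof safe
    fix z
    define a where "a = Im z / Im \<tau>"
    define b where "b = Re z - a * Re \<tau>"
    have z: "z = of_real a * \<tau> + of_real b"
      using \<tau> by (simp add: complex_eq_iff a_def b_def)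
    have "f z = f (of_real (frac a) * \<tau> + of_real (frac b) + of_int \<lfloor>b\<rfloor> + of_int \<lfloor>a\<rfloor> * \<tau>)"
      by (rule arg_cong[of _ _ f]) (simp add: z frac_def algebra_simps)
    then have "f z = f (of_real (frac a) * \<tau> + of_real (frac b))"
      by (simp only: per1 per2)
    moreover have "of_real (frac a) * \<tau> + of_real (frac b) \<in> P"
      unfolding P_def by (intro image_eqI[of _ _ "(frac a, frac b)"]) (auto simp: frac_lt_1 less_imp_le)
    ultimately show "f z \<in> f ` P"
      by auto
  qed
  ultimately have "f constant_on UNIV"
    using Liouville_theorem[OF holo] bounded_subset by blast
  then show ?thesis
    by (auto simp: constant_on_def)
qed

text \<open>
  Off the zeros of \<open>s\<close> the quotient \<open>f / s\<close> is elliptic; the zeros of \<open>s\<close> form a single orbit of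
  simple zeros under the lattice, and at one of them \<open>f\<close> vanishes too.
\<close>

lemma quasi_periodic_proportional:
  assumes f: "f holomorphic_on UNIV" and s: "s holomorphic_on UNIV" and \<tau>: "Im \<tau> > 0"
    and zero: "f 0 = 0" "s 0 = 0" "deriv s 0 \<noteq> 0"
    and zeros: "\<And>z. s z = 0 \<Longrightarrow> \<exists>m n. z = of_int m * \<tau> + of_int n"
    and f1: "\<And>z. f (z + 1) = a z * f z" and s1: "\<And>z. s (z + 1) = a z * s z"
    and f2: "\<And>z. f (z + \<tau>) = b z * f z" and s2: "\<And>z. s (z + \<tau>) = b z * s z"
    and ab: "\<And>z. a z \<noteq> 0" "\<And>z. b z \<noteq> 0"
  shows "\<exists>K. \<forall>z. s z \<noteq> 0 \<longrightarrow> f z = K * s z"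
proof -
  \<comment> \<open>The value at the zeros of \<open>s\<close> is the limit of f / s at 0. It is
    right at every zero, because each zero is a lattice point and \<open>h\<close> is periodic;
    differentiability at 0 is carried to the other zeros in the same way.\<close>
  define h where "h z = (if s z = 0 then deriv f 0 / deriv s 0 else f z / s z)" for z
  have h1: "h (z + 1) = h z" for z
    using ab(1)[of z] by (simp add: h_def f1 s1)
  have h2: "h (z + \<tau>) = h z" for z
    using ab(2)[of z] by (simp add: h_def f2 s2)
  have per: "h (z + (of_int m * \<tau> + of_int n)) = h z" for z m n
    using periodic_of_int[of h 1 "z + of_int m * \<tau>" n, OF h1] periodic_of_int[of h \<tau> z m, OF h2]
    by (simp add: add.assoc)
  have fs0: "((\<lambda>z. g z / z) \<longlongrightarrow> deriv g 0) (at 0)" if "g holomorphic_on UNIV" "g 0 = 0" for g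
    using that holomorphic_derivI[of g UNIV 0] by (simp add: has_field_derivative_iff)
  have nz: "\<forall>\<^sub>F z in at 0. s z \<noteq> 0"
    using tendsto_imp_eventually_ne[OF fs0[OF s zero(2)] zero(3)]
    by eventually_elim auto
  then obtain e where e: "e > 0" "\<And>z. z \<noteq> 0 \<Longrightarrow> dist z 0 < e \<Longrightarrow> s z \<noteq> 0"
    by (auto simp: eventually_at)
  have holo0: "h holomorphic_on ball 0 e"
  proof (rule no_isolated_singularity'[of "{0}"])
    show "h holomorphic_on ball 0 e - {0}"
    proof (rule holomorphic_transform)
      show "(\<lambda>z. f z / s z) holomorphic_on ball 0 e - {0}"
        using e by (intro holomorphic_intros holomorphic_on_subset[OF f] holomorphic_on_subset[OF s])
          (auto simp: dist_commute)
    qed (use e in \<open>auto simp: h_def dist_commute\<close>)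
    fix z :: complex assume "z \<in> {0}"
    have "((\<lambda>z. (f z / z) / (s z / z)) \<longlongrightarrow> deriv f 0 / deriv s 0) (at 0)"
      by (intro tendsto_divide fs0 f s zero)
    moreover have "\<forall>\<^sub>F z in at 0. (f z / z) / (s z / z) = h z"
      using nz eventually_neq_at_within[of 0] by eventually_elim (auto simp: h_def)
    ultimately have "(h \<longlongrightarrow> deriv f 0 / deriv s 0) (at 0)"
      by (rule Lim_transform_eventually)
    then show "(h \<longlongrightarrow> h z) (at z within ball 0 e)"
      using \<open>z \<in> {0}\<close> zero e(1) by (simp add: h_def at_within_open[of _ "ball 0 e"])
  qed auto
  have "h field_differentiable at z" for z
  proof (cases "s z = 0")
    case True
    then obtain m n where z: "z = of_int m * \<tau> + of_int n"
      using zeros by blast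
    have "h field_differentiable at 0"
      using holo0 e(1) by (simp add: holomorphic_on_open field_differentiable_def)
    then have "(\<lambda>w. h (w - z)) field_differentiable at z"
      using field_differentiable_compose[of "\<lambda>w. w - z" z h]
      by (simp add: o_def field_differentiable_diff)
    moreover have "h (w - z) = h w" for w
      using per[of "w - z" m n] by (simp flip: z)
    ultimately show ?thesis
      by simp
  next
    case False
    have op: "open {z. s z \<noteq> 0}"
      using s holomorphic_on_imp_continuous_on by (intro open_Collect_neq) auto
    have "(\<lambda>z. f z / s z) holomorphic_on {z. s z \<noteq> 0}"
      by (intro holomorphic_intros holomorphic_on_subset[OF f] holomorphic_on_subset[OF s]) auto
    then have "h holomorphic_on {z. s z \<noteq> 0}"
      by (rule holomorphic_transform) (auto simp: h_def)
    with op False show ?thesis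
      by (simp add: holomorphic_on_open field_differentiable_def)
  qed
  then have "h holomorphic_on UNIV"
    by (simp add: holomorphic_on_def)
  then obtain c where c: "\<And>z. h z = c"
    using doubly_periodic_entire_imp_constant[OF _ \<tau> h1 h2] by blast
  have "f z = c * s z" if "s z \<noteq> 0" for z
    using c[of z] that by (auto simp: h_def field_simps)
  then show ?thesis
    by blast
qed

text \<open>Jacobi's \<theta>_1 up to a nonzero factor depending on \<tau> alone. The factor
  \<open>ee (- z / 2)\<close> balances the two products, so that the shift by 1 only changes the
  sign.\<close>

definition jtheta :: "complex \<Rightarrow> complex \<Rightarrow> complex" where
  "jtheta \<tau> z = ee (- z / 2) * qpoch (ee z) (ee \<tau>) * qpoch (ee (\<tau> - z)) (ee \<tau>)"

lemma jtheta_plus_1: "jtheta \<tau> (z + 1) = - jtheta \<tau> z"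
proof -
  have "- (z + 1) / 2 = - z / 2 - 1 / 2"
    by (simp add: diff_divide_distrib)
  then have "ee (- (z + 1) / 2) = - ee (- z / 2)"
    by (simp only: ee_diff ee_half) simp
  moreover have "ee (\<tau> - (z + 1)) = ee (\<tau> - z)"
    using ee_diff[of "\<tau> - z" 1] by (simp add: algebra_simps)
  ultimately show ?thesis
    by (simp add: jtheta_def ee_add)
qed

text \<open>The shift by \<tau> removes the factor 1 - e(z) from the first product and adds the
  factor 1 - e(-z) to the second; the quotient of these two is the monomial -e(-z).\<close>

lemma jtheta_plus_tau:
  assumes "Im \<tau> > 0"
  shows "jtheta \<tau> (z + \<tau>) = - ee (- z - \<tau> / 2) * jtheta \<tau> z"
proof -
  have q: "norm (ee \<tau>) < 1"
    using assms by (rule norm_ee_less_1)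
  have 1: "ee (- (z + \<tau>) / 2) = ee (- z / 2) * ee (- \<tau> / 2)"
    by (simp add: ee_add[symmetric] diff_divide_distrib)
  have 2: "qpoch (ee z) (ee \<tau>) = (1 - ee z) * qpoch (ee (z + \<tau>)) (ee \<tau>)"
    by (subst qpoch_rec[OF q]) (simp add: ee_add)
  have 3: "qpoch (ee (\<tau> - (z + \<tau>))) (ee \<tau>) = (1 - ee (- z)) * qpoch (ee (\<tau> - z)) (ee \<tau>)"
    by (subst qpoch_rec[OF q]) (simp add: ee_minus ee_diff field_simps)
  have 4: "ee (- z - \<tau> / 2) = ee (- z) * ee (- \<tau> / 2)"
    by (simp flip: ee_add)
  have 5: "ee z * ee (- z) = 1"
    by (simp flip: ee_add)
  have 6: "1 - ee (- z) = - ee (- z) * (1 - ee z)"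
    using 5 by (simp add: algebra_simps)
  show ?thesis
    unfolding jtheta_def 1 2 3 4 6
    by (simp only: mult_minus_left mult_minus_right mult.assoc mult.commute mult.left_commute)
qed

lemma jtheta_minus_tau:
  assumes "Im \<tau> > 0"
  shows "jtheta \<tau> (z - \<tau>) = - ee (z - \<tau> / 2) * jtheta \<tau> z"
proof -
  have eq: "jtheta \<tau> z = - ee (- z + \<tau> / 2) * jtheta \<tau> (z - \<tau>)"
    using jtheta_plus_tau[OF assms, of "z - \<tau>"] by (simp add: algebra_simps)
  have "ee (z - \<tau> / 2) * ee (- z + \<tau> / 2) = 1"
    by (simp flip: ee_add)
  then show ?thesis
    unfolding eq by (simp flip: mult.assoc)
qed

lemma jtheta_eq_0:
  assumes "Im \<tau> > 0" "jtheta \<tau> z = 0"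
  shows "\<exists>m n. z = of_int m * \<tau> + of_int n"
proof -
  have "(\<exists>n. ee (z + of_nat n * \<tau>) = 1) \<or> (\<exists>n. ee (\<tau> - z + of_nat n * \<tau>) = 1)"
    using assms by (auto simp: jtheta_def qpoch_eq_0_iff[OF norm_ee_less_1] ee_power ee_add)
  then show ?thesis
    unfolding ee_eq_1_iff
  proof (elim disjE exE)
    fix n k assume "z + of_nat n * \<tau> = of_int k"
    then have "z = of_int (- int n) * \<tau> + of_int k"
      by (simp add: algebra_simps)
    then show ?thesis by blast
  next
    fix n k assume "\<tau> - z + of_nat n * \<tau> = of_int k"
    then have "z = of_int (int n + 1) * \<tau> + of_int (- k)"
      by (simp add: algebra_simps)
    then show ?thesis by blast
  qed
qed

lemma holomorphic_on_qpoch: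
  assumes "norm q < 1" "f holomorphic_on A"
  shows "(\<lambda>z. qpoch (f z) q) holomorphic_on A"
  using holomorphic_on_compose[OF assms(2), of "\<lambda>a. qpoch a q"]
    holomorphic_on_subset[OF holomorphic_qpoch[OF assms(1)]]
  by (auto simp: o_def)

lemma holomorphic_jtheta:
  assumes "Im \<tau> > 0" "f holomorphic_on A"
  shows "(\<lambda>z. jtheta \<tau> (f z)) holomorphic_on A"
  unfolding jtheta_def
  by (intro holomorphic_intros holomorphic_on_qpoch norm_ee_less_1 assms) auto

lemma
  assumes "Im \<tau> > 0"
  shows jtheta_0: "jtheta \<tau> 0 = 0" and deriv_jtheta_0: "deriv (jtheta \<tau>) 0 \<noteq> 0"
proof -
  have q: "norm (ee \<tau>) < 1"
    using assms by (rule norm_ee_less_1)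
  \<comment> \<open>The vanishing factor 1 - e(z) is split off; what remains at 0 is the square of
    \<open>qpoch (ee \<tau>) (ee \<tau>)\<close>, which is nonzero, so the zero is simple.\<close>
  define r where "r z = ee (- z / 2) * qpoch (ee (z + \<tau>)) (ee \<tau>) * qpoch (ee (\<tau> - z)) (ee \<tau>)" for z
  have jtheta_eq: "jtheta \<tau> z = (1 - ee z) * r z" for z
    using qpoch_rec[OF q, of "ee z"] by (simp add: jtheta_def r_def ee_add)
  then show "jtheta \<tau> 0 = 0"
    by simp
  have "r holomorphic_on UNIV"
    unfolding r_def by (intro holomorphic_intros holomorphic_on_qpoch q) auto
  then have r: "(r has_field_derivative deriv r 0) (at 0)"
    by (simp add: holomorphic_derivI)
  have "((\<lambda>z. (1 - ee z) * r z) has_field_derivative - (2 * of_real pi * \<i>) * r 0) (at 0)"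
    unfolding ee_def by (rule derivative_eq_intros r refl | simp)+
  then have "deriv (jtheta \<tau>) 0 = - (2 * of_real pi * \<i>) * r 0"
    unfolding jtheta_eq[abs_def, symmetric] by (rule DERIV_imp_deriv)
  moreover have "qpoch (ee \<tau>) (ee \<tau>) \<noteq> 0"
    using qpoch_nome_nonzero[of 1 1 1 "ee \<tau>"] q by simp
  then have "r 0 \<noteq> 0"
    by (simp add: r_def)
  ultimately show "deriv (jtheta \<tau>) 0 \<noteq> 0"
    by simp
qed

lemma Im_S_pos: "Im \<tau> > 0 \<Longrightarrow> Im (- 1 / \<tau>) > 0"
  by (auto simp: Im_divide add_nonneg_pos intro!: divide_pos_pos)

text \<open>Jacobi's imaginary transformation with an undetermined constant. In z / \<tau> the shift
  of z by \<tau> is a shift by 1, and the shift of z by 1 is a shift by minus the new period -1 /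
  \<tau>. The Gaussian factor is the one that makes both multipliers agree with those of
  \<open>jtheta \<tau>\<close>.\<close>

lemma jtheta_S:
  assumes \<tau>: "Im \<tau> > 0"
  shows "\<exists>K. \<forall>z. jtheta \<tau> z \<noteq> 0 \<longrightarrow> jtheta (- 1 / \<tau>) (z / \<tau>) * ee (- z\<^sup>2 / (2 * \<tau>)) = K * jtheta \<tau> z"
proof (rule quasi_periodic_proportional[where \<tau> = \<tau> and a = "\<lambda>_. -1" and b = "\<lambda>z. - ee (- z - \<tau> / 2)"])
  have nz: "\<tau> \<noteq> 0" using \<tau> by auto
  note \<tau>' = Im_S_pos[OF \<tau>]
  show "(\<lambda>z. jtheta (- 1 / \<tau>) (z / \<tau>) * ee (- z\<^sup>2 / (2 * \<tau>))) holomorphic_on UNIV"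
    using nz by (intro holomorphic_intros holomorphic_jtheta \<tau>') auto
  show "jtheta \<tau> holomorphic_on UNIV"
    using holomorphic_jtheta[OF \<tau>, of "\<lambda>z. z"] by simp
  show "jtheta (- 1 / \<tau>) ((z + \<tau>) / \<tau>) * ee (- (z + \<tau>)\<^sup>2 / (2 * \<tau>)) =
      - ee (- z - \<tau> / 2) * (jtheta (- 1 / \<tau>) (z / \<tau>) * ee (- z\<^sup>2 / (2 * \<tau>)))" for z
  proof -
    have "- (z + \<tau>)\<^sup>2 / (2 * \<tau>) = (- z - \<tau> / 2) + (- z\<^sup>2 / (2 * \<tau>))"
      using nz by (simp add: field_simps power2_eq_square)
    then have "ee (- (z + \<tau>)\<^sup>2 / (2 * \<tau>)) = ee (- z - \<tau> / 2) * ee (- z\<^sup>2 / (2 * \<tau>))"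
      by (simp only: ee_add)
    moreover have "(z + \<tau>) / \<tau> = z / \<tau> + 1"
      using nz by (simp add: field_simps)
    ultimately show ?thesis
      by (simp add: jtheta_plus_1)
  qed
  show "jtheta (- 1 / \<tau>) ((z + 1) / \<tau>) * ee (- (z + 1)\<^sup>2 / (2 * \<tau>)) =
      - 1 * (jtheta (- 1 / \<tau>) (z / \<tau>) * ee (- z\<^sup>2 / (2 * \<tau>)))" for z
  proof -
    have "jtheta (- 1 / \<tau>) ((z + 1) / \<tau>) = jtheta (- 1 / \<tau>) (z / \<tau> - (- 1 / \<tau>))"
      by (simp add: add_divide_distrib)
    also have "\<dots> = - ee (z / \<tau> - (- 1 / \<tau>) / 2) * jtheta (- 1 / \<tau>) (z / \<tau>)"
      by (rule jtheta_minus_tau[OF \<tau>'])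
    finally have 1: "jtheta (- 1 / \<tau>) ((z + 1) / \<tau>) =
      - ee (z / \<tau> - (- 1 / \<tau>) / 2) * jtheta (- 1 / \<tau>) (z / \<tau>)" .
    have "(z / \<tau> - (- 1 / \<tau>) / 2) + - (z + 1)\<^sup>2 / (2 * \<tau>) = - z\<^sup>2 / (2 * \<tau>)"
      using nz by (simp add: field_simps power2_eq_square)
    then have 2: "ee (- z\<^sup>2 / (2 * \<tau>)) = ee (z / \<tau> - (- 1 / \<tau>) / 2) * ee (- (z + 1)\<^sup>2 / (2 * \<tau>))"
      by (simp only: ee_add[symmetric])
    show ?thesis
      unfolding 1 2 by (simp only: mult_minus_left mult_1 mult.assoc mult.left_commute)
  qed
qed (use \<tau> Im_S_pos[OF \<tau>] in \<open>auto simp: jtheta_0 deriv_jtheta_0 jtheta_plus_1 jtheta_plus_tau dest: jtheta_eq_0\<close>)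

section \<open>Theta constants and their quotients\<close>

text \<open>
  In terms of \<open>w = exp (\<pi>i\<tau>)\<close>, these are the eighth powers of the three Jacobi theta constants,
  divided by \<open>\<Prod>(1 - w\<^sup>2\<^sup>n)\<^sup>8\<close>.
\<close>

definition theta2 :: "complex \<Rightarrow> complex" where
  "theta2 w = 256 * w ^ 2 * qpoch (- (w ^ 2)) (w ^ 2) ^ 16"

definition theta3 :: "complex \<Rightarrow> complex" where
  "theta3 w = qpoch (- w) (w ^ 2) ^ 16"

definition theta4 :: "complex \<Rightarrow> complex" where
  "theta4 w = qpoch w (w ^ 2) ^ 16"

lemma theta_nonzero:
  assumes "norm w < 1"
  shows "w \<noteq> 0 \<Longrightarrow> theta2 w \<noteq> 0" "theta3 w \<noteq> 0" "theta4 w \<noteq> 0"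
  using qpoch_nome_nonzero[of "-1" 2 2 w] qpoch_nome_nonzero[of "-1" 1 2 w]
    qpoch_nome_nonzero[of 1 1 2 w] assms
  by (auto simp: theta2_def theta3_def theta4_def)

lemma holomorphic_theta:
  "theta2 holomorphic_on ball 0 1" "theta3 holomorphic_on ball 0 1" "theta4 holomorphic_on ball 0 1"
  using holomorphic_qpoch_nome[of 2 2 "-1"] holomorphic_qpoch_nome[of 1 2 "-1"]
    holomorphic_qpoch_nome[of 1 2 1]
  unfolding theta2_def[abs_def] theta3_def[abs_def] theta4_def[abs_def]
  by (auto intro!: holomorphic_intros)

lemma theta_minus: "theta2 (- w) = theta2 w" "theta3 (- w) = theta4 w" "theta4 (- w) = theta3 w"
  by (simp_all add: theta2_def theta3_def theta4_def)

text \<open>At a half period both products become one of the products in the theta constants. The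
  eighth power turns the prefactor \<open>ee (- z / 2)\<close> into a power of
  \<open>ee \<tau>\<close> and hides the sign change under z - 1, so representatives differing by 1
  share a value. Both are listed because division by \<tau> in \<open>theta_S\<close> meets
  both.\<close>

lemma jtheta_half_periods:
  assumes "Im \<tau> > 0"
  shows "jtheta \<tau> (1 / 2) ^ 8 = ee (- \<tau>) * theta2 (ee (\<tau> / 2))"
    and "jtheta \<tau> (- 1 / 2) ^ 8 = ee (- \<tau>) * theta2 (ee (\<tau> / 2))"
    and "jtheta \<tau> ((\<tau> + 1) / 2) ^ 8 = ee (- 2 * \<tau>) * theta3 (ee (\<tau> / 2))"
    and "jtheta \<tau> ((\<tau> - 1) / 2) ^ 8 = ee (- 2 * \<tau>) * theta3 (ee (\<tau> / 2))"
    and "jtheta \<tau> (\<tau> / 2) ^ 8 = ee (- 2 * \<tau>) * theta4 (ee (\<tau> / 2))"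
proof -
  define w where "w = ee (\<tau> / 2)"
  have w2: "w ^ 2 = ee \<tau>"
    by (simp add: w_def ee_power)
  have e12: "ee (- 1 / 2) = -1"
    using ee_minus[of "1/2"] by simp
  have shift: "jtheta \<tau> (z - 1) ^ 8 = jtheta \<tau> z ^ 8" for z
    using jtheta_plus_1[of \<tau> "z - 1"] by simp
  have "ee (\<tau> - 1 / 2) = - ee \<tau>"
    by (simp add: ee_diff)
  then have "jtheta \<tau> (1 / 2) = ee (- 1 / 4) * (qpoch (-1) (ee \<tau>) * qpoch (- ee \<tau>) (ee \<tau>))"
    by (simp add: jtheta_def)
  \<comment> \<open>The first factor 1 - (-1) = 2 is the origin of 256 = 2^8 in
    \<open>theta2\<close>.\<close>
  also have "qpoch (-1) (ee \<tau>) = 2 * qpoch (- ee \<tau>) (ee \<tau>)"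
    by (subst qpoch_rec) (use norm_ee_less_1[OF assms] in auto)
  finally have "jtheta \<tau> (1 / 2) ^ 8 = ee (- 1 / 4) ^ 8 * 256 * qpoch (- ee \<tau>) (ee \<tau>) ^ 16"
    by (simp add: power_mult_distrib flip: power_mult power_add)
  moreover have "ee (- 1 / 4) ^ 8 = ee (of_int (-2))"
    by (simp add: ee_power)
  ultimately show 1: "jtheta \<tau> (1 / 2) ^ 8 = ee (- \<tau>) * theta2 (ee (\<tau> / 2))"
    by (simp add: theta2_def w2[unfolded w_def] ee_minus)
  show "jtheta \<tau> (- 1 / 2) ^ 8 = ee (- \<tau>) * theta2 (ee (\<tau> / 2))"
    using shift[of "1 / 2"] 1 by simp
  have 3: "ee ((\<tau> + 1) / 2) = - w"
    by (simp add: w_def add_divide_distrib ee_add)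
  have "\<tau> - (\<tau> + 1) / 2 = \<tau> / 2 - 1 / 2"
    by (simp add: field_simps)
  then have "ee (\<tau> - (\<tau> + 1) / 2) = - w"
    by (simp add: w_def ee_diff)
  with 3 have "jtheta \<tau> ((\<tau> + 1) / 2) ^ 8 = ee (- ((\<tau> + 1) / 2) / 2) ^ 8 * qpoch (- w) (w ^ 2) ^ 16"
    by (simp add: jtheta_def w2 power_mult_distrib flip: power_mult power_add)
  also have "ee (- ((\<tau> + 1) / 2) / 2) ^ 8 = ee (- 2 * \<tau> - of_int 2)"
    unfolding ee_power by (rule arg_cong[of _ _ ee]) (simp add: field_simps)
  finally show 3: "jtheta \<tau> ((\<tau> + 1) / 2) ^ 8 = ee (- 2 * \<tau>) * theta3 (ee (\<tau> / 2))"
    by (simp add: theta3_def ee_diff w_def del: of_int_numeral)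
  have "(\<tau> - 1) / 2 = (\<tau> + 1) / 2 - 1"
    by (simp add: field_simps)
  then show "jtheta \<tau> ((\<tau> - 1) / 2) ^ 8 = ee (- 2 * \<tau>) * theta3 (ee (\<tau> / 2))"
    by (simp only: shift 3)
  have "\<tau> - \<tau> / 2 = \<tau> / 2"
    by (simp add: field_simps)
  then have "jtheta \<tau> (\<tau> / 2) ^ 8 = ee (- (\<tau> / 2) / 2) ^ 8 * qpoch w (w ^ 2) ^ 16"
    by (simp add: jtheta_def w2 power_mult_distrib flip: w_def power_mult power_add)
  also have "ee (- (\<tau> / 2) / 2) ^ 8 = ee (- 2 * \<tau>)"
    by (simp add: ee_power)
  finally show "jtheta \<tau> (\<tau> / 2) ^ 8 = ee (- 2 * \<tau>) * theta4 (ee (\<tau> / 2))"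
    by (simp add: theta4_def w_def)
qed

text \<open>Division by \<tau> maps the half periods of \<tau> to those of -1 / \<tau>: it exchanges
  the ones belonging to \<open>theta2\<close> and \<open>theta4\<close> and keeps the one belonging
  to \<open>theta3\<close>. One \<open>c\<close> serves all three, since the constant from
  \<open>jtheta_S\<close> is independent of z; it is nonzero because the theta constants
  are.\<close>

lemma theta_S:
  assumes \<tau>: "Im \<tau> > 0"
  defines "w \<equiv> ee (\<tau> / 2)" and "w' \<equiv> ee (- 1 / \<tau> / 2)"
  shows "\<exists>c. c \<noteq> 0 \<and> theta2 w' = c * theta4 w \<and> theta3 w' = c * theta3 w \<and> theta4 w' = c * theta2 w"
proof -
  define \<tau>' where "\<tau>' = - 1 / \<tau>"
  have nz: "\<tau> \<noteq> 0" using \<tau> by auto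
  have \<tau>': "Im \<tau>' > 0"
    unfolding \<tau>'_def using \<tau> by (rule Im_S_pos)
  obtain K where "\<And>z. jtheta \<tau> z \<noteq> 0 \<Longrightarrow>
      jtheta \<tau>' (z / \<tau>) * ee (- z\<^sup>2 / (2 * \<tau>)) = K * jtheta \<tau> z"
    using jtheta_S[OF \<tau>] unfolding \<tau>'_def by blast
  then have K: "jtheta \<tau>' (z / \<tau>) ^ 8 * ee (- 4 * z\<^sup>2 / \<tau>) = K ^ 8 * jtheta \<tau> z ^ 8"
    if "jtheta \<tau> z ^ 8 \<noteq> 0" for z
  proof -
    assume *: "\<And>z. jtheta \<tau> z \<noteq> 0 \<Longrightarrow>
      jtheta \<tau>' (z / \<tau>) * ee (- z\<^sup>2 / (2 * \<tau>)) = K * jtheta \<tau> z"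
    have "ee (- 4 * z\<^sup>2 / \<tau>) = ee (- z\<^sup>2 / (2 * \<tau>)) ^ 8"
      by (simp add: ee_power)
    then show ?thesis
      using arg_cong[OF *[of z], of "\<lambda>x. x ^ 8"] that by (simp add: power_mult_distrib)
  qed
  have w'_eq: "w' = ee (\<tau>' / 2)"
    by (simp add: w'_def \<tau>'_def)
  have w: "norm w < 1" "w \<noteq> 0" "norm w' < 1" "w' \<noteq> 0"
    using \<tau> \<tau>' by (auto simp: w_def w'_eq intro!: norm_ee_less_1)
  note nonzero = theta_nonzero[OF w(1)] theta_nonzero[OF w(3)]
  note half = jtheta_half_periods[OF \<tau>, folded w_def]
    jtheta_half_periods[OF \<tau>', folded w'_eq]
  define c where "c = K ^ 8 * ee (\<tau>' - \<tau>)"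
  \<comment> \<open>The signs of the three half periods of \<tau> are chosen so that the quotients
    are exactly the representatives of \<open>jtheta_half_periods\<close> for \<tau>'.\<close>
  have A: "- 1 / 2 / \<tau> = \<tau>' / 2" "\<tau> / 2 / \<tau> = 1 / 2" "(\<tau> - 1) / 2 / \<tau> = (\<tau>' + 1) / 2"
    using nz by (auto simp: \<tau>'_def field_simps)
  have B: "- 4 * (- 1 / 2)\<^sup>2 / \<tau> = \<tau>'" "- 4 * (\<tau> / 2)\<^sup>2 / \<tau> = - \<tau>"
    "- 4 * ((\<tau> - 1) / 2)\<^sup>2 / \<tau> = - \<tau> + \<tau>' + of_int 2"
    using nz by (auto simp: \<tau>'_def field_simps power2_eq_square)
  have e2: "ee (x * 2) = ee x * ee x" for x
    by (simp only: mult_2_right ee_add)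
  have "ee (- 2 * \<tau>') * theta4 w' * ee \<tau>' = K ^ 8 * (ee (- \<tau>) * theta2 w)"
    using K[of "- 1 / 2", unfolded A B half] nonzero w by simp
  then have "theta4 w' = c * theta2 w"
    by (simp add: c_def ee_diff ee_minus e2 field_simps power2_eq_square)
  moreover have "ee (- \<tau>') * theta2 w' * ee (- \<tau>) = K ^ 8 * (ee (- 2 * \<tau>) * theta4 w)"
    using K[of "\<tau> / 2", unfolded A B half] nonzero w by simp
  then have "theta2 w' = c * theta4 w"
    by (simp add: c_def ee_diff ee_minus e2 field_simps power2_eq_square)
  moreover have "ee (- 2 * \<tau>') * theta3 w' * ee (- \<tau> + \<tau>' + of_int 2) = K ^ 8 * (ee (- 2 * \<tau>) * theta3 w)"
    using K[of "(\<tau> - 1) / 2", unfolded A B half] nonzero w by simp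
  then have "theta3 w' = c * theta3 w"
    unfolding ee_add ee_of_int by (simp add: c_def ee_diff ee_minus e2 field_simps power2_eq_square)
  ultimately show ?thesis
    using nonzero by (intro exI[of _ c]) auto
qed

text \<open>
  The parities of \<open>x\<close> and \<open>y\<close> encode the half period \<open>(x\<tau> + y) / 2\<close>, that is, which of the three
  theta constants is squared in the numerator.
\<close>

definition theta_ratio :: "int \<Rightarrow> int \<Rightarrow> complex \<Rightarrow> complex" where
  "theta_ratio x y w =
     (if even x then (if even y then 0 else theta2 w ^ 2 / (theta3 w * theta4 w))
      else if even y then theta4 w ^ 2 / (theta2 w * theta3 w)
      else theta3 w ^ 2 / (theta2 w * theta4 w))"

lemma theta_ratio_parity:
  assumes "even x = even x'" "even y = even y'"
  shows "theta_ratio x y w = theta_ratio x' y' w"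
  using assms by (simp add: theta_ratio_def)

lemma theta_ratio_minus: "theta_ratio x y (- w) = theta_ratio x (x + y) w"
  by (simp add: theta_ratio_def theta_minus mult_ac)

text \<open>Adding an odd integer to \<tau> replaces w by -w, which exchanges \<open>theta3\<close>
  and \<open>theta4\<close>; an even one leaves w unchanged.\<close>

lemma theta_ratio_T: "theta_ratio x y (ee ((\<tau> + of_int k) / 2)) = theta_ratio x (x * k + y) (ee (\<tau> / 2))"
proof (cases "even k")
  case True
  then obtain l where "k = 2 * l" ..
  then have "ee ((\<tau> + of_int k) / 2) = ee (\<tau> / 2)"
    by (simp add: add_divide_distrib ee_add)
  then show ?thesis
    using True by (auto intro!: theta_ratio_parity)
next
  case False
  then obtain l where "k = 2 * l + 1" ..
  then have "(\<tau> + of_int k) / 2 = \<tau> / 2 + of_int l + 1 / 2"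
    by (simp add: add_divide_distrib)
  then have "ee ((\<tau> + of_int k) / 2) = - ee (\<tau> / 2)"
    by (simp only: ee_add ee_half ee_of_int) simp
  then show ?thesis
    using False by (auto simp: theta_ratio_minus intro!: theta_ratio_parity)
qed

text \<open>The factor \<open>c\<close> of \<open>theta_S\<close> cancels, as numerator and
  denominator are both quadratic in the theta constants. The sign of x is immaterial for parities
  and is written to match the action of the matrix S.\<close>

lemma theta_ratio_S:
  assumes "Im \<tau> > 0"
  shows "theta_ratio x y (ee (- 1 / \<tau> / 2)) = theta_ratio y (- x) (ee (\<tau> / 2))"
  using theta_S[OF assms] by (auto simp: theta_ratio_def power2_eq_square)

section \<open>Action of the modular group on the theta quotients\<close>

lemma moebius_denominator_nonzero:
  assumes "Im \<tau> > 0" "a * d - b * c = (1 :: int)"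
  shows "of_int c * \<tau> + of_int d \<noteq> 0"
proof
  assume *: "of_int c * \<tau> + of_int d = 0"
  have "of_int c * Im \<tau> = Im (of_int c * \<tau> + of_int d)"
    by simp
  then have "c = 0"
    using assms(1) by (simp add: *)
  with * assms(2) show False
    by simp
qed

lemma Im_moebius_pos:
  assumes "Im \<tau> > 0" "a * d - b * c = (1 :: int)"
  shows "Im ((of_int a * \<tau> + of_int b) / (of_int c * \<tau> + of_int d)) > 0"
proof -
  define z where "z = of_int c * \<tau> + of_int d"
  have "z \<noteq> 0"
    using moebius_denominator_nonzero[OF assms] by (simp add: z_def)
  have "Im ((of_int a * \<tau> + of_int b) / z) = of_int (a * d - b * c) * Im \<tau> / (norm z)\<^sup>2"
    unfolding Im_divide cmod_power2 by (simp add: z_def algebra_simps)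
  also have "\<dots> > 0"
    using assms \<open>z \<noteq> 0\<close> by simp
  finally show ?thesis
    by (simp add: z_def)
qed

text \<open>The row (x, y) is multiplied by the matrix from the right. The induction on the absolute
  value of c is Euclid's algorithm: with a = k c + r the matrix is T^k S times the matrix with rows
  (c, d) and (-r, -b'), whose lower left entry is smaller. For c = 0 only a translation is left, up
  to signs that do not affect parities.\<close>

lemma theta_ratio_modular:
  assumes "Im \<tau> > 0" "a * d - b * c = (1 :: int)"
  shows "theta_ratio x y (ee ((of_int a * \<tau> + of_int b) / (of_int c * \<tau> + of_int d) / 2)) =
    theta_ratio (x * a + y * c) (x * b + y * d) (ee (\<tau> / 2))"
  using assms(2)
proof (induction "nat \<bar>c\<bar>" arbitrary: a b c d x y rule: less_induct)
  case less
  show ?case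
  proof (cases "c = 0")
    case True
    then have "a * d = 1"
      using less.prems by simp
    then have ad: "a = 1 \<and> d = 1 \<or> a = -1 \<and> d = -1"
      by (auto simp: zmult_eq_1_iff)
    then have "(of_int a * \<tau> + of_int b) / (of_int c * \<tau> + of_int d) = \<tau> + of_int (b * d)"
      using True by auto
    then show ?thesis
      using ad True by (auto simp: theta_ratio_T simp del: of_int_mult intro!: theta_ratio_parity)
  next
    case False
    define k r b' where "k = a div c" and "r = a mod c" and "b' = b - k * d"
    have a: "a = k * c + r"
      by (simp add: k_def r_def)
    have b: "b = k * d + b'"
      by (simp add: b'_def)
    have det: "c * (- b') - d * (- r) = 1"
      using less.prems unfolding a b by (simp add: algebra_simps)
    then have det': "r * d - b' * c = 1"
      by (simp add: algebra_simps)
    define \<tau>1 where "\<tau>1 = (of_int c * \<tau> + of_int d) / (of_int (- r) * \<tau> + of_int (- b'))"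
    have \<tau>1: "Im \<tau>1 > 0"
      unfolding \<tau>1_def by (rule Im_moebius_pos[OF assms(1) det])
    have nz: "of_int c * \<tau> + of_int d \<noteq> 0"
      using moebius_denominator_nonzero[OF assms(1) less.prems] .
    have S: "- 1 / \<tau>1 = (of_int r * \<tau> + of_int b') / (of_int c * \<tau> + of_int d)"
      by (simp add: \<tau>1_def)
    have "(of_int a * \<tau> + of_int b) / (of_int c * \<tau> + of_int d) = - 1 / \<tau>1 + of_int k"
      unfolding S using nz by (simp add: a b field_simps)
    then have "theta_ratio x y (ee ((of_int a * \<tau> + of_int b) / (of_int c * \<tau> + of_int d) / 2)) =
        theta_ratio (x * k + y) (- x) (ee (\<tau>1 / 2))"
      by (simp only: theta_ratio_T theta_ratio_S[OF \<tau>1])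
    also have "nat \<bar>- r\<bar> < nat \<bar>c\<bar>"
      using False by (simp add: r_def abs_mod_less)
    then have "theta_ratio (x * k + y) (- x) (ee (\<tau>1 / 2)) =
        theta_ratio ((x * k + y) * c + (- x) * (- r)) ((x * k + y) * d + (- x) * (- b')) (ee (\<tau> / 2))"
      unfolding \<tau>1_def by (intro less.hyps det)
    also have "(x * k + y) * c + (- x) * (- r) = x * a + y * c"
      by (simp add: a algebra_simps)
    also have "(x * k + y) * d + (- x) * (- b') = x * b + y * d"
      by (simp add: b algebra_simps)
    finally show ?thesis .
  qed
qed

lemma theta_ratio_meromorphic: "theta_ratio x y meromorphic_on {0}"
proof -
  have "g meromorphic_on {0}" if "g holomorphic_on ball 0 1" for g :: "complex \<Rightarrow> complex"
  proof -
    have "g analytic_on ball 0 1"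
      using that by (simp add: analytic_on_open)
    then show ?thesis
      by (intro analytic_on_imp_meromorphic_on) (auto intro: analytic_on_subset)
  qed
  from this[OF holomorphic_theta(1)] this[OF holomorphic_theta(2)] this[OF holomorphic_theta(3)]
  show ?thesis
    unfolding theta_ratio_def[abs_def]
    by (cases "even x"; cases "even y") (auto intro!: meromorphic_intros)
qed

lemma theta_ratio_holomorphic:
  "theta_ratio x y holomorphic_on ball 0 1 - {0}"
proof -
  have "g holomorphic_on ball 0 1 - {0}" if "g holomorphic_on ball 0 1" for g :: "complex \<Rightarrow> complex"
    using that by (rule holomorphic_on_subset) auto
  from this[OF holomorphic_theta(1)] this[OF holomorphic_theta(2)] this[OF holomorphic_theta(3)]
  show ?thesis
    unfolding theta_ratio_def[abs_def]
    by (cases "even x"; cases "even y") (auto intro!: holomorphic_intros simp: theta_nonzero)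
qed

section \<open>Weakly holomorphic modular functions\<close>

lemma det_2x2:
  assumes "A \<in> carrier_mat 2 2"
  shows "Determinant.det A = A $$ (0, 0) * A $$ (1, 1) - A $$ (0, 1) * A $$ (1, 0)"
  using laplace_expansion_row[OF assms, of 0] assms
  by (simp add: numeral_2_eq_2 cofactor_def det_single mat_delete_def)

lemma mult_2x2:
  fixes A B :: "int mat"
  assumes "A \<in> carrier_mat 2 2" "B \<in> carrier_mat 2 2" "i < 2" "j < 2"
  shows "(A * B) $$ (i, j) = A $$ (i, 0) * B $$ (0, j) + A $$ (i, 1) * B $$ (1, j)"
  using assms by (simp add: scalar_prod_def numeral_2_eq_2)

lemma SL2Z_simps: "carrier SL2Z = {A \<in> carrier_mat 2 2. Determinant.det A = 1}"
  "mult SL2Z = (*)" "one SL2Z = 1\<^sub>m 2"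
  by (simp_all add: SL2Z_def)

lemma group_SL2Z: "group SL2Z"
proof (rule groupI)
  fix A assume A: "A \<in> carrier SL2Z"
  then have c: "A \<in> carrier_mat 2 2" "adj_mat A \<in> carrier_mat 2 2"
    by (auto simp: SL2Z_simps adj_mat)
  have "adj_mat A * A = 1\<^sub>m 2"
    using adj_mat(3)[of A 2] A by (auto simp: SL2Z_simps)
  moreover from this have "Determinant.det (adj_mat A) = 1"
    using det_mult[OF c(2,1)] A by (simp add: SL2Z_simps)
  ultimately show "\<exists>B\<in>carrier SL2Z. B \<otimes>\<^bsub>SL2Z\<^esub> A = \<one>\<^bsub>SL2Z\<^esub>"
    using c by (intro bexI[of _ "adj_mat A"]) (auto simp: SL2Z_simps)
qed (auto simp: SL2Z_simps det_mult[of _ 2])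

lemma principal_congruence_subgroup_iff:
  "A \<in> principal_congruence_subgroup N \<longleftrightarrow> A \<in> carrier SL2Z \<and>
     [A $$ (0, 0) = 1] (mod int N) \<and> [A $$ (0, 1) = 0] (mod int N) \<and>
     [A $$ (1, 0) = 0] (mod int N) \<and> [A $$ (1, 1) = 1] (mod int N)"
  unfolding principal_congruence_subgroup_def numeral_2_eq_2
  by (auto simp: less_Suc_eq)

lemma subgroup_principal_congruence: "subgroup (principal_congruence_subgroup N) SL2Z"
proof (rule group.subgroupI[OF group_SL2Z])
  interpret group SL2Z by (rule group_SL2Z)
  let ?P = "principal_congruence_subgroup N"
  have "1\<^sub>m 2 \<in> ?P"
    using one_closed unfolding principal_congruence_subgroup_iff by (simp add: SL2Z_simps)
  then show "?P \<noteq> {}"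
    by blast
  fix A assume A: "A \<in> ?P"
  then have Ac: "A \<in> carrier SL2Z"
    by (simp add: principal_congruence_subgroup_iff)
  \<comment> \<open>Right multiplication by \<open>A\<close> does not change a matrix modulo N.
    Taking the inverse of \<open>A\<close> for \<open>B\<close> gives closure under inverses, taking
    \<open>B\<close> in \<open>?P\<close> gives closure under products.\<close>
  have cong: "[(B * A) $$ (i, j) = B $$ (i, j)] (mod int N)"
    if "B \<in> carrier SL2Z" "i < 2" "j < 2" for B i j
  proof -
    have c: "A \<in> carrier_mat 2 2" "B \<in> carrier_mat 2 2"
      using that Ac by (auto simp: SL2Z_simps)
    have "[A $$ (k, j) = 1\<^sub>m 2 $$ (k, j)] (mod int N)" if "k < 2" for k
      using A \<open>j < 2\<close> that unfolding principal_congruence_subgroup_def by blast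
    then have "[B $$ (i, 0) * A $$ (0, j) + B $$ (i, 1) * A $$ (1, j) =
        B $$ (i, 0) * 1\<^sub>m 2 $$ (0, j) + B $$ (i, 1) * 1\<^sub>m 2 $$ (1, j)] (mod int N)"
      by (intro cong_add cong_mult cong_refl) auto
    then show ?thesis
      using that(3) unfolding mult_2x2[OF c(2,1) that(2,3)] by (auto simp: numeral_2_eq_2 less_Suc_eq)
  qed
  have "inv\<^bsub>SL2Z\<^esub> A * A = 1\<^sub>m 2"
    using l_inv[OF Ac] by (simp add: SL2Z_simps)
  then show "inv\<^bsub>SL2Z\<^esub> A \<in> ?P"
    using cong[OF inv_closed[OF Ac]] inv_closed[OF Ac] cong_sym
    unfolding principal_congruence_subgroup_def mem_Collect_eq by metis
  fix B assume B: "B \<in> ?P"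
  then have Bc: "B \<in> carrier SL2Z"
    by (simp add: principal_congruence_subgroup_iff)
  have "[B $$ (i, j) = 1\<^sub>m 2 $$ (i, j)] (mod int N)" if "i < 2" "j < 2" for i j
    using B that unfolding principal_congruence_subgroup_def by blast
  then have "[(B * A) $$ (i, j) = 1\<^sub>m 2 $$ (i, j)] (mod int N)" if "i < 2" "j < 2" for i j
    using that cong[OF Bc] cong_trans by blast
  then show "B \<otimes>\<^bsub>SL2Z\<^esub> A \<in> ?P"
    using m_closed[OF Bc Ac] unfolding principal_congruence_subgroup_def by (simp add: SL2Z_simps(2))
qed (auto simp: principal_congruence_subgroup_iff)

lemma moebius_action_upper_half_plane:
  assumes "A \<in> carrier SL2Z" "\<tau> \<in> upper_half_plane"
  shows "moebius_action A \<tau> \<in> upper_half_plane"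
proof -
  have "A $$ (0, 0) * A $$ (1, 1) - A $$ (0, 1) * A $$ (1, 0) = 1"
    using assms(1) by (simp only: SL2Z_simps mem_Collect_eq flip: det_2x2)
  then show ?thesis
    using Im_moebius_pos assms(2) unfolding upper_half_plane_def moebius_action_def by blast
qed

lemma congruence_subgroup_Int:
  assumes "congruence_subgroup \<Gamma>" "congruence_subgroup \<Delta>"
  shows "congruence_subgroup (\<Gamma> \<inter> \<Delta>)"
proof -
  obtain M N where MN: "M > 0" "N > 0" "principal_congruence_subgroup M \<subseteq> \<Gamma>"
      "principal_congruence_subgroup N \<subseteq> \<Delta>"
    using assms by (auto simp: congruence_subgroup_def)
  have "principal_congruence_subgroup (M * N) \<subseteq> principal_congruence_subgroup M"
    "principal_congruence_subgroup (M * N) \<subseteq> principal_congruence_subgroup N"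
    unfolding principal_congruence_subgroup_iff subset_iff
    using cong_dvd_modulus[of _ _ "int (M * N)" "int M"] cong_dvd_modulus[of _ _ "int (M * N)" "int N"] by auto
  then show ?thesis
    using assms MN group.subgroups_Inter_pair[OF group_SL2Z]
    unfolding congruence_subgroup_def by (intro conjI exI[of _ "M * N"]) auto
qed

text \<open>Widths M and N are brought to the common width M N, whose local parameter has the
  parameters of widths M and N as its N-th and M-th powers.\<close>

lemma meromorphic_at_infinity_cusp_add:
  assumes "meromorphic_at_infinity_cusp f" "meromorphic_at_infinity_cusp g"
  shows "meromorphic_at_infinity_cusp (\<lambda>\<tau>. f \<tau> + g \<tau>)"
proof -
  obtain M N F H where MN: "M > 0" "N > 0" and FH: "F meromorphic_on {0}" "H meromorphic_on {0}"
    and f: "\<forall>\<tau>\<in>upper_half_plane. f \<tau> = F (exp (2 * of_real pi * \<i> * \<tau> / of_nat M))"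
    and g: "\<forall>\<tau>\<in>upper_half_plane. g \<tau> = H (exp (2 * of_real pi * \<i> * \<tau> / of_nat N))"
    using assms unfolding meromorphic_at_infinity_cusp_def by blast
  have pow: "exp (2 * of_real pi * \<i> * \<tau> / of_nat (M * N)) ^ N = exp (2 * of_real pi * \<i> * \<tau> / of_nat M)"
    "exp (2 * of_real pi * \<i> * \<tau> / of_nat (M * N)) ^ M = exp (2 * of_real pi * \<i> * \<tau> / of_nat N)" for \<tau>
    using MN by (simp_all flip: exp_of_nat_mult)
  have "(\<lambda>w. F (w ^ N) + H (w ^ M)) meromorphic_on {0}"
    using MN by (intro meromorphic_on_add meromorphic_on_compose[OF FH(1)] meromorphic_on_compose[OF FH(2)])
      (auto intro!: analytic_intros)
  then show ?thesis
    unfolding meromorphic_at_infinity_cusp_def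
    using MN f g by (intro exI[of _ "M * N"] conjI exI[of _ "\<lambda>w. F (w ^ N) + H (w ^ M)"]) (auto simp only: pow nat_0_less_mult_iff)
qed

lemma meromorphic_at_infinity_cusp_cmult:
  assumes "meromorphic_at_infinity_cusp f"
  shows "meromorphic_at_infinity_cusp (\<lambda>\<tau>. c * f \<tau>)"
proof -
  obtain N F where F: "N > 0" "F meromorphic_on {0}"
    "\<forall>\<tau>\<in>upper_half_plane. f \<tau> = F (exp (2 * of_real pi * \<i> * \<tau> / of_nat N))"
    using assms unfolding meromorphic_at_infinity_cusp_def by blast
  have "(\<lambda>w. c * F w) meromorphic_on {0}"
    by (intro meromorphic_on_mult meromorphic_on_const F)
  then show ?thesis
    using F(1,3) unfolding meromorphic_at_infinity_cusp_def
    by (intro exI[of _ N] conjI exI[of _ "\<lambda>w. c * F w"]) simp_all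
qed

text \<open>Needed because a \<open>q_series\<close> is identified with a known function only where
  it converges, on the upper half-plane. The modular group preserves that set, so the transformed
  functions agree as well.\<close>

lemma weakly_holomorphic_modular_function_cong:
  assumes "weakly_holomorphic_modular_function f" "\<And>\<tau>. \<tau> \<in> upper_half_plane \<Longrightarrow> f \<tau> = g \<tau>"
  shows "weakly_holomorphic_modular_function g"
proof -
  have cusp: "meromorphic_at_infinity_cusp (\<lambda>\<tau>. g (moebius_action A \<tau>))"
    if "meromorphic_at_infinity_cusp (\<lambda>\<tau>. f (moebius_action A \<tau>))" "A \<in> carrier SL2Z" for A
    using that assms(2) moebius_action_upper_half_plane[OF that(2)]
    by (simp add: meromorphic_at_infinity_cusp_def)
  obtain \<Gamma> where \<Gamma>: "congruence_subgroup \<Gamma>"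
      "\<forall>A\<in>\<Gamma>. \<forall>\<tau>\<in>upper_half_plane. f (moebius_action A \<tau>) = f \<tau>"
    using assms(1) unfolding weakly_holomorphic_modular_function_def by blast
  have "\<Gamma> \<subseteq> carrier SL2Z"
    using \<Gamma>(1) by (simp add: congruence_subgroup_def subgroup.subset)
  then have "\<forall>A\<in>\<Gamma>. \<forall>\<tau>\<in>upper_half_plane. g (moebius_action A \<tau>) = g \<tau>"
    using \<Gamma>(2) assms(2) moebius_action_upper_half_plane by (metis subsetD)
  moreover have "g holomorphic_on upper_half_plane"
    using assms holomorphic_transform unfolding weakly_holomorphic_modular_function_def by blast
  ultimately show ?thesis
    using \<Gamma>(1) assms(1) cusp unfolding weakly_holomorphic_modular_function_def by blast
qed

lemma weakly_holomorphic_modular_function_add: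
  assumes "weakly_holomorphic_modular_function f" "weakly_holomorphic_modular_function g"
  shows "weakly_holomorphic_modular_function (\<lambda>\<tau>. f \<tau> + g \<tau>)"
proof -
  obtain \<Gamma> \<Delta> where "congruence_subgroup \<Gamma>" "congruence_subgroup \<Delta>"
    "\<forall>A\<in>\<Gamma>. \<forall>\<tau>\<in>upper_half_plane. f (moebius_action A \<tau>) = f \<tau>"
    "\<forall>A\<in>\<Delta>. \<forall>\<tau>\<in>upper_half_plane. g (moebius_action A \<tau>) = g \<tau>"
    using assms unfolding weakly_holomorphic_modular_function_def by blast
  then have "\<exists>\<Gamma>. congruence_subgroup \<Gamma> \<and> (\<forall>A\<in>\<Gamma>. \<forall>\<tau>\<in>upper_half_plane.
      f (moebius_action A \<tau>) + g (moebius_action A \<tau>) = f \<tau> + g \<tau>)"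
    using congruence_subgroup_Int by (intro exI[of _ "\<Gamma> \<inter> \<Delta>"]) simp
  then show ?thesis
    using assms unfolding weakly_holomorphic_modular_function_def
    by (auto intro: holomorphic_on_add meromorphic_at_infinity_cusp_add)
qed

lemma weakly_holomorphic_modular_function_cmult:
  assumes "weakly_holomorphic_modular_function f"
  shows "weakly_holomorphic_modular_function (\<lambda>\<tau>. c * f \<tau>)"
proof -
  obtain \<Gamma> where \<Gamma>: "congruence_subgroup \<Gamma>"
      "\<forall>A\<in>\<Gamma>. \<forall>\<tau>\<in>upper_half_plane. f (moebius_action A \<tau>) = f \<tau>"
    using assms unfolding weakly_holomorphic_modular_function_def by blast
  have "\<forall>A\<in>\<Gamma>. \<forall>\<tau>\<in>upper_half_plane. c * f (moebius_action A \<tau>) = c * f \<tau>"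
    using \<Gamma>(2) by simp
  moreover have "(\<lambda>\<tau>. c * f \<tau>) holomorphic_on upper_half_plane"
    using assms unfolding weakly_holomorphic_modular_function_def by (intro holomorphic_intros) simp
  moreover have "\<forall>A\<in>carrier SL2Z. meromorphic_at_infinity_cusp (\<lambda>\<tau>. c * f (moebius_action A \<tau>))"
    using assms unfolding weakly_holomorphic_modular_function_def by (intro ballI meromorphic_at_infinity_cusp_cmult) simp
  ultimately show ?thesis
    using \<Gamma>(1) unfolding weakly_holomorphic_modular_function_def by blast
qed

lemma weakly_holomorphic_modular_function_0: "weakly_holomorphic_modular_function (\<lambda>\<tau>. 0)"
  unfolding weakly_holomorphic_modular_function_def meromorphic_at_infinity_cusp_def congruence_subgroup_def
  using subgroup_principal_congruence[of 1]
  by (auto intro!: exI[of _ "principal_congruence_subgroup 1"] exI[of _ "1::nat"] exI[of _ "\<lambda>_. 0"])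

lemma q_series_modular_cong:
  assumes "q_series_modular d c" "\<And>n. n \<in> degrees d \<Longrightarrow> c n = c' n"
  shows "q_series_modular d c'"
proof -
  have "q_term c \<tau> n = q_term c' \<tau> n" if "n \<in> degrees d" for \<tau> n
    using assms(2)[OF that] by (simp add: q_term_def)
  then have "q_series d c = q_series d c'"
    and "q_term c \<tau> summable_on degrees d \<longleftrightarrow> q_term c' \<tau> summable_on degrees d" for \<tau>
    by (simp_all add: q_series_def fun_eq_iff cong: infsum_cong summable_on_cong)
  then show ?thesis
    using assms(1) by (simp add: q_series_modular_def)
qed

lemma q_series_modular_add:
  assumes "q_series_modular d c" "q_series_modular d c'"
  shows "q_series_modular d (\<lambda>n. c n + c' n)"
proof -
  have q: "q_term (\<lambda>n. c n + c' n) \<tau> = (\<lambda>n. q_term c \<tau> n + q_term c' \<tau> n)" for \<tau>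
    by (simp add: q_term_def fun_eq_iff ring_distribs)
  have "weakly_holomorphic_modular_function (q_series d (\<lambda>n. c n + c' n))"
  proof (rule weakly_holomorphic_modular_function_cong)
    show "weakly_holomorphic_modular_function (\<lambda>\<tau>. q_series d c \<tau> + q_series d c' \<tau>)"
      using assms unfolding q_series_modular_def by (intro weakly_holomorphic_modular_function_add) auto
    show "q_series d c \<tau> + q_series d c' \<tau> = q_series d (\<lambda>n. c n + c' n) \<tau>"
      if "\<tau> \<in> upper_half_plane" for \<tau>
      using assms that unfolding q_series_modular_def q_series_def q by (intro infsum_add[symmetric]) auto
  qed
  then show ?thesis
    using assms unfolding q_series_modular_def q by (auto intro: summable_on_add)
qed

lemma q_series_modular_cmult:
  assumes "q_series_modular d c"
  shows "q_series_modular d (\<lambda>n. k * c n)"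
proof -
  have q: "q_term (\<lambda>n. k * c n) \<tau> = (\<lambda>n. k * q_term c \<tau> n)" for \<tau>
    by (simp add: q_term_def fun_eq_iff)
  have "q_series d (\<lambda>n. k * c n) = (\<lambda>\<tau>. k * q_series d c \<tau>)"
    by (simp add: q_series_def q infsum_cmult_right' fun_eq_iff)
  then show ?thesis
    using assms unfolding q_series_modular_def
    by (auto simp: q intro!: summable_on_cmult_right weakly_holomorphic_modular_function_cmult)
qed

lemma q_series_modular_0: "q_series_modular d (\<lambda>n. 0)"
proof -
  have "q_term (\<lambda>n. 0) \<tau> = (\<lambda>n. 0)" for \<tau>
    by (simp add: q_term_def fun_eq_iff)
  then show ?thesis
    by (simp add: q_series_modular_def q_series_def[abs_def] weakly_holomorphic_modular_function_0)
qed

lemma q_series_modular_sum: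
  assumes "finite S" "\<And>x. x \<in> S \<Longrightarrow> q_series_modular d (c x)"
  shows "q_series_modular d (\<lambda>n. \<Sum>x\<in>S. k x * c x n)"
  using assms
proof (induction S rule: finite_induct)
  case (insert x S)
  then show ?case
    by (auto intro!: q_series_modular_add q_series_modular_cmult)
qed (simp add: q_series_modular_0)

text \<open>A matrix turns the row (0, 1) into its own bottom row. Hence the function at any cusp is
  again a theta quotient in w, that is, with width 2, and it is unchanged as soon as the bottom row
  is congruent to (0, 1) modulo 2.\<close>

lemma theta_ratio_weakly_holomorphic:
  "weakly_holomorphic_modular_function (\<lambda>\<tau>. theta_ratio 0 1 (ee (\<tau> / 2)))"
proof -
  have modular: "theta_ratio 0 1 (ee (moebius_action A \<tau> / 2)) =
      theta_ratio (A $$ (1, 0)) (A $$ (1, 1)) (ee (\<tau> / 2))"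
    if "A \<in> carrier SL2Z" "\<tau> \<in> upper_half_plane" for A \<tau>
  proof -
    have "A $$ (0, 0) * A $$ (1, 1) - A $$ (0, 1) * A $$ (1, 0) = 1"
      using that(1) by (simp only: SL2Z_simps mem_Collect_eq flip: det_2x2)
    then show ?thesis
      using theta_ratio_modular[of \<tau> "A $$ (0, 0)" "A $$ (1, 1)" "A $$ (0, 1)" "A $$ (1, 0)" 0 1] that(2)
      by (simp add: upper_half_plane_def moebius_action_def del: One_nat_def)
  qed
  have "meromorphic_at_infinity_cusp (\<lambda>\<tau>. theta_ratio 0 1 (ee (moebius_action A \<tau> / 2)))"
    if "A \<in> carrier SL2Z" for A
    unfolding meromorphic_at_infinity_cusp_def using modular[OF that] theta_ratio_meromorphic
    by (intro exI[of _ "2::nat"] conjI exI[of _ "theta_ratio (A $$ (1, 0)) (A $$ (1, 1))"]) (auto simp: ee_def)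
  moreover have "(\<lambda>\<tau>. theta_ratio 0 1 (ee (\<tau> / 2))) holomorphic_on upper_half_plane"
  proof -
    have "(\<lambda>\<tau>. ee (\<tau> / 2)) ` upper_half_plane \<subseteq> ball 0 1 - {0}"
      by (auto simp: upper_half_plane_def intro!: norm_ee_less_1)
    moreover have "(\<lambda>\<tau>. ee (\<tau> / 2)) holomorphic_on upper_half_plane"
      by (intro holomorphic_intros) auto
    ultimately show ?thesis
      using holomorphic_on_compose_gen[OF _ theta_ratio_holomorphic] by (auto simp: o_def)
  qed
  moreover have "theta_ratio 0 1 (ee (moebius_action A \<tau> / 2)) = theta_ratio 0 1 (ee (\<tau> / 2))"
    if "A \<in> principal_congruence_subgroup 2" "\<tau> \<in> upper_half_plane" for A \<tau>
  proof -
    have "even (A $$ (1, 0))" "odd (A $$ (1, 1))"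
      using that(1) by (auto simp: principal_congruence_subgroup_iff cong_def even_iff_mod_2_eq_zero)
    moreover have "A \<in> carrier SL2Z"
      using that(1) by (simp add: principal_congruence_subgroup_iff)
    ultimately show ?thesis
      using modular that(2) by (auto intro: theta_ratio_parity)
  qed
  moreover have "congruence_subgroup (principal_congruence_subgroup 2)"
    using subgroup_principal_congruence unfolding congruence_subgroup_def
    by (auto intro!: exI[of _ "2::nat"])
  ultimately show ?thesis
    unfolding weakly_holomorphic_modular_function_def by blast
qed

section \<open>A modular function with natural coefficients\<close>

lemma qpoch_LIMSEQ:
  assumes "norm q < 1"
  shows "(\<lambda>N. \<Prod>n<N. 1 - a * q ^ n) \<longlonglongrightarrow> qpoch a q"
  using prodinf_one_plus_LIMSEQ[OF summable_qpoch[OF assms], of a] by (simp add: qpoch_def)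

lemma qpoch_mult_minus:
  assumes "norm q < 1"
  shows "qpoch a q * qpoch (- a) q = qpoch (a\<^sup>2) (q\<^sup>2)"
proof -
  have "(1 - a * q ^ n) * (1 - (- a) * q ^ n) = 1 - a\<^sup>2 * (q\<^sup>2) ^ n" for n
    by (simp add: algebra_simps power2_eq_square flip: power_mult_distrib)
  then have eq: "(\<Prod>n<N. 1 - a * q ^ n) * (\<Prod>n<N. 1 - (- a) * q ^ n) = (\<Prod>n<N. 1 - a\<^sup>2 * (q\<^sup>2) ^ n)" for N
    by (simp flip: prod.distrib)
  have "norm (q\<^sup>2) < 1"
    using assms by (simp add: norm_power power_less_one_iff)
  from LIMSEQ_unique[OF tendsto_mult[OF qpoch_LIMSEQ[OF assms, of a] qpoch_LIMSEQ[OF assms, of "- a"], unfolded eq]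
      qpoch_LIMSEQ[OF this]]
  show ?thesis .
qed

lemma qpoch_split_even_odd:
  assumes "norm q < 1"
  shows "qpoch a q = qpoch a (q\<^sup>2) * qpoch (a * q) (q\<^sup>2)"
proof -
  have q2: "norm (q\<^sup>2) < 1"
    using assms by (simp add: norm_power power_less_one_iff)
  have eq: "(\<Prod>n<2 * N. 1 - a * q ^ n) = (\<Prod>n<N. 1 - a * (q\<^sup>2) ^ n) * (\<Prod>n<N. 1 - a * q * (q\<^sup>2) ^ n)" for N
    by (induction N) (simp_all add: power_mult[symmetric] mult_ac)
  have "(\<lambda>N. \<Prod>n<2 * N. 1 - a * q ^ n) \<longlonglongrightarrow> qpoch a q"
    using LIMSEQ_subseq_LIMSEQ[OF qpoch_LIMSEQ[OF assms], of "\<lambda>N. 2 * N" a] by (simp add: o_def strict_mono_def)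
  from LIMSEQ_unique[OF this[unfolded eq] tendsto_mult[OF qpoch_LIMSEQ[OF q2, of a] qpoch_LIMSEQ[OF q2, of "a * q"]]]
  show ?thesis .
qed

text \<open>Partitions into distinct parts against partitions into odd parts. Both (-q; q)(q; q) =
  (q^2; q^2) and (q; q) = (q; q^2)(q^2; q^2) hold, and the nonzero factor (q^2; q^2)
  cancels.\<close>

lemma qpoch_Euler:
  assumes "norm q < 1"
  shows "qpoch (- q) q * qpoch q (q\<^sup>2) = 1"
proof -
  have "qpoch (q\<^sup>2) (q\<^sup>2) \<noteq> 0"
    using qpoch_nome_nonzero[of 1 2 2 q] assms by simp
  moreover have "qpoch q q = qpoch q (q\<^sup>2) * qpoch (q\<^sup>2) (q\<^sup>2)"
    using qpoch_split_even_odd[OF assms, of q] by (simp add: power2_eq_square)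
  ultimately show ?thesis
    using qpoch_mult_minus[OF assms, of q] by (simp add: mult_ac)
qed

text \<open>The product of \<open>theta3\<close> and \<open>theta4\<close> joins the factors at w
  and -w into Y^16, a function of w^2 alone, and Euler's identity makes 1 / Y equal to X. The
  exponent 48 is 32 from the square of \<open>theta2\<close> plus these 16.\<close>

lemma theta_ratio_0_1:
  assumes "norm w < 1"
  shows "theta_ratio 0 1 w = 2 ^ 16 * (w\<^sup>2)\<^sup>2 * qpoch (- (w\<^sup>2)) (w\<^sup>2) ^ 48"
proof -
  have w2: "norm (w\<^sup>2) < 1"
    using assms by (simp add: norm_power power_less_one_iff)
  define X Y where "X = qpoch (- (w\<^sup>2)) (w\<^sup>2)" and "Y = qpoch (w\<^sup>2) ((w\<^sup>2)\<^sup>2)"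
  have XY: "X * Y = 1"
    unfolding X_def Y_def by (rule qpoch_Euler[OF w2])
  then have "Y \<noteq> 0"
    by auto
  have "theta3 w * theta4 w = Y ^ 16"
    using qpoch_mult_minus[OF w2, of w] by (simp add: theta3_def theta4_def Y_def mult_ac flip: power_mult_distrib)
  then have "theta_ratio 0 1 w = 2 ^ 16 * (w\<^sup>2)\<^sup>2 * X ^ 32 / Y ^ 16"
    by (simp add: theta_ratio_def theta2_def X_def power_mult_distrib flip: power_mult)
  also have "X ^ 32 / Y ^ 16 = X ^ 48"
  proof -
    have "X ^ 48 * Y ^ 16 = X ^ 32 * (X * Y) ^ 16"
      by (simp add: power_mult_distrib flip: power_add)
    then show ?thesis
      using XY \<open>Y \<noteq> 0\<close> by (simp add: field_simps)
  qed
  then have "2 ^ 16 * (w\<^sup>2)\<^sup>2 * X ^ 32 / Y ^ 16 = 2 ^ 16 * (w\<^sup>2)\<^sup>2 * X ^ 48"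
    by (metis times_divide_eq_right)
  finally show ?thesis
    by (simp add: X_def)
qed

section \<open>Positivity of the coefficients\<close>

text \<open>Positivity is asked for only below degree \<open>m\<close>, so that the notion applies
  to the partial products, which are polynomials.\<close>

definition pos_nat_coeffs :: "nat \<Rightarrow> complex fps \<Rightarrow> bool" where
  "pos_nat_coeffs m F \<longleftrightarrow> (\<forall>n. \<exists>k::nat. fps_nth F n = of_nat k \<and> (n < m \<longrightarrow> k \<ge> 1))"

text \<open>The bound 1 for \<open>H\<close> makes its constant term positive, so the single summand
  f n * h 0 of the Cauchy product is already at least 1.\<close>

lemma pos_nat_coeffs_mult:
  assumes "pos_nat_coeffs m F" "pos_nat_coeffs 1 H"
  shows "pos_nat_coeffs m (F * H)"
proof -
  obtain f h where f: "\<And>n. fps_nth F n = of_nat (f n)" "\<And>n. n < m \<Longrightarrow> f n \<ge> 1"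
    and h: "\<And>n. fps_nth H n = of_nat (h n)" "h 0 \<ge> 1"
    using assms unfolding pos_nat_coeffs_def by (metis less_one)
  have "fps_nth (F * H) n = of_nat (\<Sum>i=0..n. f i * h (n - i))" for n
    by (simp add: fps_mult_nth f h)
  moreover have "(\<Sum>i=0..n. f i * h (n - i)) \<ge> 1" if "n < m" for n
  proof -
    have "1 \<le> f n * h (n - n)"
      using f(2)[OF that] h(2) by simp
    also have "\<dots> \<le> (\<Sum>i=0..n. f i * h (n - i))"
      by (rule member_le_sum) auto
    finally show ?thesis .
  qed
  ultimately show ?thesis
    unfolding pos_nat_coeffs_def by blast
qed

lemma pos_nat_coeffs_mono: "pos_nat_coeffs m F \<Longrightarrow> l \<le> m \<Longrightarrow> pos_nat_coeffs l F"
  unfolding pos_nat_coeffs_def by (meson less_le_trans)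

text \<open>Stated for \<open>Suc k\<close>, since in the zeroth power all higher coefficients
  vanish.\<close>

lemma pos_nat_coeffs_power:
  assumes "pos_nat_coeffs m F" "m > 0"
  shows "pos_nat_coeffs m (F ^ Suc k)"
proof (induction k)
  case (Suc k)
  then show ?case
    using pos_nat_coeffs_mult[OF Suc pos_nat_coeffs_mono[OF assms(1)]] assms(2)
    by (simp add: mult_ac)
qed (use assms in simp)

text \<open>Each degree from 1 to N is reached by a partition with one part. In the induction the
  new degree Suc N receives f 0 from the new factor.\<close>

lemma pos_nat_coeffs_finite_product:
  "pos_nat_coeffs (Suc N) (\<Prod>n<N. 1 + fps_X ^ Suc n)"
proof (induction N)
  case (Suc N)
  define F where "F = (\<Prod>n<N. 1 + fps_X ^ Suc n :: complex fps)"
  obtain f where f: "\<And>n. fps_nth F n = of_nat (f n)" "\<And>n. n < Suc N \<Longrightarrow> f n \<ge> 1"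
    using Suc unfolding F_def[symmetric] pos_nat_coeffs_def by metis
  have "fps_nth (F * (1 + fps_X ^ Suc N)) n = of_nat (f n + (if n < Suc N then 0 else f (n - Suc N)))" for n
    unfolding ring_distribs fps_add_nth fps_X_power_mult_right_nth by (simp add: f(1))
  moreover have "f n + (if n < Suc N then 0 else f (n - Suc N)) \<ge> 1" if "n < Suc (Suc N)" for n
    using f(2)[of n] f(2)[of 0] that by (cases "n = Suc N") auto
  ultimately show ?case
    unfolding pos_nat_coeffs_def prod.lessThan_Suc F_def[symmetric] by blast
qed (auto simp: pos_nat_coeffs_def intro: exI[of _ "if n = 0 then 1 else (0::nat)" for n])

text \<open>Uniform convergence makes every Taylor coefficient at 0 the limit of the coefficients of
  the partial products. These are eventually positive natural numbers, which form a closed set, so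
  the limit is one too.\<close>

lemma pos_nat_coeffs_qpoch:
  defines "g \<equiv> (\<lambda>z. qpoch (- z) z)"
  shows "pos_nat_coeffs m (fps_expansion g 0)"
  unfolding pos_nat_coeffs_def
proof
  fix n
  let ?F = "\<lambda>N. \<Prod>n<N. 1 + fps_X ^ Suc n :: complex fps"
  define f where "f N z = (\<Prod>n<N. 1 + z ^ Suc n)" for N and z :: complex
  \<comment> \<open>Only Taylor coefficients at 0 are at stake, so any radius below 1 would
    do.\<close>
  have "uniform_limit (cball 0 (1 / 2)) (\<lambda>N z :: complex. \<Prod>n<N. 1 + z ^ Suc n) (\<lambda>z. \<Prod>n. 1 + z ^ Suc n) sequentially"
  proof (rule uniform_limit_prodinf_one_plus[where f = "\<lambda>n z. z ^ Suc n"])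
    show "summable (\<lambda>n. (1 / 2) ^ Suc n :: real)"
      by (subst summable_Suc_iff) (simp add: summable_geometric)
    show "norm (z ^ Suc n) \<le> (1 / 2) ^ Suc n" if "z \<in> cball 0 (1 / 2)" for z :: complex and n
      unfolding norm_power using that by (intro power_mono) auto
  qed (auto intro!: holomorphic_intros)
  moreover have "(\<Prod>n. 1 + z ^ Suc n) = g z" for z
    by (simp add: g_def qpoch_def)
  ultimately have ulim: "uniform_limit (ball 0 (1 / 2)) f g sequentially"
    unfolding f_def[abs_def] by (auto intro: uniform_limit_on_subset)
  have f_holo: "f N holomorphic_on ball 0 (1 / 2)" for N
    unfolding f_def by (intro holomorphic_intros)
  have lim: "(\<lambda>N. (deriv ^^ n) (f N) 0 / fact n) \<longlonglongrightarrow> (deriv ^^ n) g 0 / fact n"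
    by (intro tendsto_divide tendsto_const higher_deriv_complex_uniform_limit[OF ulim])
      (auto simp: f_holo)
  have "f N has_fps_expansion ?F N" for N
    unfolding f_def[abs_def] by (intro fps_expansion_intros)
  then have "(deriv ^^ n) (f N) 0 / fact n = fps_nth (?F N) n" for N
    by (rule fps_nth_fps_expansion[symmetric])
  moreover have "fps_nth (?F N) n \<in> of_nat ` {1..}" if "N \<ge> n" for N
    using pos_nat_coeffs_finite_product[of N] that unfolding pos_nat_coeffs_def
    by (metis atLeast_iff imageI le_imp_less_Suc)
  ultimately have "\<forall>\<^sub>F N in sequentially. (deriv ^^ n) (f N) 0 / fact n \<in> of_nat ` {1..}"
    unfolding eventually_sequentially by metis
  then have "(deriv ^^ n) g 0 / fact n \<in> of_nat ` {1..}"
    using closed_of_nat_image Lim_in_closed_set[OF _ _ _ lim] by auto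
  then show "\<exists>k. fps_nth (fps_expansion g 0) n = of_nat k \<and> (n < m \<longrightarrow> 1 \<le> k)"
    by (auto simp: fps_expansion_def)
qed

text \<open>The condition \<open>a 0 = 0\<close> is recorded because the grading has no degree 0 to
  carry a constant term.\<close>

lemma theta_ratio_series:
  obtains a :: "nat \<Rightarrow> nat" where "a 0 = 0" "\<And>n. n \<ge> 2 \<Longrightarrow> a n > 0"
    "\<And>w. norm w < 1 \<Longrightarrow> (\<lambda>n. of_nat (a n) * (w\<^sup>2) ^ n) sums theta_ratio 0 1 w"
proof -
  define g where "g z = qpoch (- z) z" for z
  have g_holo: "g holomorphic_on ball 0 1"
    using holomorphic_qpoch_nome[of 1 1 "-1"] by (simp add: g_def[abs_def])
  then have "g analytic_on {0}"
    using analytic_on_open[of "ball 0 1" g] analytic_on_subset by fastforce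
  then have "g has_fps_expansion fps_expansion g 0"
    using analytic_at_imp_has_fps_expansion_0 by blast
  then have expansion: "(\<lambda>z. g z ^ 48) has_fps_expansion fps_expansion g 0 ^ 48"
    by (intro fps_expansion_intros)
  have "pos_nat_coeffs m (fps_expansion g 0 ^ 48)" for m
    using pos_nat_coeffs_power[of "Suc m" "fps_expansion g 0" 47] pos_nat_coeffs_qpoch[of "Suc m"]
    unfolding g_def[abs_def] by (auto elim: pos_nat_coeffs_mono)
  then have "\<forall>n. \<exists>k::nat. (deriv ^^ n) (\<lambda>z. g z ^ 48) 0 / fact n = of_nat k \<and> k \<ge> 1"
    unfolding fps_nth_fps_expansion[OF expansion, symmetric] pos_nat_coeffs_def
    by (metis lessI)
  then obtain c where c: "\<And>n. (deriv ^^ n) (\<lambda>z. g z ^ 48) 0 / fact n = of_nat (c n)" "\<And>n. c n \<ge> 1"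
    by metis
  define a where "a n = (if n < 2 then 0 else 2 ^ 16 * c (n - 2))" for n
  show thesis
  proof
    show "a 0 = 0"
      by (simp add: a_def)
    show "a n > 0" if "n \<ge> 2" for n
      using that c(2)[of "n - 2"] by (auto simp: a_def)
    fix w :: complex assume w: "norm w < 1"
    then have "w\<^sup>2 \<in> ball 0 1"
      by (simp add: norm_power power_less_one_iff)
    moreover have "(\<lambda>z. g z ^ 48) holomorphic_on ball 0 1"
      by (intro holomorphic_intros g_holo)
    ultimately have "(\<lambda>n. of_nat (c n) * (w\<^sup>2) ^ n) sums g (w\<^sup>2) ^ 48"
      using holomorphic_power_series[of "\<lambda>z. g z ^ 48" 0 1 "w\<^sup>2"] by (simp add: c(1))
    then have "(\<lambda>n. 2 ^ 16 * (w\<^sup>2)\<^sup>2 * (of_nat (c n) * (w\<^sup>2) ^ n)) sums (2 ^ 16 * (w\<^sup>2)\<^sup>2 * g (w\<^sup>2) ^ 48)"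
      by (rule sums_mult)
    also have "(\<lambda>n. 2 ^ 16 * (w\<^sup>2)\<^sup>2 * (of_nat (c n) * (w\<^sup>2) ^ n)) = (\<lambda>n. of_nat (a (n + 2)) * (w\<^sup>2) ^ (n + 2))"
      unfolding a_def power_add by (simp add: mult_ac)
    finally have "(\<lambda>n. of_nat (a (n + 2)) * (w\<^sup>2) ^ (n + 2)) sums theta_ratio 0 1 w"
      by (simp add: theta_ratio_0_1[OF w] g_def)
    then show "(\<lambda>n. of_nat (a n) * (w\<^sup>2) ^ n) sums theta_ratio 0 1 w"
      by (subst (asm) sums_iff_shift) (simp add: a_def numeral_2_eq_2)
  qed
qed

lemma exists_positive_modular_q_series:
  obtains a :: "int \<Rightarrow> nat" where "\<And>n. n \<ge> 2 \<Longrightarrow> a n > 0"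
    "q_series_modular 1 (\<lambda>n. of_nat (a n))"
proof -
  obtain b :: "nat \<Rightarrow> nat" where b: "b 0 = 0" "\<And>n. n \<ge> 2 \<Longrightarrow> b n > 0"
    and sums: "\<And>w. norm w < 1 \<Longrightarrow> (\<lambda>n. of_nat (b n) * (w\<^sup>2) ^ n) sums theta_ratio 0 1 w"
    using theta_ratio_series by blast
  \<comment> \<open>As \<open>nat\<close> sends -1 to 0, the equation \<open>b 0 = 0\<close> kills
    the coefficient in degree -1 as well as the term of degree 0 that \<open>degrees 1\<close>
    omits.\<close>
  define a where "a n = b (nat n)" for n
  have "(q_term (\<lambda>n. of_nat (a n)) \<tau> has_sum theta_ratio 0 1 (ee (\<tau> / 2))) (degrees 1)"
    if "\<tau> \<in> upper_half_plane" for \<tau>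
  proof -
    define w where "w = ee (\<tau> / 2)"
    have w: "norm w < 1"
      using that by (auto simp: upper_half_plane_def w_def intro: norm_ee_less_1)
    have w2: "w\<^sup>2 = exp (2 * of_real pi * \<i> * \<tau>)"
      by (simp add: w_def ee_power) (simp add: ee_def)
    \<comment> \<open>Absolute convergence, which \<open>has_sum\<close> requires, is the same
      expansion at the real point \<open>norm w\<close>, as the coefficients are
      nonnegative.\<close>
    have "summable (\<lambda>n. of_real (norm (of_nat (b n) * (w\<^sup>2) ^ n)) :: complex)"
      using sums[of "of_real (norm w)"] w by (auto simp: sums_iff norm_mult norm_power)
    then have "summable (\<lambda>n. norm (of_nat (b n) * (w\<^sup>2) ^ n))"
      by (simp only: summable_of_real_iff)
    then have "((\<lambda>n. of_nat (b n) * (w\<^sup>2) ^ n) has_sum theta_ratio 0 1 w) UNIV"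
      using sums[OF w] by (rule norm_summable_imp_has_sum)
    moreover have "of_nat (b n) * (w\<^sup>2) ^ n = q_term (\<lambda>n. of_nat (a n)) \<tau> (int n)" for n
      by (simp add: q_term_def a_def w2)
    ultimately have "((q_term (\<lambda>n. of_nat (a n)) \<tau> \<circ> int) has_sum theta_ratio 0 1 w) UNIV"
      by (simp add: o_def)
    then have "(q_term (\<lambda>n. of_nat (a n)) \<tau> has_sum theta_ratio 0 1 w) (range int)"
      by (subst has_sum_reindex) auto
    then show ?thesis
    proof (subst has_sum_cong_neutral[where T = "range int"])
      show "q_term (\<lambda>n. of_nat (a n)) \<tau> n = 0" if "n \<in> degrees 1 - range int" for n
      proof -
        have "n < 0"
          using that by (metis DiffD2 not_less nat_0_le rangeI)
        then show ?thesis
          using b(1) by (simp add: q_term_def a_def)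
      qed
      show "q_term (\<lambda>n. of_nat (a n)) \<tau> n = 0" if "n \<in> range int - degrees 1" for n
        using that b(1) by (auto simp: degrees_def q_term_def a_def)
    qed (simp_all add: w_def)
  qed note has_sum = this
  show thesis
  proof
    show "a n > 0" if "n \<ge> 2" for n
      using b(2)[of "nat n"] that by (simp add: a_def)
    have "weakly_holomorphic_modular_function (q_series 1 (\<lambda>n. of_nat (a n)))"
      by (rule weakly_holomorphic_modular_function_cong[OF theta_ratio_weakly_holomorphic])
        (simp add: q_series_def infsumI[OF has_sum])
    then show "q_series_modular 1 (\<lambda>n. of_nat (a n))"
      using has_sum by (auto simp: q_series_modular_def summable_on_def)
  qed
qed

section \<open>Representations and character orthogonality\<close>

lemma GL_simps: "mult (GL d) = (*)" "one (GL d) = 1\<^sub>m d"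
  by (simp_all add: GL_def units_of_def ring_mat_simps)

lemma mem_carrier_GL:
  "A \<in> carrier (GL d) \<longleftrightarrow> A \<in> carrier_mat d d \<and> (\<exists>B\<in>carrier_mat d d. B * A = 1\<^sub>m d \<and> A * B = 1\<^sub>m d)"
  by (auto simp: GL_def units_of_def Units_def ring_mat_simps)

lemma group_GL: "group (GL d)"
  unfolding GL_def by (intro monoid.units_group) (rule ring.is_monoid[OF ring_mat])

lemma mat_trace_mult_commute:
  fixes A B :: "'a :: comm_semiring_0 mat"
  assumes "A \<in> carrier_mat n m" "B \<in> carrier_mat m n"
  shows "mat_trace (A * B) = mat_trace (B * A)"
proof -
  have "mat_trace (A * B) = (\<Sum>i<n. \<Sum>j<m. A $$ (i, j) * B $$ (j, i))"
    using assms by (simp add: mat_trace_def scalar_prod_def atLeast0LessThan)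
  also have "\<dots> = (\<Sum>j<m. \<Sum>i<n. B $$ (j, i) * A $$ (i, j))"
    by (subst sum.swap) (simp add: mult.commute)
  also have "\<dots> = mat_trace (B * A)"
    using assms by (simp add: mat_trace_def scalar_prod_def atLeast0LessThan)
  finally show ?thesis .
qed

lemma mat_trace_one: "mat_trace (1\<^sub>m n :: 'a :: semiring_1 mat) = of_nat n"
  by (simp add: mat_trace_def)

text \<open>The two products have equal traces, and in characteristic 0 the traces n and m of the
  identity matrices determine the dimensions.\<close>

lemma inverse_mats_imp_dims_eq:
  fixes A B :: "complex mat"
  assumes "A \<in> carrier_mat n m" "B \<in> carrier_mat m n" "A * B = 1\<^sub>m n" "B * A = 1\<^sub>m m"
  shows "n = m"
  using mat_trace_mult_commute[OF assms(1,2)] assms(3,4) by (simp add: mat_trace_one)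

text \<open>Not divided by the group order. The sum is formed entrywise because the zero matrix that
  would start it depends on the dimensions. Its purpose is to turn any matrix into an intertwiner,
  for character orthogonality and for Maschke's theorem.\<close>

definition mat_average :: "('g, 'b) monoid_scheme \<Rightarrow> ('g \<Rightarrow> complex mat) \<Rightarrow> ('g \<Rightarrow> complex mat) \<Rightarrow>
    nat \<Rightarrow> nat \<Rightarrow> complex mat \<Rightarrow> complex mat" where
  "mat_average G \<sigma> \<tau> n m X =
     mat n m (\<lambda>ij. \<Sum>g\<in>carrier G. (\<sigma> g * X * \<tau> (inv\<^bsub>G\<^esub> g)) $$ ij)"

lemma mat_average_carrier [simp]: "mat_average G \<sigma> \<tau> n m X \<in> carrier_mat n m"
  by (simp add: mat_average_def)

lemma sum_scalar_prod_mat: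
  fixes A :: "'a :: semiring_0 mat"
  assumes "A \<in> carrier_mat k n" "\<And>x. x \<in> S \<Longrightarrow> B x \<in> carrier_mat n m"
  shows "A * mat n m (\<lambda>ij. \<Sum>x\<in>S. B x $$ ij) = mat k m (\<lambda>ij. \<Sum>x\<in>S. (A * B x) $$ ij)"
proof (rule eq_matI)
  fix i j assume "i < dim_row (mat k m (\<lambda>ij. \<Sum>x\<in>S. (A * B x) $$ ij))"
    "j < dim_col (mat k m (\<lambda>ij. \<Sum>x\<in>S. (A * B x) $$ ij))"
  then have ij: "i < k" "j < m" by auto
  have "(A * B x) $$ (i, j) = (\<Sum>l<n. A $$ (i, l) * B x $$ (l, j))" if "x \<in> S" for x
    using assms(1) assms(2)[OF that] ij by (simp add: scalar_prod_def atLeast0LessThan)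
  then show "(A * mat n m (\<lambda>ij. \<Sum>x\<in>S. B x $$ ij)) $$ (i, j) = mat k m (\<lambda>ij. \<Sum>x\<in>S. (A * B x) $$ ij) $$ (i, j)"
    using assms(1) ij by (simp add: scalar_prod_def atLeast0LessThan sum_distrib_left sum.swap[of _ S])
qed (use assms in auto)

lemma sum_scalar_prod_mat_right:
  fixes A :: "'a :: semiring_0 mat"
  assumes "A \<in> carrier_mat m k" "\<And>x. x \<in> S \<Longrightarrow> B x \<in> carrier_mat n m"
  shows "mat n m (\<lambda>ij. \<Sum>x\<in>S. B x $$ ij) * A = mat n k (\<lambda>ij. \<Sum>x\<in>S. (B x * A) $$ ij)"
proof (rule eq_matI)
  fix i j assume "i < dim_row (mat n k (\<lambda>ij. \<Sum>x\<in>S. (B x * A) $$ ij))"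
    "j < dim_col (mat n k (\<lambda>ij. \<Sum>x\<in>S. (B x * A) $$ ij))"
  then have ij: "i < n" "j < k" by auto
  have "(B x * A) $$ (i, j) = (\<Sum>l<m. B x $$ (i, l) * A $$ (l, j))" if "x \<in> S" for x
    using assms(1) assms(2)[OF that] ij by (simp add: scalar_prod_def atLeast0LessThan)
  then show "(mat n m (\<lambda>ij. \<Sum>x\<in>S. B x $$ ij) * A) $$ (i, j) = mat n k (\<lambda>ij. \<Sum>x\<in>S. (B x * A) $$ ij) $$ (i, j)"
    using assms(1) ij by (simp add: scalar_prod_def atLeast0LessThan sum_distrib_right sum.swap[of _ S])
qed (use assms in auto)

context group
begin

lemma representationD:
  assumes "representation G d \<sigma>"
  shows "g \<in> carrier G \<Longrightarrow> \<sigma> g \<in> carrier_mat d d"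
    and "g \<in> carrier G \<Longrightarrow> h \<in> carrier G \<Longrightarrow> \<sigma> (g \<otimes>\<^bsub>G\<^esub> h) = \<sigma> g * \<sigma> h"
    and "\<sigma> \<one>\<^bsub>G\<^esub> = 1\<^sub>m d"
    and "rep_dim G \<sigma> = d"
proof -
  interpret group_hom G "GL d" \<sigma>
    using assms group_GL is_group by (simp add: representation_def group_hom_def group_hom_axioms_def)
  show 1: "g \<in> carrier G \<Longrightarrow> \<sigma> g \<in> carrier_mat d d"
    using hom_closed mem_carrier_GL by blast
  show "g \<in> carrier G \<Longrightarrow> h \<in> carrier G \<Longrightarrow> \<sigma> (g \<otimes>\<^bsub>G\<^esub> h) = \<sigma> g * \<sigma> h"
    by (simp add: GL_simps)
  show one: "\<sigma> \<one>\<^bsub>G\<^esub> = 1\<^sub>m d"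
    using hom_one by (simp add: GL_simps(2))
  show "rep_dim G \<sigma> = d"
    by (simp only: rep_dim_def one index_one_mat)
qed

lemma representationI:
  assumes "\<And>g. g \<in> carrier G \<Longrightarrow> \<sigma> g \<in> carrier_mat d d"
    "\<And>g h. g \<in> carrier G \<Longrightarrow> h \<in> carrier G \<Longrightarrow> \<sigma> (g \<otimes>\<^bsub>G\<^esub> h) = \<sigma> g * \<sigma> h" "\<sigma> \<one>\<^bsub>G\<^esub> = 1\<^sub>m d"
  shows "representation G d \<sigma>"
proof -
  have "\<sigma> g \<in> carrier (GL d)" if "g \<in> carrier G" for g
    unfolding mem_carrier_GL using assms(1)[OF that] assms(1)[of "inv g"] that
      assms(2)[of g "inv g"] assms(2)[of "inv g" g] assms(3)
    by (auto intro!: bexI[of _ "\<sigma> (inv g)"])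
  then show ?thesis
    using assms(2) by (auto simp: representation_def hom_def GL_simps)
qed

lemma representation_inv:
  assumes "representation G d \<sigma>" "g \<in> carrier G"
  shows "\<sigma> (inv\<^bsub>G\<^esub> g) * \<sigma> g = 1\<^sub>m d" "\<sigma> g * \<sigma> (inv\<^bsub>G\<^esub> g) = 1\<^sub>m d"
proof -
  show "\<sigma> (inv\<^bsub>G\<^esub> g) * \<sigma> g = 1\<^sub>m d" "\<sigma> g * \<sigma> (inv\<^bsub>G\<^esub> g) = 1\<^sub>m d"
    using representationD(2)[OF assms(1), of "inv g" g] representationD(2)[OF assms(1), of g "inv g"]
      representationD(3)[OF assms(1)] assms(2) by auto
qed

text \<open>For the summand f(g) one has \<sigma>(h) f(g) = f(hg) \<tau>(h), and g \<mapsto> hg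
  permutes the group.\<close>

lemma mat_average_intertwines:
  assumes \<sigma>: "representation G n \<sigma>" and \<tau>: "representation G m \<tau>"
    and X: "X \<in> carrier_mat n m" and h: "h \<in> carrier G"
  shows "\<sigma> h * mat_average G \<sigma> \<tau> n m X = mat_average G \<sigma> \<tau> n m X * \<tau> h"
proof -
  note c = representationD(1)[OF \<sigma>] representationD(1)[OF \<tau>]
  let ?f = "\<lambda>g. \<sigma> g * X * \<tau> (inv g)"
  have fc: "?f g \<in> carrier_mat n m" if "g \<in> carrier G" for g
    using c(1)[OF that] c(2)[OF inv_closed[OF that]] X by auto
  have eq: "\<sigma> h * ?f g = ?f (h \<otimes> g) * \<tau> h" if g: "g \<in> carrier G" for g
  proof -
    have hg: "h \<otimes> g \<in> carrier G" using g h by simp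
    have "\<tau> (inv (h \<otimes> g)) * \<tau> h = \<tau> (inv g)"
      using g h representationD(2)[OF \<tau>, of "inv (h \<otimes> g)" h, symmetric]
      by (simp add: inv_mult_group m_assoc)
    then have "?f (h \<otimes> g) * \<tau> h = \<sigma> (h \<otimes> g) * X * \<tau> (inv g)"
      using assoc_mult_mat[of "\<sigma> (h \<otimes> g) * X" n m "\<tau> (inv (h \<otimes> g))" m "\<tau> h" m]
        c(1)[OF hg] c(2)[OF inv_closed[OF hg]] c(2)[OF h] X by auto
    also have "\<dots> = \<sigma> h * ?f g"
      using c(1)[OF h] c(1)[OF g] c(2)[OF inv_closed[OF g]] X
      by (simp add: representationD(2)[OF \<sigma> h g] assoc_mult_mat[of _ n n _ n _ m]
          assoc_mult_mat[of _ n n _ m _ m])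
    finally show ?thesis by simp
  qed
  have "bij_betw (\<lambda>g. h \<otimes> g) (carrier G) (carrier G)"
    using h by (intro bij_betw_byWitness[where f' = "\<lambda>g. inv h \<otimes> g"]) (auto simp flip: m_assoc)
  then have "(\<Sum>g\<in>carrier G. (?f g * \<tau> h) $$ ij) = (\<Sum>g\<in>carrier G. (?f (h \<otimes> g) * \<tau> h) $$ ij)" for ij
    by (rule sum.reindex_bij_betw[symmetric])
  then show ?thesis
    unfolding mat_average_def
    by (simp add: sum_scalar_prod_mat[OF c(1)[OF h] fc] sum_scalar_prod_mat_right[OF c(2)[OF h] fc] eq)
qed

end

section \<open>Invariant subspaces, Schur's lemma and orthogonality\<close>

lemma subspace_module_vec_iff:
  "VectorSpace.subspace class_ring W (module_vec TYPE(complex) d) \<longleftrightarrow>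
     W \<subseteq> carrier_vec d \<and> 0\<^sub>v d \<in> W \<and> (\<forall>v\<in>W. \<forall>w\<in>W. v + w \<in> W) \<and> (\<forall>c. \<forall>v\<in>W. c \<cdot>\<^sub>v v \<in> W)"
  using vec_vs[of d, where ?'a = complex] vec_module[of d, where ?'a = complex]
  by (auto simp: VectorSpace.subspace_def submodule_def module_vec_simps class_ring_simps)

lemma index_mult_mat_sum:
  assumes "A \<in> carrier_mat n m" "B \<in> carrier_mat m p" "i < n" "j < p"
  shows "(A * B) $$ (i, j) = (\<Sum>k<m. A $$ (i, k) * B $$ (k, j))"
  using assms by (simp add: scalar_prod_def atLeast0LessThan)

lemma eq_vec_of_diff:
  fixes v w :: "'a :: group_add vec"
  assumes "v - w = 0\<^sub>v n" "dim_vec v = n" "dim_vec w = n"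
  shows "v = w"
proof (rule eq_vecI)
  fix i assume "i < dim_vec w"
  then show "vec_index v i = vec_index w i"
    using arg_cong[OF assms(1), of "\<lambda>u. vec_index u i"] assms(2,3) by simp
qed (use assms in simp)

lemma eq_mat_of_mult_vec:
  fixes A B :: "'a :: comm_semiring_1 mat"
  assumes "A \<in> carrier_mat n m" "B \<in> carrier_mat n m" "\<And>v. v \<in> carrier_vec m \<Longrightarrow> A *\<^sub>v v = B *\<^sub>v v"
  shows "A = B"
proof (rule eq_matI)
  fix i j assume ij: "i < dim_row B" "j < dim_col B"
  then have "vec_index (A *\<^sub>v unit_vec m j) i = vec_index (B *\<^sub>v unit_vec m j) i"
    using assms by simp
  then show "A $$ (i, j) = B $$ (i, j)"
    using ij assms(1,2) by (simp add: scalar_prod_right_unit)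
qed (use assms in auto)

lemma right_inverse_of_surj:
  fixes T :: "'a :: comm_semiring_1 mat"
  assumes T: "T \<in> carrier_mat n m"
    and surj: "\<And>w. w \<in> carrier_vec n \<Longrightarrow> \<exists>v\<in>carrier_vec m. T *\<^sub>v v = w"
  shows "\<exists>B\<in>carrier_mat m n. T * B = 1\<^sub>m n"
proof -
  obtain b where b: "\<And>j. b j \<in> carrier_vec m" "\<And>j. T *\<^sub>v b j = unit_vec n j"
    using surj[of "unit_vec n j" for j] unit_vec_carrier by metis
  define B where "B = mat m n (\<lambda>(i, j). vec_index (b j) i)"
  have "T * B = 1\<^sub>m n"
  proof (rule eq_matI)
    fix i j assume "i < dim_row (1\<^sub>m n :: 'a mat)" "j < dim_col (1\<^sub>m n :: 'a mat)"
    then have ij: "i < n" "j < n" by auto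
    have "col B j = b j"
      using b(1)[of j] ij by (auto simp: B_def)
    then have "(T * B) $$ (i, j) = vec_index (T *\<^sub>v b j) i"
      using T ij by (simp add: B_def)
    then show "(T * B) $$ (i, j) = 1\<^sub>m n $$ (i, j)"
      using ij by (simp add: b(2))
  qed (use T in \<open>auto simp: B_def\<close>)
  then show ?thesis
    by (auto simp: B_def)
qed

context group
begin

lemma irreducible_repD:
  assumes "irreducible_rep G d \<sigma>"
  shows "representation G d \<sigma>" "d > 0"
    and "W \<subseteq> carrier_vec d \<Longrightarrow> 0\<^sub>v d \<in> W \<Longrightarrow> (\<And>v w. v \<in> W \<Longrightarrow> w \<in> W \<Longrightarrow> v + w \<in> W) \<Longrightarrow>
      (\<And>c v. v \<in> W \<Longrightarrow> c \<cdot>\<^sub>v v \<in> W) \<Longrightarrow>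
      (\<And>g w. g \<in> carrier G \<Longrightarrow> w \<in> W \<Longrightarrow> \<sigma> g *\<^sub>v w \<in> W) \<Longrightarrow> W = {0\<^sub>v d} \<or> W = carrier_vec d"
proof -
  note * = assms[unfolded irreducible_rep_def]
  show "representation G d \<sigma>" "d > 0"
    using * by simp_all
  assume "W \<subseteq> carrier_vec d" "0\<^sub>v d \<in> W" "\<And>v w. v \<in> W \<Longrightarrow> w \<in> W \<Longrightarrow> v + w \<in> W"
    "\<And>c v. v \<in> W \<Longrightarrow> c \<cdot>\<^sub>v v \<in> W" "\<And>g w. g \<in> carrier G \<Longrightarrow> w \<in> W \<Longrightarrow> \<sigma> g *\<^sub>v w \<in> W"
  then show "W = {0\<^sub>v d} \<or> W = carrier_vec d"
    by (intro *[THEN conjunct2, THEN conjunct2, rule_format]) (simp add: subspace_module_vec_iff)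
qed

text \<open>Kernel \<open>K\<close> and image \<open>I\<close> of T are invariant, hence trivial or
  everything. If T is onto it has a right inverse B, and if its kernel is zero then T (B T v - v) =
  0 makes B a left inverse; the equality of n and m is not presupposed.\<close>

lemma schur_zero_or_invertible:
  assumes \<sigma>: "irreducible_rep G n \<sigma>" and \<tau>: "irreducible_rep G m \<tau>" and T: "T \<in> carrier_mat n m"
    and eq: "\<And>g. g \<in> carrier G \<Longrightarrow> \<sigma> g * T = T * \<tau> g"
  shows "T = 0\<^sub>m n m \<or> (\<exists>B\<in>carrier_mat m n. T * B = 1\<^sub>m n \<and> B * T = 1\<^sub>m m)"
proof -
  note \<sigma>c = representationD(1)[OF irreducible_repD(1)[OF \<sigma>]]
  note \<tau>c = representationD(1)[OF irreducible_repD(1)[OF \<tau>]]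
  have eqv: "T *\<^sub>v (\<tau> g *\<^sub>v v) = \<sigma> g *\<^sub>v (T *\<^sub>v v)" if "g \<in> carrier G" "v \<in> carrier_vec m" for g v
    using eq[OF that(1)] T \<sigma>c[OF that(1)] \<tau>c[OF that(1)] that(2)
    by (metis assoc_mult_mat_vec)
  define K where "K = {v \<in> carrier_vec m. T *\<^sub>v v = 0\<^sub>v n}"
  define I where "I = (\<lambda>v. T *\<^sub>v v) ` carrier_vec m"
  have "K = {0\<^sub>v m} \<or> K = carrier_vec m"
  proof (rule irreducible_repD(3)[OF \<tau>])
    fix g w assume g: "g \<in> carrier G" and w: "w \<in> K"
    have "\<sigma> g *\<^sub>v 0\<^sub>v n = 0\<^sub>v n"
      using \<sigma>c[OF g] by (intro eq_vecI) auto
    then show "\<tau> g *\<^sub>v w \<in> K"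
      using \<tau>c[OF g] g w by (auto simp: K_def eqv intro!: mult_mat_vec_carrier[of _ m m])
  qed (use T in \<open>auto simp: K_def mult_add_distrib_mat_vec[OF T] mult_mat_vec[OF T]\<close>)
  moreover have "I = {0\<^sub>v n} \<or> I = carrier_vec n"
  proof (rule irreducible_repD(3)[OF \<sigma>])
    show "0\<^sub>v n \<in> I"
      unfolding I_def using T by (intro image_eqI[of _ _ "0\<^sub>v m"]) auto
    show "v + w \<in> I" if "v \<in> I" "w \<in> I" for v w
      using that T unfolding I_def
      by (auto simp flip: mult_add_distrib_mat_vec[OF T] intro: imageI)
    show "c \<cdot>\<^sub>v v \<in> I" if "v \<in> I" for c v
      using that T unfolding I_def by (auto simp flip: mult_mat_vec[OF T] intro: imageI)
    show "\<sigma> g *\<^sub>v w \<in> I" if "g \<in> carrier G" "w \<in> I" for g w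
      using that \<tau>c[OF that(1)] unfolding I_def
      by (auto simp flip: eqv intro!: imageI mult_mat_vec_carrier[of _ m m])
  qed (use T in \<open>auto simp: I_def\<close>)
  moreover have "T = 0\<^sub>m n m" if "K = carrier_vec m \<or> I = {0\<^sub>v n}"
  proof (rule eq_mat_of_mult_vec[OF T])
    fix v :: "complex vec" assume v: "v \<in> carrier_vec m"
    then have "T *\<^sub>v v = 0\<^sub>v n"
      using that by (auto simp: K_def I_def)
    then show "T *\<^sub>v v = 0\<^sub>m n m *\<^sub>v v"
      using v by (intro eq_vecI) auto
  qed simp
  moreover have "\<exists>B\<in>carrier_mat m n. T * B = 1\<^sub>m n \<and> B * T = 1\<^sub>m m" if K: "K = {0\<^sub>v m}" and I: "I = carrier_vec n"
  proof -
    obtain B where B: "B \<in> carrier_mat m n" "T * B = 1\<^sub>m n"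
      using right_inverse_of_surj[OF T] I unfolding I_def by (metis imageE)
    have "B * T = 1\<^sub>m m"
    proof (rule eq_mat_of_mult_vec)
      fix v :: "complex vec" assume v: "v \<in> carrier_vec m"
      have "T *\<^sub>v (B * T *\<^sub>v v) = (T * B) *\<^sub>v (T *\<^sub>v v)"
        using v T B(1) by (simp add: assoc_mult_mat_vec[of _ m n _ m] assoc_mult_mat_vec[of _ n m _ n])
      also have "\<dots> = T *\<^sub>v v"
        using v T by (simp add: B(2))
      finally have "T *\<^sub>v (B * T *\<^sub>v v - v) = 0\<^sub>v n"
        using v T B(1) by (subst mult_minus_distrib_mat_vec[OF T]) auto
      then have "B * T *\<^sub>v v - v \<in> K"
        using v T B(1) by (auto simp: K_def)
      then have "B * T *\<^sub>v v - v = 0\<^sub>v m"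
        using K by simp
      then have "B * T *\<^sub>v v = v"
        using v T B(1) by (metis carrier_matD(1) carrier_vecD dim_mult_mat_vec eq_vec_of_diff index_mult_mat(2))
      then show "B * T *\<^sub>v v = 1\<^sub>m m *\<^sub>v v"
        using v by simp
    qed (use T B in auto)
    then show ?thesis
      using B by blast
  qed
  ultimately show ?thesis
    by blast
qed

text \<open>Intertwiners arise as rectangular matrices, whereas similarity speaks of square ones;
  the equality of the dimensions is derived here.\<close>

lemma rep_isoI:
  assumes "representation G n \<sigma>" "representation G m \<tau>" "P \<in> carrier_mat n m" "Q \<in> carrier_mat m n"
    "P * Q = 1\<^sub>m n" "Q * P = 1\<^sub>m m" and eq: "\<And>g. g \<in> carrier G \<Longrightarrow> \<sigma> g * P = P * \<tau> g"
  shows "rep_iso G \<sigma> \<tau>"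
proof -
  have nm: "n = m"
    using inverse_mats_imp_dims_eq[OF assms(3-6)] .
  have "similar_mat_wit (\<sigma> g) (\<tau> g) P Q" if g: "g \<in> carrier G" for g
  proof (rule similar_mat_witI)
    have "\<sigma> g = \<sigma> g * (P * Q)"
      using representationD(1)[OF assms(1) g] assms(5) by simp
    also have "\<dots> = P * \<tau> g * Q"
      using representationD(1)[OF assms(1) g] assms(3,4) eq[OF g] by (metis assoc_mult_mat)
    finally show "\<sigma> g = P * \<tau> g * Q" .
  qed (use assms representationD(1) g nm in auto)
  then show ?thesis
    unfolding rep_iso_def by blast
qed

lemma schur_not_iso:
  assumes "irreducible_rep G n \<sigma>" "irreducible_rep G m \<tau>" "T \<in> carrier_mat n m"
    "\<And>g. g \<in> carrier G \<Longrightarrow> \<sigma> g * T = T * \<tau> g" "\<not> rep_iso G \<sigma> \<tau>"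
  shows "T = 0\<^sub>m n m"
  using schur_zero_or_invertible[OF assms(1-4)] rep_isoI[OF irreducible_repD(1)[OF assms(1)]
      irreducible_repD(1)[OF assms(2)] assms(3) _ _ _ assms(4)] assms(5) by blast

text \<open>Over the complex numbers T has an eigenvalue c. Then T - c commutes with the
  representation and kills an eigenvector, so it is not invertible and must be zero.\<close>

lemma schur_scalar:
  assumes \<sigma>: "irreducible_rep G n \<sigma>" and T: "T \<in> carrier_mat n n"
    and eq: "\<And>g. g \<in> carrier G \<Longrightarrow> \<sigma> g * T = T * \<sigma> g"
  shows "\<exists>c. T = c \<cdot>\<^sub>m 1\<^sub>m n"
proof -
  obtain c v where v: "v \<in> carrier_vec n" "v \<noteq> 0\<^sub>v n" "T *\<^sub>v v = c \<cdot>\<^sub>v v"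
    using spectrum_non_empty[OF T irreducible_repD(2)[OF \<sigma>]] T
    by (auto simp: spectrum_def eigenvalue_def eigenvector_def)
  let ?S = "T - c \<cdot>\<^sub>m 1\<^sub>m n"
  have comm: "\<sigma> g * ?S = ?S * \<sigma> g" if g: "g \<in> carrier G" for g
    using representationD(1)[OF irreducible_repD(1)[OF \<sigma>] g] T eq[OF g]
    by (simp add: mult_minus_distrib_mat[of _ n n] minus_mult_distrib_mat[of _ n n]
        mult_smult_distrib[of _ n n _ n] mult_smult_assoc_mat[of _ n n _ n])
  have S: "?S *\<^sub>v v = 0\<^sub>v n"
  proof -
    have "(c \<cdot>\<^sub>m 1\<^sub>m n) *\<^sub>v v = c \<cdot>\<^sub>v v"
      using v(1) by (intro eq_vecI) (auto simp: smult_scalar_prod_distrib[of _ n])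
    then show ?thesis
      using v T by (subst minus_mult_distrib_mat_vec[of _ n n]) auto
  qed
  have ninv: "B * ?S \<noteq> 1\<^sub>m n" if B: "B \<in> carrier_mat n n" for B
  proof -
    have "B * ?S *\<^sub>v v = B *\<^sub>v (?S *\<^sub>v v)"
      using v B T by (intro assoc_mult_mat_vec[of _ n n _ n]) auto
    then show ?thesis
      using v B S by auto
  qed
  have "?S \<in> carrier_mat n n"
    by (intro minus_carrier_mat smult_carrier_mat one_carrier_mat)
  from schur_zero_or_invertible[OF \<sigma> \<sigma> this comm] have "?S = 0\<^sub>m n n"
    using ninv by auto
  then have "T = c \<cdot>\<^sub>m 1\<^sub>m n"
    using T by (auto simp: mat_eq_iff)
  then show ?thesis ..
qed

text \<open>Averaging the matrix unit E(j, k) produces the sums of products of matrix coefficients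
  that occur in the orthogonality relations.\<close>

lemma mat_average_unit:
  assumes "representation G n \<sigma>" "representation G m \<tau>" "i < n" "j < n" "k < m" "l < m"
  shows "mat_average G \<sigma> \<tau> n m (mat n m (\<lambda>ab. if ab = (j, k) then 1 else 0)) $$ (i, l) =
    (\<Sum>g\<in>carrier G. \<sigma> g $$ (i, j) * \<tau> (inv g) $$ (k, l))"
proof -
  let ?E = "mat n m (\<lambda>ab. if ab = (j, k) then 1 else 0) :: complex mat"
  have "(\<sigma> g * ?E * \<tau> (inv g)) $$ (i, l) = \<sigma> g $$ (i, j) * \<tau> (inv g) $$ (k, l)" if g: "g \<in> carrier G" for g
  proof -
    note c = representationD(1)[OF assms(1) g] representationD(1)[OF assms(2) inv_closed[OF g]]
    have "(\<sigma> g * ?E) $$ (i, b) = (if b = k then \<sigma> g $$ (i, j) else 0)" if "b < m" for b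
      using c assms(3-6) that by (simp add: scalar_prod_def if_distrib if_distribR sum.If_cases)
    note row = this
    have "(\<sigma> g * ?E * \<tau> (inv g)) $$ (i, l) = (\<Sum>b<m. (\<sigma> g * ?E) $$ (i, b) * \<tau> (inv g) $$ (b, l))"
      using c assms(3-6) by (intro index_mult_mat_sum[of _ n]) auto
    also have "\<dots> = (\<Sum>b<m. if b = k then \<sigma> g $$ (i, j) * \<tau> (inv g) $$ (b, l) else 0)"
      by (intro sum.cong) (simp_all add: row)
    finally show ?thesis
      using assms(5) by (simp add: sum.delta)
  qed
  then show ?thesis
    using assms by (simp add: mat_average_def)
qed

lemma sum_character_mult:
  assumes "representation G n \<sigma>" "representation G m \<tau>"
  shows "(\<Sum>g\<in>carrier G. character \<sigma> g * character \<tau> (inv g)) =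
    (\<Sum>i<n. \<Sum>k<m. mat_average G \<sigma> \<tau> n m (mat n m (\<lambda>ab. if ab = (i, k) then 1 else 0)) $$ (i, k))"
proof -
  have "(\<Sum>g\<in>carrier G. character \<sigma> g * character \<tau> (inv g)) =
      (\<Sum>g\<in>carrier G. \<Sum>i<n. \<Sum>k<m. \<sigma> g $$ (i, i) * \<tau> (inv g) $$ (k, k))"
  proof (rule sum.cong)
    fix g assume g: "g \<in> carrier G"
    note c = representationD(1)[OF assms(1) g] representationD(1)[OF assms(2) inv_closed[OF g]]
    then show "character \<sigma> g * character \<tau> (inv g) = (\<Sum>i<n. \<Sum>k<m. \<sigma> g $$ (i, i) * \<tau> (inv g) $$ (k, k))"
      by (simp add: character_def mat_trace_def sum_product)
  qed simp
  also have "\<dots> = (\<Sum>i<n. \<Sum>k<m. \<Sum>g\<in>carrier G. \<sigma> g $$ (i, i) * \<tau> (inv g) $$ (k, k))"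
    by (subst sum.swap, intro sum.cong refl, subst sum.swap) simp
  finally show ?thesis
    by (simp add: mat_average_unit[OF assms])
qed

lemma character_orthogonal:
  assumes \<sigma>: "irreducible_rep G n \<sigma>" and \<tau>: "irreducible_rep G m \<tau>" and "\<not> rep_iso G \<sigma> \<tau>"
  shows "(\<Sum>g\<in>carrier G. character \<sigma> g * character \<tau> (inv g)) = 0"
proof -
  note reps = irreducible_repD(1)[OF \<sigma>] irreducible_repD(1)[OF \<tau>]
  have "mat_average G \<sigma> \<tau> n m X = 0\<^sub>m n m" if "X \<in> carrier_mat n m" for X
    using mat_average_intertwines[OF reps that] by (intro schur_not_iso[OF \<sigma> \<tau> _ _ assms(3)]) auto
  then show ?thesis
    unfolding sum_character_mult[OF reps] by simp
qed

text \<open>By Schur the average of E(i, k) is a scalar matrix, and its trace fixes the scalar: the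
  diagonal entries add up to the sum over g of entry (k, i) of \<sigma>(g^-1) \<sigma>(g) = 1, which
  is |G| for i = k and 0 otherwise.\<close>

lemma character_norm:
  assumes \<sigma>: "irreducible_rep G n \<sigma>"
  shows "(\<Sum>g\<in>carrier G. character \<sigma> g * character \<sigma> (inv g)) = of_nat (order G)"
proof -
  note rep = irreducible_repD(1)[OF \<sigma>]
  have n: "n > 0" by (rule irreducible_repD(2)[OF \<sigma>])
  let ?A = "\<lambda>j k. mat_average G \<sigma> \<sigma> n n (mat n n (\<lambda>ab. if ab = (j, k) then 1 else 0))"
  have "?A i k $$ (i, k) = (if i = k then of_nat (order G) / of_nat n else 0)" if ik: "i < n" "k < n" for i k
  proof -
    obtain c where c: "?A i k = c \<cdot>\<^sub>m 1\<^sub>m n"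
      using schur_scalar[OF \<sigma> mat_average_carrier mat_average_intertwines[OF rep rep mat_carrier]] by auto
    have "(\<Sum>l<n. ?A i k $$ (l, l)) = (\<Sum>g\<in>carrier G. \<Sum>l<n. \<sigma> (inv g) $$ (k, l) * \<sigma> g $$ (l, i))"
      by (subst sum.swap) (simp add: mat_average_unit[OF rep rep] ik mult.commute)
    also have "\<dots> = (\<Sum>g\<in>carrier G. (\<sigma> (inv g) * \<sigma> g) $$ (k, i))"
      using representationD(1)[OF rep] ik
      by (intro sum.cong refl index_mult_mat_sum[of _ n, symmetric]) auto
    also have "\<dots> = (if i = k then of_nat (order G) else 0)"
      using ik by (simp add: representation_inv[OF rep] order_def)
    finally have "c * of_nat n = (if i = k then of_nat (order G) else 0)"
      unfolding c by (simp add: mult.commute)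
    then show ?thesis
      using n ik unfolding c by (auto simp: field_simps split: if_splits)
  qed
  then have "(\<Sum>i<n. \<Sum>k<n. ?A i k $$ (i, k)) = (\<Sum>i<n. \<Sum>k<n. if i = k then of_nat (order G) / of_nat n else 0)"
    by (intro sum.cong) auto
  also have "\<dots> = of_nat (order G)"
    using n by (simp add: sum.delta)
  finally show ?thesis
    unfolding sum_character_mult[OF rep rep] .
qed

end

section \<open>Complete reducibility and multiplicities\<close>

text \<open>If r exceeded d, padding both matrices with zeros to size r would give a square matrix
  with a zero row and a left inverse, hence also a right inverse, which the zero row
  forbids.\<close>

lemma left_invertible_imp_dim_le:
  fixes B L :: "'a :: field mat"
  assumes B: "B \<in> carrier_mat d r" and L: "L \<in> carrier_mat r d" and LB: "L * B = 1\<^sub>m r"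
  shows "r \<le> d"
proof (rule ccontr)
  assume "\<not> r \<le> d"
  then have dr: "d < r" by simp
  define B' where "B' = mat r r (\<lambda>(i, j). if i < d then B $$ (i, j) else 0)"
  define L' where "L' = mat r r (\<lambda>(i, j). if j < d then L $$ (i, j) else 0)"
  have c: "B' \<in> carrier_mat r r" "L' \<in> carrier_mat r r"
    by (simp_all add: B'_def L'_def)
  have "L' * B' = L * B"
  proof (rule eq_matI)
    fix i j assume "i < dim_row (L * B)" "j < dim_col (L * B)"
    then have ij: "i < r" "j < r" using B L by auto
    have "(L' * B') $$ (i, j) = (\<Sum>k<r. L' $$ (i, k) * B' $$ (k, j))"
      by (rule index_mult_mat_sum[OF c(2,1) ij])
    also have "\<dots> = (\<Sum>k<d. L $$ (i, k) * B $$ (k, j))"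
      using dr ij by (intro sum.mono_neutral_cong_right) (auto simp: B'_def L'_def)
    also have "\<dots> = (L * B) $$ (i, j)"
      by (rule index_mult_mat_sum[OF L B ij, symmetric])
    finally show "(L' * B') $$ (i, j) = (L * B) $$ (i, j)" .
  qed (use B L c in auto)
  then have "B' * L' = 1\<^sub>m r"
    using mat_mult_left_right_inverse[OF c(2,1)] LB by simp
  moreover have "(B' * L') $$ (d, d) = (\<Sum>k<r. B' $$ (d, k) * L' $$ (k, d))"
    by (rule index_mult_mat_sum[OF c dr dr])
  ultimately show False
    using dr by (simp add: B'_def)
qed

text \<open>
  A left-invertible matrix with column space inside \<open>W\<close> and the maximal number of columns spans
  \<open>W\<close>: otherwise a further column can be added.
\<close>

lemma subspace_basis:
  fixes W :: "'a :: field vec set"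
  assumes W: "W \<subseteq> carrier_vec d" "0\<^sub>v d \<in> W"
    and add: "\<And>v w. v \<in> W \<Longrightarrow> w \<in> W \<Longrightarrow> v + w \<in> W" and smult: "\<And>c v. v \<in> W \<Longrightarrow> c \<cdot>\<^sub>v v \<in> W"
  shows "\<exists>r. \<exists>B\<in>carrier_mat d r. \<exists>L\<in>carrier_mat r d. L * B = 1\<^sub>m r \<and>
    (\<forall>v\<in>carrier_vec r. B *\<^sub>v v \<in> W) \<and> (\<forall>w\<in>W. B *\<^sub>v (L *\<^sub>v w) = w)"
proof -
  define good where "good r = (\<exists>B\<in>carrier_mat d r. \<exists>L\<in>carrier_mat r d. L * B = 1\<^sub>m r \<and>
    (\<forall>v\<in>carrier_vec r. B *\<^sub>v v \<in> W))" for r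
  have good0: "good 0"
    unfolding good_def
  proof (intro bexI conjI ballI)
    show "0\<^sub>m 0 d * 0\<^sub>m d 0 = (1\<^sub>m 0 :: 'a mat)"
      by (rule eq_matI) auto
    fix v :: "'a vec" assume "v \<in> carrier_vec 0"
    then have "0\<^sub>m d 0 *\<^sub>v v = 0\<^sub>v d"
      by (intro eq_vecI) (auto simp: scalar_prod_def)
    then show "0\<^sub>m d 0 *\<^sub>v v \<in> W"
      using W(2) by simp
  qed auto
  have bound: "r \<le> d" if "good r" for r
    using that unfolding good_def using left_invertible_imp_dim_le by blast
  define r where "r = (GREATEST r. good r)"
  have "good r"
    unfolding r_def by (rule GreatestI_nat[where P = good, OF good0 bound])
  then obtain B L where B: "B \<in> carrier_mat d r" and L: "L \<in> carrier_mat r d" and LB: "L * B = 1\<^sub>m r"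
    and BW: "\<And>v. v \<in> carrier_vec r \<Longrightarrow> B *\<^sub>v v \<in> W"
    unfolding good_def by blast
  have "B *\<^sub>v (L *\<^sub>v w) = w" if w: "w \<in> W" for w
  proof (rule ccontr)
    assume neq: "B *\<^sub>v (L *\<^sub>v w) \<noteq> w"
    have wc: "w \<in> carrier_vec d"
      using w W(1) by blast
    \<comment> \<open>The component of \<open>w\<close> missed by the columns of \<open>B\<close>:
      it is nonzero, lies in \<open>W\<close> and is killed by \<open>L\<close>.\<close>
    define u where "u = w + (-1) \<cdot>\<^sub>v (B *\<^sub>v (L *\<^sub>v w))"
    have uW: "u \<in> W"
      unfolding u_def using w L wc by (intro add smult BW) auto
    then have uc: "u \<in> carrier_vec d"
      using W(1) by blast
    have "\<exists>k<d. vec_index u k \<noteq> 0"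
    proof (rule ccontr)
      assume "\<not> (\<exists>k<d. vec_index u k \<noteq> 0)"
      then have "vec_index w k = vec_index (B *\<^sub>v (L *\<^sub>v w)) k" if "k < d" for k
        using that B L wc by (auto simp: u_def)
      then have "w = B *\<^sub>v (L *\<^sub>v w)"
        using B wc by (intro eq_vecI) auto
      with neq show False by simp
    qed
    then obtain k where k: "k < d" "vec_index u k \<noteq> 0"
      by blast
    have Lu: "L *\<^sub>v u = 0\<^sub>v r"
    proof -
      have "L *\<^sub>v (B *\<^sub>v (L *\<^sub>v w)) = L *\<^sub>v w"
        using B L wc LB by (simp flip: assoc_mult_mat_vec[of L r d B r "L *\<^sub>v w"])
      then have "L *\<^sub>v u = L *\<^sub>v w + (-1) \<cdot>\<^sub>v (L *\<^sub>v w)"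
        unfolding u_def using B L wc
        by (subst mult_add_distrib_mat_vec[OF L]) (auto simp: mult_mat_vec[OF L])
      then show ?thesis
        using L wc by (intro eq_vecI) auto
    qed
    \<comment> \<open>\<open>R\<close> kills the columns of \<open>B\<close> and fixes
      \<open>u\<close>, which is what the additional row of a left inverse needs.\<close>
    define R where "R = 1\<^sub>m d - B * L"
    have R: "R \<in> carrier_mat d d"
      unfolding R_def using B L by auto
    have RB: "R * B = 0\<^sub>m d r"
      unfolding R_def using B L LB by (simp add: minus_mult_distrib_mat[of _ d d] assoc_mult_mat[of B d r L d B r])
    have Ru: "R *\<^sub>v u = u"
    proof -
      have "B * L *\<^sub>v u = 0\<^sub>v d"
        using B L uc Lu by (subst assoc_mult_mat_vec[of _ d r _ d]) (auto intro!: eq_vecI)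
      then show ?thesis
        unfolding R_def using B L uc by (subst minus_mult_distrib_mat_vec[of _ d d]) auto
    qed
    define B' where "B' = mat d (Suc r) (\<lambda>(i, j). if j < r then B $$ (i, j) else vec_index u i)"
    \<comment> \<open>The last row is row k of \<open>R\<close>, scaled by the nonzero entry of
      \<open>u\<close> at k: it gives 0 on the columns of \<open>B\<close> and 1 on
      \<open>u\<close>.\<close>
    define L' where "L' = mat (Suc r) d (\<lambda>(i, j). if i < r then L $$ (i, j) else R $$ (k, j) / vec_index u k)"
    have c: "B' \<in> carrier_mat d (Suc r)" "L' \<in> carrier_mat (Suc r) d"
      by (simp_all add: B'_def L'_def)
    have mv: "(\<Sum>l<d. A $$ (i, l) * vec_index u l) = vec_index (A *\<^sub>v u) i" if "A \<in> carrier_mat n d" "i < n" for A n i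
      using that uc by (simp add: scalar_prod_def atLeast0LessThan)
    have "L' * B' = 1\<^sub>m (Suc r)"
    proof (rule eq_matI)
      fix i j assume "i < dim_row (1\<^sub>m (Suc r) :: 'a mat)" "j < dim_col (1\<^sub>m (Suc r) :: 'a mat)"
      then have ij: "i < Suc r" "j < Suc r" by auto
      have eq: "(L' * B') $$ (i, j) = (\<Sum>l<d. L' $$ (i, l) * B' $$ (l, j))"
        by (rule index_mult_mat_sum[OF c(2,1) ij])
      consider "i < r" "j < r" | "i < r" "j = r" | "i = r" "j < r" | "i = r" "j = r"
        using ij by linarith
      then have "(\<Sum>l<d. L' $$ (i, l) * B' $$ (l, j)) = 1\<^sub>m (Suc r) $$ (i, j)"
      proof cases
        case 1
        then have "(\<Sum>l<d. L' $$ (i, l) * B' $$ (l, j)) = (L * B) $$ (i, j)"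
          unfolding index_mult_mat_sum[OF L B 1] by (simp add: B'_def L'_def)
        then show ?thesis using 1 LB by simp
      next
        case 2
        then have "(\<Sum>l<d. L' $$ (i, l) * B' $$ (l, j)) = vec_index (L *\<^sub>v u) i"
          unfolding mv[OF L 2(1), symmetric] by (simp add: B'_def L'_def)
        then show ?thesis using 2 Lu by simp
      next
        case 3
        then have "(\<Sum>l<d. L' $$ (i, l) * B' $$ (l, j)) = (R * B) $$ (k, j) / vec_index u k"
          unfolding index_mult_mat_sum[OF R B k(1) 3(2)] by (simp add: B'_def L'_def sum_divide_distrib)
        then show ?thesis using 3 RB k by simp
      next
        case 4
        then have "(\<Sum>l<d. L' $$ (i, l) * B' $$ (l, j)) = vec_index (R *\<^sub>v u) k / vec_index u k"
          unfolding mv[OF R k(1), symmetric] by (simp add: B'_def L'_def sum_divide_distrib)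
        then show ?thesis using 4 Ru k by simp
      qed
      with eq show "(L' * B') $$ (i, j) = 1\<^sub>m (Suc r) $$ (i, j)" by simp
    qed (use c in auto)
    moreover have "B' *\<^sub>v v \<in> W" if v: "v \<in> carrier_vec (Suc r)" for v
    proof -
      have "B' *\<^sub>v v = B *\<^sub>v vec r (vec_index v) + vec_index v r \<cdot>\<^sub>v u"
      proof (rule eq_vecI)
        fix i assume "i < dim_vec (B *\<^sub>v vec r (vec_index v) + vec_index v r \<cdot>\<^sub>v u)"
        then have "i < d" using uc by simp
        then show "vec_index (B' *\<^sub>v v) i = vec_index (B *\<^sub>v vec r (vec_index v) + vec_index v r \<cdot>\<^sub>v u) i"
          using v B uc by (simp add: B'_def scalar_prod_def mult.commute)
      qed (use B uc in \<open>auto simp: B'_def\<close>)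
      then show ?thesis
        using add BW smult uW by simp
    qed
    ultimately have "good (Suc r)"
      unfolding good_def using c by blast
    then have "Suc r \<le> r"
      unfolding r_def by (rule Greatest_le_nat[where P = good, OF _ bound])
    then show False by simp
  qed
  with B L LB BW show ?thesis
    by blast
qed

section \<open>Subrepresentations, direct sums and Maschke's theorem\<close>

lemma diag_block_mat_pair:
  assumes "A \<in> carrier_mat n n" "B \<in> carrier_mat m m"
  shows "diag_block_mat [A, B] = four_block_mat A (0\<^sub>m n m) (0\<^sub>m m n) B"
proof -
  have "diag_block_mat ([A] @ [B]) = four_block_mat A (0\<^sub>m n m) (0\<^sub>m m n) B"
    unfolding diag_block_mat_append Let_def diag_block_mat_singleton using assms by simp
  then show ?thesis
    by (simp del: diag_block_mat.simps)
qed

context group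
begin

text \<open>The columns of \<open>B\<close> are a basis of the invariant subspace and
  \<open>L\<close> reads off coordinates, so L \<sigma>(g) B is the restriction of \<sigma> in that
  basis.\<close>

lemma subrepresentation:
  assumes \<sigma>: "representation G d \<sigma>" and B: "B \<in> carrier_mat d r" and L: "L \<in> carrier_mat r d"
    and LB: "L * B = 1\<^sub>m r" and BW: "\<And>v. v \<in> carrier_vec r \<Longrightarrow> B *\<^sub>v v \<in> W"
    and BL: "\<And>w. w \<in> W \<Longrightarrow> B *\<^sub>v (L *\<^sub>v w) = w"
    and inv: "\<And>g w. g \<in> carrier G \<Longrightarrow> w \<in> W \<Longrightarrow> \<sigma> g *\<^sub>v w \<in> W"
  shows "representation G r (\<lambda>g. L * \<sigma> g * B)"
    and "g \<in> carrier G \<Longrightarrow> \<sigma> g * B = B * (L * \<sigma> g * B)"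
proof -
  note c = representationD(1)[OF \<sigma>]
  have eq: "\<sigma> g * B = B * (L * \<sigma> g * B)" if g: "g \<in> carrier G" for g
  proof (rule eq_mat_of_mult_vec)
    fix v :: "complex vec" assume v: "v \<in> carrier_vec r"
    have Bv: "B *\<^sub>v v \<in> carrier_vec d"
      using B v by auto
    have "B * (L * \<sigma> g * B) *\<^sub>v v = B *\<^sub>v (L *\<^sub>v (\<sigma> g *\<^sub>v (B *\<^sub>v v)))"
      using B L c[OF g] v Bv
      by (simp add: assoc_mult_mat_vec[of B d r _ r] assoc_mult_mat_vec[of L r d _ r] assoc_mult_mat_vec[of _ d d B r])
    also have "\<dots> = \<sigma> g *\<^sub>v (B *\<^sub>v v)"
      by (intro BL inv g BW v)
    finally show "\<sigma> g * B *\<^sub>v v = B * (L * \<sigma> g * B) *\<^sub>v v"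
      using B c[OF g] v by simp
  qed (use B L c[OF g] in auto)
  then show "g \<in> carrier G \<Longrightarrow> \<sigma> g * B = B * (L * \<sigma> g * B)" .
  show "representation G r (\<lambda>g. L * \<sigma> g * B)"
  proof (rule representationI)
    fix g h assume gh: "g \<in> carrier G" "h \<in> carrier G"
    have "L * \<sigma> (g \<otimes> h) * B = L * \<sigma> g * (\<sigma> h * B)"
      using B L c[OF gh(1)] c[OF gh(2)] representationD(2)[OF \<sigma> gh]
      by (simp add: assoc_mult_mat[of L r d _ d] assoc_mult_mat[of _ d d _ d B r] assoc_mult_mat[of L r d _ d _ r])
    also have "\<dots> = (L * \<sigma> g * B) * (L * \<sigma> h * B)"
      unfolding eq[OF gh(2)] using B L c[OF gh(1)] c[OF gh(2)]
      by (intro assoc_mult_mat[of _ r d _ r _ r, symmetric]) auto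
    finally show "L * \<sigma> (g \<otimes> h) * B = (L * \<sigma> g * B) * (L * \<sigma> h * B)" .
  qed (use B L c LB representationD(3)[OF \<sigma>] in auto)
qed

lemma rep_iso_dims:
  assumes "representation G n \<sigma>" "representation G m \<tau>" "rep_iso G \<sigma> \<tau>"
  obtains P Q where "n = m" "P \<in> carrier_mat n n" "Q \<in> carrier_mat n n" "P * Q = 1\<^sub>m n" "Q * P = 1\<^sub>m n"
    "\<And>g. g \<in> carrier G \<Longrightarrow> \<sigma> g = P * \<tau> g * Q"
proof -
  obtain P Q where PQ: "\<And>g. g \<in> carrier G \<Longrightarrow> similar_mat_wit (\<sigma> g) (\<tau> g) P Q"
    using assms(3) unfolding rep_iso_def by blast
  note c = representationD(1)[OF assms(1)] representationD(1)[OF assms(2)]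
  have d: "n = dim_row (\<sigma> \<one>)"
    using c(1)[OF one_closed] by simp
  show thesis
  proof
    show "n = m"
      using similar_mat_witD(5)[OF d PQ[OF one_closed]] c(2)[OF one_closed] by (metis carrier_matD(1))
    show "\<sigma> g = P * \<tau> g * Q" if "g \<in> carrier G" for g
      using similar_mat_witD(3)[OF refl PQ[OF that]] .
  qed (use similar_mat_witD[OF d PQ[OF one_closed]] in auto)
qed

lemma rep_iso_character:
  assumes "representation G n \<sigma>" "representation G m \<tau>" "rep_iso G \<sigma> \<tau>" "g \<in> carrier G"
  shows "character \<sigma> g = character \<tau> g"
proof -
  obtain P Q where PQ: "n = m" "P \<in> carrier_mat n n" "Q \<in> carrier_mat n n" "Q * P = 1\<^sub>m n"
    "\<And>g. g \<in> carrier G \<Longrightarrow> \<sigma> g = P * \<tau> g * Q"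
    using rep_iso_dims[OF assms(1-3)] by metis
  have \<tau>: "\<tau> g \<in> carrier_mat n n"
    using representationD(1)[OF assms(2,4)] PQ(1) by simp
  have "mat_trace (P * \<tau> g * Q) = mat_trace (Q * (P * \<tau> g))"
    using PQ \<tau> by (intro mat_trace_mult_commute[of _ n n]) auto
  also have "Q * (P * \<tau> g) = \<tau> g"
    using PQ \<tau> by (simp flip: assoc_mult_mat[of Q n n P n "\<tau> g" n])
  finally show ?thesis
    using PQ(5)[OF assms(4)] by (simp add: character_def)
qed

lemma rep_iso_trans: "rep_iso G \<sigma> \<tau> \<Longrightarrow> rep_iso G \<tau> \<upsilon> \<Longrightarrow> rep_iso G \<sigma> \<upsilon>"
  unfolding rep_iso_def using similar_mat_wit_trans by blast

lemma rep_iso_refl: "representation G d \<sigma> \<Longrightarrow> rep_iso G \<sigma> \<sigma>"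
  unfolding rep_iso_def using similar_mat_wit_refl representationD(1) by blast

lemma representation_pair:
  assumes "representation G n \<sigma>" "representation G m \<tau>"
  shows "representation G (n + m) (\<lambda>g. diag_block_mat [\<sigma> g, \<tau> g])"
proof -
  note c = representationD(1)[OF assms(1)] representationD(1)[OF assms(2)]
  show ?thesis
  proof (rule representationI)
    fix g h assume gh: "g \<in> carrier G" "h \<in> carrier G"
    note c' = c(1)[OF gh(1)] c(2)[OF gh(1)] c(1)[OF gh(2)] c(2)[OF gh(2)]
    then show "diag_block_mat [\<sigma> (g \<otimes> h), \<tau> (g \<otimes> h)] =
        diag_block_mat [\<sigma> g, \<tau> g] * diag_block_mat [\<sigma> h, \<tau> h]"
      using c(1)[OF m_closed[OF gh]] c(2)[OF m_closed[OF gh]]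
      by (simp add: diag_block_mat_pair[of _ n _ m] mult_four_block_mat[of _ n n _ m _ m _ _ n _ m]
          representationD(2)[OF assms(1)] representationD(2)[OF assms(2)] gh del: diag_block_mat.simps)
  next
    fix g assume "g \<in> carrier G"
    then show "diag_block_mat [\<sigma> g, \<tau> g] \<in> carrier_mat (n + m) (n + m)"
      using c by (simp add: diag_block_mat_pair[of _ n _ m] del: diag_block_mat.simps)
  qed (simp add: representationD(3)[OF assms(1)] representationD(3)[OF assms(2)]
      diag_block_mat_pair[of _ n _ m] del: diag_block_mat.simps)
qed

lemma rep_iso_pair_cong:
  assumes "representation G n \<sigma>" "representation G n' \<sigma>'" "representation G m \<tau>" "representation G m' \<tau>'"
    and "rep_iso G \<sigma> \<sigma>'" "rep_iso G \<tau> \<tau>'"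
  shows "rep_iso G (\<lambda>g. diag_block_mat [\<sigma> g, \<tau> g]) (\<lambda>g. diag_block_mat [\<sigma>' g, \<tau>' g])"
proof -
  have [simp]: "n' = n" "m' = m"
    using rep_iso_dims assms by metis+
  obtain P Q P' Q' where PQ: "\<And>g. g \<in> carrier G \<Longrightarrow> similar_mat_wit (\<sigma> g) (\<sigma>' g) P Q"
    "\<And>g. g \<in> carrier G \<Longrightarrow> similar_mat_wit (\<tau> g) (\<tau>' g) P' Q'"
    using assms(5,6) unfolding rep_iso_def by blast
  have "similar_mat_wit (diag_block_mat [\<sigma> g, \<tau> g]) (diag_block_mat [\<sigma>' g, \<tau>' g])
      (four_block_mat P (0\<^sub>m n m) (0\<^sub>m m n) P') (four_block_mat Q (0\<^sub>m n m) (0\<^sub>m m n) Q')"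
    if g: "g \<in> carrier G" for g
  proof -
    have c: "\<sigma> g \<in> carrier_mat n n" "\<sigma>' g \<in> carrier_mat n n" "\<tau> g \<in> carrier_mat m m" "\<tau>' g \<in> carrier_mat m m"
      using representationD(1)[OF _ g] assms(1-4) by auto
    have d: "n = dim_row (\<sigma> g)" "m = dim_row (\<tau> g)"
      using c by auto
    show ?thesis
      unfolding diag_block_mat_pair[OF c(1,3)] diag_block_mat_pair[OF c(2,4)]
      using similar_mat_witD[OF d(1) PQ(1)[OF g]] similar_mat_witD[OF d(2) PQ(2)[OF g]] c
      by (intro similar_mat_wit_four_block PQ[OF g]) auto
  qed
  then show ?thesis
    unfolding rep_iso_def by blast
qed

lemma rep_iso_pair_swap:
  assumes "representation G n \<sigma>" "representation G m \<tau>"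
  shows "rep_iso G (\<lambda>g. diag_block_mat [\<sigma> g, \<tau> g]) (\<lambda>g. diag_block_mat [\<tau> g, \<sigma> g])"
proof (rule rep_isoI[OF representation_pair[OF assms] representation_pair[OF assms(2,1)]])
  let ?P = "\<lambda>n m. four_block_mat (0\<^sub>m n m) (1\<^sub>m n) (1\<^sub>m m) (0\<^sub>m m n) :: complex mat"
  show "?P n m \<in> carrier_mat (n + m) (m + n)" "?P m n \<in> carrier_mat (m + n) (n + m)"
    by simp_all
  show "?P n m * ?P m n = 1\<^sub>m (n + m)" "?P m n * ?P n m = 1\<^sub>m (m + n)"
    by (simp_all add: mult_four_block_mat[of _ n m _ n _ m _ _ n _ m] mult_four_block_mat[of _ m n _ m _ n _ _ m _ n])
  fix g assume g: "g \<in> carrier G"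
  note c = representationD(1)[OF assms(1) g] representationD(1)[OF assms(2) g]
  show "diag_block_mat [\<sigma> g, \<tau> g] * ?P n m = ?P n m * diag_block_mat [\<tau> g, \<sigma> g]"
    unfolding diag_block_mat_pair[OF c] diag_block_mat_pair[OF c(2,1)] using c
    by (simp add: mult_four_block_mat[of _ n n _ m _ m _ _ m _ n] mult_four_block_mat[of _ n m _ n _ m _ _ m _ n])
qed

text \<open>The coordinate map \<open>L\<close> on \<open>W\<close> need not be equivariant, but its
  average \<open>M\<close> is, and it still restricts to the coordinates on \<open>W\<close>. The
  kernel \<open>U\<close> of \<open>M\<close> is then an invariant complement.\<close>

lemma maschke:
  assumes fin: "finite (carrier G)" and \<sigma>: "representation G d \<sigma>"
    and W: "W \<subseteq> carrier_vec d" "0\<^sub>v d \<in> W"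
    and add: "\<And>v w. v \<in> W \<Longrightarrow> w \<in> W \<Longrightarrow> v + w \<in> W" and smult: "\<And>c v. v \<in> W \<Longrightarrow> c \<cdot>\<^sub>v v \<in> W"
    and inv: "\<And>g w. g \<in> carrier G \<Longrightarrow> w \<in> W \<Longrightarrow> \<sigma> g *\<^sub>v w \<in> W"
    and proper: "W \<noteq> {0\<^sub>v d}" "W \<noteq> carrier_vec d"
  shows "\<exists>r<d. \<exists>s<d. \<exists>\<tau> \<upsilon>. representation G r \<tau> \<and> representation G s \<upsilon> \<and>
    rep_iso G \<sigma> (\<lambda>g. diag_block_mat [\<tau> g, \<upsilon> g])"
proof -
  note c = representationD(1)[OF \<sigma>]
  obtain r B L where B: "B \<in> carrier_mat d r" and L: "L \<in> carrier_mat r d" and LB: "L * B = 1\<^sub>m r"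
    and BW: "\<forall>v\<in>carrier_vec r. B *\<^sub>v v \<in> W" and BLW: "\<forall>w\<in>W. B *\<^sub>v (L *\<^sub>v w) = w"
    using subspace_basis[OF W add smult] by auto
  define \<tau> where "\<tau> g = L * \<sigma> g * B" for g
  have \<tau>: "representation G r \<tau>" and \<sigma>B: "\<And>g. g \<in> carrier G \<Longrightarrow> \<sigma> g * B = B * \<tau> g"
    using subrepresentation[OF \<sigma> B L LB bspec[OF BW] bspec[OF BLW] inv] by (auto simp: \<tau>_def[abs_def])
  define N where "N = (of_nat (order G) :: complex)"
  have N: "N \<noteq> 0"
    using fin by (simp add: N_def order_gt_0_iff_finite)
  \<comment> \<open>The division by the group order makes \<open>M * B\<close> the identity: each of
    its summands before division is the identity matrix.\<close>
  define M where "M = (1 / N) \<cdot>\<^sub>m mat_average G \<tau> \<sigma> r d L"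
  have M: "M \<in> carrier_mat r d"
    by (simp add: M_def)
  have \<tau>M: "\<tau> h * M = M * \<sigma> h" if h: "h \<in> carrier G" for h
    unfolding M_def using mat_average_intertwines[OF \<tau> \<sigma> L h] representationD(1)[OF \<tau> h] c[OF h]
    by (simp add: mult_smult_distrib[of _ r r _ d] mult_smult_assoc_mat[of _ r d _ d])
  have MB: "M * B = 1\<^sub>m r"
  proof -
    have "\<tau> g * L * \<sigma> (inv g) * B = 1\<^sub>m r" if g: "g \<in> carrier G" for g
    proof -
      note cg = representationD(1)[OF \<tau> g] representationD(1)[OF \<tau> inv_closed[OF g]] c[OF inv_closed[OF g]]
      have cB: "B * \<tau> (inv g) \<in> carrier_mat d r"
        using B cg(2) by (rule mult_carrier_mat)
      have "\<tau> g * L * \<sigma> (inv g) * B = \<tau> g * L * (B * \<tau> (inv g))"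
        using cg L B \<sigma>B[OF inv_closed[OF g]]
        by (simp add: assoc_mult_mat[of "\<tau> g" r r _ d] assoc_mult_mat[of L r d _ d B r]
            assoc_mult_mat[OF cg(1) L cB])
      also have "\<dots> = \<tau> g * (L * B) * \<tau> (inv g)"
        using cg L B by (simp add: assoc_mult_mat[of "\<tau> g" r r _ r _ r] assoc_mult_mat[of L r d B r _ r]
            assoc_mult_mat[OF cg(1) L cB])
      finally show ?thesis
        using cg LB representation_inv[OF \<tau> g] by simp
    qed
    then have "mat_average G \<tau> \<sigma> r d L * B = mat r r (\<lambda>ij. \<Sum>g\<in>carrier G. 1\<^sub>m r $$ ij)"
      unfolding mat_average_def using representationD(1)[OF \<tau>] c L B
      by (subst sum_scalar_prod_mat_right[of _ d r]) (auto intro!: mult_carrier_mat)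
    also have "\<dots> = N \<cdot>\<^sub>m 1\<^sub>m r"
      by (rule eq_matI) (simp_all add: N_def order_def)
    finally show ?thesis
      unfolding M_def using B N by (subst mult_smult_assoc_mat[of _ r d _ r]) (auto intro!: eq_matI)
  qed
  define U where "U = {w \<in> carrier_vec d. M *\<^sub>v w = 0\<^sub>v r}"
  have U: "U \<subseteq> carrier_vec d" "0\<^sub>v d \<in> U" "\<And>v w. v \<in> U \<Longrightarrow> w \<in> U \<Longrightarrow> v + w \<in> U"
      "\<And>c v. v \<in> U \<Longrightarrow> c \<cdot>\<^sub>v v \<in> U"
    using M by (auto simp: U_def mult_add_distrib_mat_vec[OF M] mult_mat_vec[OF M])
  obtain s C K where C: "C \<in> carrier_mat d s" and K: "K \<in> carrier_mat s d" and KC: "K * C = 1\<^sub>m s"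
    and CU: "\<forall>v\<in>carrier_vec s. C *\<^sub>v v \<in> U" and CKU: "\<forall>w\<in>U. C *\<^sub>v (K *\<^sub>v w) = w"
    using subspace_basis[OF U] by auto
  have invU: "\<sigma> g *\<^sub>v w \<in> U" if g: "g \<in> carrier G" and w: "w \<in> U" for g w
  proof -
    have wc: "w \<in> carrier_vec d"
      using w by (simp add: U_def)
    have "M *\<^sub>v (\<sigma> g *\<^sub>v w) = \<tau> g *\<^sub>v (M *\<^sub>v w)"
      by (simp only: assoc_mult_mat_vec[OF M c[OF g] wc, symmetric] \<tau>M[OF g, symmetric]
          assoc_mult_mat_vec[OF representationD(1)[OF \<tau> g] M wc])
    also have "\<dots> = 0\<^sub>v r"
      using w representationD(1)[OF \<tau> g] by (intro eq_vecI) (auto simp: U_def)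
    finally show ?thesis
      using w c[OF g] by (auto simp: U_def intro!: mult_mat_vec_carrier[of _ d d])
  qed
  define \<upsilon> where "\<upsilon> g = K * \<sigma> g * C" for g
  have \<upsilon>: "representation G s \<upsilon>" and \<sigma>C: "\<And>g. g \<in> carrier G \<Longrightarrow> \<sigma> g * C = C * \<upsilon> g"
    using subrepresentation[OF \<sigma> C K KC bspec[OF CU] bspec[OF CKU] invU] by (auto simp: \<upsilon>_def[abs_def])
  have MC: "M * C = 0\<^sub>m r s"
  proof (rule eq_mat_of_mult_vec)
    fix v :: "complex vec" assume v: "v \<in> carrier_vec s"
    then have "M * C *\<^sub>v v = 0\<^sub>v r"
      using bspec[OF CU v] M C by (simp add: U_def)
    then show "M * C *\<^sub>v v = 0\<^sub>m r s *\<^sub>v v"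
      using v by (auto intro!: eq_vecI)
  qed (use M C in auto)
  \<comment> \<open>The projection onto \<open>U\<close> along \<open>W\<close>; composed with
    \<open>K\<close> it gives the coordinates on \<open>U\<close>.\<close>
  define R where "R = 1\<^sub>m d - B * M"
  have BM: "B * M \<in> carrier_mat d d"
    using B M by (rule mult_carrier_mat)
  have R: "R \<in> carrier_mat d d"
    unfolding R_def using BM by (rule minus_carrier_mat)
  have MR: "M * R = 0\<^sub>m r d"
  proof -
    have "M * (B * M) = M"
      using M by (simp add: assoc_mult_mat[OF M B M, symmetric] MB)
    then show ?thesis
      unfolding R_def using M B by (simp add: mult_minus_distrib_mat[OF M one_carrier_mat BM])
  qed
  have RB: "R * B = 0\<^sub>m d r"
    unfolding R_def using M B MB
    by (simp add: minus_mult_distrib_mat[OF one_carrier_mat BM B] assoc_mult_mat[of B d r M d B r])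
  have RC: "R * C = C"
    unfolding R_def using M B C MC
    by (simp add: minus_mult_distrib_mat[OF one_carrier_mat BM C] assoc_mult_mat[of B d r M d C s])
      (auto intro!: eq_matI)
  have CKR: "C * (K * R) = R"
  proof (rule eq_mat_of_mult_vec)
    fix v :: "complex vec" assume v: "v \<in> carrier_vec d"
    have "M *\<^sub>v (R *\<^sub>v v) = 0\<^sub>v r"
      unfolding assoc_mult_mat_vec[OF M R v, symmetric] MR using v by (auto intro!: eq_vecI)
    then have "R *\<^sub>v v \<in> U"
      using v R by (auto simp: U_def)
    then show "C * (K * R) *\<^sub>v v = R *\<^sub>v v"
      using bspec[OF CKU, of "R *\<^sub>v v"] C K R v by (simp add: assoc_mult_mat_vec[of C d s _ d] assoc_mult_mat_vec[of K s d R d])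
  qed (use C K R in auto)
  \<comment> \<open>The change of basis puts \<open>B\<close> and \<open>C\<close> side by side, its
    inverse stacks \<open>M\<close> on \<open>K * R\<close>. Blocks with no rows or no columns bring
    both into the four-block form.\<close>
  let ?P = "four_block_mat B C (0\<^sub>m 0 r) (0\<^sub>m 0 s)"
  let ?Q = "four_block_mat M (0\<^sub>m r 0) (K * R) (0\<^sub>m s 0)"
  have P: "?P \<in> carrier_mat d (r + s)" and Q: "?Q \<in> carrier_mat (r + s) d"
    using B C M K R by auto
  have "B * M + C * (K * R) = 1\<^sub>m d"
    unfolding CKR unfolding R_def using B M by (intro eq_matI) auto
  then have PQ: "?P * ?Q = 1\<^sub>m d"
    using B C M K R by (subst mult_four_block_mat[of _ d r _ s _ 0 _ _ d _ 0]) (auto intro!: eq_matI)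
  have "K * R * B = 0\<^sub>m s r"
    using K R B RB by (simp add: assoc_mult_mat[of K s d R d B r])
  moreover have "K * R * C = 1\<^sub>m s"
    using K R C RC KC by (simp add: assoc_mult_mat[of K s d R d C s])
  ultimately have QP: "?Q * ?P = 1\<^sub>m (r + s)"
    using B C M K R MB MC by (subst mult_four_block_mat[of _ r d _ 0 _ s _ _ r _ s]) auto
  have drs: "d = r + s"
    using inverse_mats_imp_dims_eq[OF P Q PQ QP] .
  have iso: "rep_iso G \<sigma> (\<lambda>g. diag_block_mat [\<tau> g, \<upsilon> g])"
  proof (rule rep_isoI[OF \<sigma> representation_pair[OF \<tau> \<upsilon>] P Q PQ QP])
    fix g assume g: "g \<in> carrier G"
    note cg = c[OF g] representationD(1)[OF \<tau> g] representationD(1)[OF \<upsilon> g]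
    have "\<sigma> g * ?P = four_block_mat (\<sigma> g) (0\<^sub>m d 0) (0\<^sub>m 0 d) (0\<^sub>m 0 0) * ?P"
      using cg by (intro arg_cong2[of _ _ _ _ "(*)"] refl eq_matI) auto
    also have "\<dots> = four_block_mat (\<sigma> g * B) (\<sigma> g * C) (0\<^sub>m 0 r) (0\<^sub>m 0 s)"
      using cg B C by (subst mult_four_block_mat[of _ d d _ 0 _ 0 _ _ r _ s]) auto
    also have "\<dots> = ?P * four_block_mat (\<tau> g) (0\<^sub>m r s) (0\<^sub>m s r) (\<upsilon> g)"
      unfolding \<sigma>B[OF g] \<sigma>C[OF g] using cg B C
      by (subst mult_four_block_mat[of _ d r _ s _ 0 _ _ r _ s]) auto
    finally show "\<sigma> g * ?P = ?P * diag_block_mat [\<tau> g, \<upsilon> g]"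
      unfolding diag_block_mat_pair[OF cg(2,3)] .
  qed
  have "r \<noteq> 0"
  proof
    assume r: "r = 0"
    have "w = 0\<^sub>v d" if "w \<in> W" for w
    proof -
      have "w = B *\<^sub>v (L *\<^sub>v w)"
        using bspec[OF BLW that] by simp
      also have "\<dots> = 0\<^sub>v d"
        using B L that W(1) r by (intro eq_vecI) (auto simp: scalar_prod_def)
      finally show ?thesis .
    qed
    with proper(1) W(2) show False by blast
  qed
  moreover have "r \<noteq> d"
  proof
    assume r: "r = d"
    then have "B * L = 1\<^sub>m d"
      using mat_mult_left_right_inverse[of L d B] B L LB by simp
    then have "v \<in> W" if "v \<in> carrier_vec d" for v
      using bspec[OF BW, of "L *\<^sub>v v"] assoc_mult_mat_vec[OF B L that] L that by simp
    with proper(2) W(1) show False by blast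
  qed
  ultimately have "r < d" "s < d"
    using drs by simp_all
  then show ?thesis
    using \<tau> \<upsilon> iso by blast
qed

end

lemma diag_block_mat_append_pair: "diag_block_mat (As @ Bs) = diag_block_mat [diag_block_mat As, diag_block_mat Bs]"
  using diag_block_mat_append[of "[diag_block_mat As]" "[diag_block_mat Bs]"]
  unfolding diag_block_mat_append[of As] diag_block_mat_singleton append.simps by simp

lemma diag_block_mat_Cons_pair: "diag_block_mat (A # As) = diag_block_mat [A, diag_block_mat As]"
  using diag_block_mat_append_pair[of "[A]" As] by (simp only: append.simps diag_block_mat_singleton)

lemma mat_trace_diag_block_pair:
  assumes "A \<in> carrier_mat n n" "B \<in> carrier_mat m m"
  shows "mat_trace (diag_block_mat [A, B]) = mat_trace A + mat_trace B"
proof -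
  have "mat_trace (diag_block_mat [A, B]) =
      (\<Sum>i<n + m. if i < n then A $$ (i, i) else B $$ (i - n, i - n))"
    unfolding diag_block_mat_pair[OF assms] mat_trace_def using assms by (intro sum.cong) auto
  also have "{..<n + m} = {..<n} \<union> {n..<n + m}"
    by auto
  also have "(\<Sum>i\<in>\<dots>. if i < n then A $$ (i, i) else B $$ (i - n, i - n)) =
      (\<Sum>i<n. A $$ (i, i)) + (\<Sum>i\<in>{n..<n + m}. B $$ (i - n, i - n))"
    by (subst sum.union_disjoint) (auto intro!: arg_cong2[of _ _ _ _ "(+)"] sum.cong)
  also have "(\<Sum>i\<in>{n..<n + m}. B $$ (i - n, i - n)) = (\<Sum>i<m. B $$ (i, i))"
    by (rule sum.reindex_bij_witness[of _ "\<lambda>i. i + n" "\<lambda>i. i - n"]) auto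
  finally show ?thesis
    using assms by (simp add: mat_trace_def)
qed

section \<open>Decompositions as lists of indices\<close>

text \<open>With indices in place of matrices, one list describes the direct sum for all group
  elements, and reordering summands becomes a matter of lists.\<close>

definition multiplicity_list :: "nat \<Rightarrow> (nat \<Rightarrow> nat) \<Rightarrow> nat list" where
  "multiplicity_list t m = concat (map (\<lambda>i. replicate (m i) i) [0..<t])"

lemma direct_sum_rep_eq:
  "direct_sum_rep t \<rho> m = (\<lambda>g. diag_block_mat (map (\<lambda>i. \<rho> i g) (multiplicity_list t m)))"
  by (simp add: direct_sum_rep_def multiplicity_list_def map_concat o_def fun_eq_iff)

lemma set_multiplicity_list: "set (multiplicity_list t m) \<subseteq> {..<t}"
  by (auto simp: multiplicity_list_def)

lemma sum_list_multiplicity_list: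
  fixes f :: "nat \<Rightarrow> 'c :: comm_semiring_1"
  shows "(\<Sum>i\<leftarrow>multiplicity_list t m. f i) = (\<Sum>i<t. of_nat (m i) * f i)"
  unfolding multiplicity_list_def
  by (induction t) (simp_all add: sum_list_replicate)

lemma multiplicity_list_upd:
  assumes "i < t"
  obtains xs ys where "multiplicity_list t m = xs @ ys" "multiplicity_list t (m(i := Suc (m i))) = xs @ i # ys"
proof -
  have "[0..<t] = [0..<i] @ i # [Suc i..<t]"
    using assms upt_add_eq_append[of 0 i "t - i"] upt_conv_Cons[of i t] by simp
  then have split: "multiplicity_list t m' = concat (map (\<lambda>i. replicate (m' i) i) [0..<i]) @ replicate (m' i) i @
      concat (map (\<lambda>i. replicate (m' i) i) [Suc i..<t])" for m'
    by (simp add: multiplicity_list_def)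
  have "concat (map (\<lambda>j. replicate ((m(i := Suc (m i))) j) j) [0..<i]) = concat (map (\<lambda>i. replicate (m i) i) [0..<i])"
    "concat (map (\<lambda>j. replicate ((m(i := Suc (m i))) j) j) [Suc i..<t]) = concat (map (\<lambda>i. replicate (m i) i) [Suc i..<t])"
    by (intro arg_cong[of _ _ concat] map_cong; auto)+
  then show thesis
    using split[of m] split[of "m(i := Suc (m i))"] that by simp
qed

context group
begin

lemma representation_diag_list:
  assumes "\<And>i. i \<in> set is \<Longrightarrow> representation G (rep_dim G (\<rho> i)) (\<rho> i)"
  shows "representation G (\<Sum>i\<leftarrow>is. rep_dim G (\<rho> i)) (\<lambda>g. diag_block_mat (map (\<lambda>i. \<rho> i g) is))"
  using assms
proof (induction "is")
  case Nil
  then show ?case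
    by (intro representationI) (auto intro: eq_matI)
next
  case (Cons i "is")
  then have "representation G (rep_dim G (\<rho> i) + (\<Sum>i\<leftarrow>is. rep_dim G (\<rho> i)))
      (\<lambda>g. diag_block_mat [\<rho> i g, diag_block_mat (map (\<lambda>i. \<rho> i g) is)])"
    by (intro representation_pair) auto
  then show ?case
    by (simp only: list.map sum_list.Cons diag_block_mat_Cons_pair[of _ "map _ _"])
qed

lemma character_diag_list:
  assumes "\<And>i. i \<in> set is \<Longrightarrow> representation G (rep_dim G (\<rho> i)) (\<rho> i)" "g \<in> carrier G"
  shows "character (\<lambda>g. diag_block_mat (map (\<lambda>i. \<rho> i g) is)) g = (\<Sum>i\<leftarrow>is. character (\<rho> i) g)"
  using assms(1)
proof (induction "is")
  case (Cons i "is")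
  have "\<rho> i g \<in> carrier_mat (rep_dim G (\<rho> i)) (rep_dim G (\<rho> i))"
    using Cons.prems[of i] representationD(1) assms(2) by simp
  moreover have "diag_block_mat (map (\<lambda>i. \<rho> i g) is) \<in>
      carrier_mat (\<Sum>i\<leftarrow>is. rep_dim G (\<rho> i)) (\<Sum>i\<leftarrow>is. rep_dim G (\<rho> i))"
    using representationD(1)[OF representation_diag_list[of "is" \<rho>] assms(2)] Cons.prems by simp
  ultimately have "character (\<lambda>g. diag_block_mat (map (\<lambda>i. \<rho> i g) (i # is))) g =
      character (\<rho> i) g + character (\<lambda>g. diag_block_mat (map (\<lambda>i. \<rho> i g) is)) g"
    unfolding character_def list.map diag_block_mat_Cons_pair[of _ "map _ _"]
    by (rule mat_trace_diag_block_pair)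
  then show ?case
    using Cons by simp
qed (simp add: character_def mat_trace_def)

text \<open>The block \<open>k\<close> is swapped with the sum over \<open>is\<close>, and the
  blocks \<open>js\<close> are appended by congruence.\<close>

lemma rep_iso_diag_list_insert:
  assumes "\<And>i. i \<in> set (k # is @ js) \<Longrightarrow> representation G (rep_dim G (\<rho> i)) (\<rho> i)"
  shows "rep_iso G (\<lambda>g. diag_block_mat (map (\<lambda>i. \<rho> i g) (k # is @ js)))
    (\<lambda>g. diag_block_mat (map (\<lambda>i. \<rho> i g) (is @ k # js)))"
proof -
  let ?D = "\<lambda>is g. diag_block_mat (map (\<lambda>i. \<rho> i g) is)"
  have append: "?D (xs @ ys) = (\<lambda>g. diag_block_mat [?D xs g, ?D ys g])" for xs ys
    unfolding map_append diag_block_mat_append_pair[of "map _ xs"] ..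
  have rep: "representation G (\<Sum>i\<leftarrow>xs. rep_dim G (\<rho> i)) (?D xs)" if "set xs \<subseteq> set (k # is @ js)" for xs
    using that assms by (intro representation_diag_list) blast
  have "rep_iso G (?D ([k] @ is)) (?D (is @ [k]))"
    unfolding append by (rule rep_iso_pair_swap[OF rep rep]) auto
  then have "rep_iso G (?D (([k] @ is) @ js)) (?D ((is @ [k]) @ js))"
    unfolding append[of "_ @ _"] by (intro rep_iso_pair_cong[OF rep rep rep rep] rep_iso_refl[OF rep]) auto
  then show ?thesis
    by simp
qed

lemma irreps_systemD:
  assumes "irreps_system G t \<rho>" "i < t"
  shows "irreducible_rep G (rep_dim G (\<rho> i)) (\<rho> i)" "representation G (rep_dim G (\<rho> i)) (\<rho> i)"
    "rep_dim G (\<rho> i) > 0"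
    "j < t \<Longrightarrow> i \<noteq> j \<Longrightarrow> \<not> rep_iso G (\<rho> i) (\<rho> j)"
proof -
  show 1: "irreducible_rep G (rep_dim G (\<rho> i)) (\<rho> i)"
    using assms by (simp add: irreps_system_def)
  show "representation G (rep_dim G (\<rho> i)) (\<rho> i)" "rep_dim G (\<rho> i) > 0"
    using irreducible_repD[OF 1] by auto
  show "j < t \<Longrightarrow> i \<noteq> j \<Longrightarrow> \<not> rep_iso G (\<rho> i) (\<rho> j)"
    using assms by (simp add: irreps_system_def)
qed

text \<open>Insertion sort: the tail is sorted by induction, and the head is moved to its place
  among the equal indices.\<close>

lemma rep_iso_sorted:
  assumes "irreps_system G t \<rho>" "set is \<subseteq> {..<t}"
  shows "\<exists>m. (\<forall>i\<ge>t. m i = 0) \<and> rep_iso G (\<lambda>g. diag_block_mat (map (\<lambda>i. \<rho> i g) is)) (direct_sum_rep t \<rho> m)"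
  using assms(2)
proof (induction "is")
  case Nil
  have "multiplicity_list t (\<lambda>_. 0) = []"
    by (simp add: multiplicity_list_def)
  moreover have "rep_iso G (\<lambda>g. diag_block_mat (map (\<lambda>i. \<rho> i g) [])) (\<lambda>g. diag_block_mat (map (\<lambda>i. \<rho> i g) []))"
    by (rule rep_iso_refl[OF representation_diag_list]) simp
  ultimately show ?case
    by (intro exI[of _ "\<lambda>_. 0"]) (simp add: direct_sum_rep_eq)
next
  case (Cons k "is")
  let ?D = "\<lambda>is g. diag_block_mat (map (\<lambda>i. \<rho> i g) is)"
  have rep: "representation G (\<Sum>i\<leftarrow>xs. rep_dim G (\<rho> i)) (?D xs)" if "set xs \<subseteq> {..<t}" for xs
    using that irreps_systemD(2)[OF assms(1)] by (intro representation_diag_list) auto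
  have k: "k < t" using Cons.prems by simp
  obtain m where m: "\<forall>i\<ge>t. m i = 0" "rep_iso G (?D is) (?D (multiplicity_list t m))"
    using Cons unfolding direct_sum_rep_eq by auto
  obtain xs ys where xy: "multiplicity_list t m = xs @ ys" "multiplicity_list t (m(k := Suc (m k))) = xs @ k # ys"
    using multiplicity_list_upd[OF k] by metis
  have sub: "set (xs @ ys) \<subseteq> {..<t}"
    using set_multiplicity_list[of t m] xy by simp
  have cons: "?D (k # js) = (\<lambda>g. diag_block_mat [?D [k] g, ?D js g])" for js
    unfolding list.map diag_block_mat_singleton diag_block_mat_Cons_pair[of _ "map _ js"] ..
  have "rep_iso G (?D (k # is)) (?D (k # xs @ ys))"
    unfolding cons using m(2) Cons.prems sub k unfolding xy
    by (intro rep_iso_pair_cong[OF rep rep rep rep] rep_iso_refl[OF rep]) auto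
  moreover have "rep_iso G (?D (k # xs @ ys)) (?D (xs @ k # ys))"
    using sub k irreps_systemD(2)[OF assms(1)] by (intro rep_iso_diag_list_insert) auto
  ultimately have "rep_iso G (?D (k # is)) (direct_sum_rep t \<rho> (m(k := Suc (m k))))"
    unfolding direct_sum_rep_eq xy by (rule rep_iso_trans)
  moreover have "\<forall>i\<ge>t. (m(k := Suc (m k))) i = 0"
    using m(1) k by auto
  ultimately show ?case
    by blast
qed

text \<open>Strong induction on the dimension by Maschke's theorem. The order of the summands is
  left open, so that the lists of the two pieces can simply be concatenated;
  \<open>rep_iso_sorted\<close> restores the order.\<close>

lemma complete_reducibility_list:
  assumes sys: "irreps_system G t \<rho>" and fin: "finite (carrier G)" and "representation G d \<sigma>"
  shows "\<exists>is. set is \<subseteq> {..<t} \<and> rep_iso G \<sigma> (\<lambda>g. diag_block_mat (map (\<lambda>i. \<rho> i g) is))"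
  using assms(3)
proof (induction d arbitrary: \<sigma> rule: less_induct)
  case (less d)
  let ?D = "\<lambda>is g. diag_block_mat (map (\<lambda>i. \<rho> i g) is)"
  have rep: "representation G (\<Sum>i\<leftarrow>xs. rep_dim G (\<rho> i)) (?D xs)" if "set xs \<subseteq> {..<t}" for xs
    using that irreps_systemD(2)[OF sys] by (intro representation_diag_list) auto
  consider "d = 0" | "irreducible_rep G d \<sigma>" | "d > 0" "\<not> irreducible_rep G d \<sigma>"
    by blast
  then show ?case
  proof cases
    case 1
    then have "\<sigma> g = 0\<^sub>m 0 0" if "g \<in> carrier G" for g
      using representationD(1)[OF less.prems that] by (intro eq_matI) auto
    then have "rep_iso G \<sigma> (?D [])"
      using rep_iso_refl[OF less.prems] by (simp add: rep_iso_def)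
    then show ?thesis
      by (intro exI[of _ "[]"]) simp
  next
    case 2
    then obtain i where "i < t" "rep_iso G \<sigma> (\<rho> i)"
      using sys unfolding irreps_system_def by meson
    then show ?thesis
      by (intro exI[of _ "[i]"]) (simp del: diag_block_mat.simps)
  next
    case 3
    obtain W where W: "VectorSpace.subspace class_ring W (module_vec TYPE(complex) d)"
      "\<forall>g\<in>carrier G. \<forall>w\<in>W. \<sigma> g *\<^sub>v w \<in> W" "W \<noteq> {0\<^sub>v d}" "W \<noteq> carrier_vec d"
      using 3 less.prems unfolding irreducible_rep_def by auto
    have "\<exists>r<d. \<exists>s<d. \<exists>\<tau> \<upsilon>. representation G r \<tau> \<and> representation G s \<upsilon> \<and>
        rep_iso G \<sigma> (\<lambda>g. diag_block_mat [\<tau> g, \<upsilon> g])"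
      using W unfolding subspace_module_vec_iff by (intro maschke[OF fin less.prems, of W]) simp_all
    then obtain r s \<tau> \<upsilon> where rs: "r < d" "s < d" and reps: "representation G r \<tau>" "representation G s \<upsilon>"
      and iso: "rep_iso G \<sigma> (\<lambda>g. diag_block_mat [\<tau> g, \<upsilon> g])"
      by blast
    obtain xs where xs: "set xs \<subseteq> {..<t}" "rep_iso G \<tau> (?D xs)"
      using less.IH[OF rs(1) reps(1)] by blast
    obtain ys where ys: "set ys \<subseteq> {..<t}" "rep_iso G \<upsilon> (?D ys)"
      using less.IH[OF rs(2) reps(2)] by blast
    have "rep_iso G (\<lambda>g. diag_block_mat [\<tau> g, \<upsilon> g]) (?D (xs @ ys))"
      unfolding map_append diag_block_mat_append_pair[of "map _ xs"]
      by (rule rep_iso_pair_cong[OF reps(1) rep[OF xs(1)] reps(2) rep[OF ys(1)] xs(2) ys(2)])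
    with iso have "rep_iso G \<sigma> (?D (xs @ ys))"
      by (rule rep_iso_trans)
    then show ?thesis
      using xs(1) ys(1) by (intro exI[of _ "xs @ ys"]) simp
  qed
qed

lemma multiplicity_formula:
  assumes sys: "irreps_system G t \<rho>" and \<sigma>: "representation G d \<sigma>"
    and iso: "rep_iso G \<sigma> (direct_sum_rep t \<rho> m)" and i: "i < t"
  shows "(\<Sum>g\<in>carrier G. character \<sigma> g * character (\<rho> i) (inv g)) = of_nat (order G) * of_nat (m i)"
proof -
  have reps: "representation G (rep_dim G (\<rho> j)) (\<rho> j)" if "j \<in> set (multiplicity_list t m)" for j
    using that irreps_systemD(2)[OF sys] set_multiplicity_list[of t m] by auto
  have "character \<sigma> g = (\<Sum>j<t. of_nat (m j) * character (\<rho> j) g)" if "g \<in> carrier G" for g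
    using rep_iso_character[OF \<sigma> representation_diag_list[OF reps] iso[unfolded direct_sum_rep_eq] that]
      character_diag_list[of "multiplicity_list t m", OF reps that] by (simp add: sum_list_multiplicity_list)
  then have "(\<Sum>g\<in>carrier G. character \<sigma> g * character (\<rho> i) (inv g)) =
      (\<Sum>g\<in>carrier G. \<Sum>j<t. of_nat (m j) * (character (\<rho> j) g * character (\<rho> i) (inv g)))"
    by (simp add: sum_distrib_right mult.assoc)
  also have "\<dots> = (\<Sum>j<t. of_nat (m j) * (\<Sum>g\<in>carrier G. character (\<rho> j) g * character (\<rho> i) (inv g)))"
    by (subst sum.swap) (simp add: sum_distrib_left)
  also have "\<dots> = (\<Sum>j<t. if j = i then of_nat (m j) * of_nat (order G) else 0)"
    using character_orthogonal[OF irreps_systemD(1)[OF sys] irreps_systemD(1)[OF sys] irreps_systemD(4)[OF sys]]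
      character_norm[OF irreps_systemD(1)[OF sys]] i by (intro sum.cong) auto
  finally show ?thesis
    using i by (simp add: mult.commute)
qed

text \<open>This includes that the definite description is meaningful: a multiplicity vector exists
  by complete reducibility and sorting, and \<open>multiplicity_formula\<close> recovers its entries
  below t from the character. The weights do not depend on \<sigma>, the form that
  \<open>q_series_modular_sum\<close> requires.\<close>

lemma multiplicity_in_eq:
  assumes sys: "irreps_system G t \<rho>" and fin: "finite (carrier G)" and \<sigma>: "representation G d \<sigma>" and i: "i < t"
  shows "of_nat (multiplicity_in G t \<rho> \<sigma> i) =
    (\<Sum>g\<in>carrier G. character (\<rho> i) (inv g) / of_nat (order G) * character \<sigma> g)"
proof -
  have N: "(of_nat (order G) :: complex) \<noteq> 0"
    using fin by (simp add: order_gt_0_iff_finite)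
  let ?P = "\<lambda>m. rep_iso G \<sigma> (direct_sum_rep t \<rho> m) \<and> (\<forall>i\<ge>t. m i = 0)"
  obtain "is" where list: "set is \<subseteq> {..<t}" "rep_iso G \<sigma> (\<lambda>g. diag_block_mat (map (\<lambda>i. \<rho> i g) is))"
    using complete_reducibility_list[OF sys fin \<sigma>] by blast
  obtain m where "\<forall>i\<ge>t. m i = 0" "rep_iso G (\<lambda>g. diag_block_mat (map (\<lambda>i. \<rho> i g) is)) (direct_sum_rep t \<rho> m)"
    using rep_iso_sorted[OF sys list(1)] by blast
  then have m: "?P m"
    using rep_iso_trans list(2) by blast
  have *: "m' = m" if m': "?P m'" for m'
  proof
    fix j
    show "m' j = m j"
    proof (cases "j < t")
      case True
      have "of_nat (order G) * of_nat (m' j) = (of_nat (order G) * of_nat (m j) :: complex)"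
        using multiplicity_formula[OF sys \<sigma> conjunct1[OF m] True]
          multiplicity_formula[OF sys \<sigma> conjunct1[OF m'] True] by simp
      then show ?thesis
        using N by simp
    qed (use m m' in simp)
  qed
  have "multiplicity_in G t \<rho> \<sigma> = m"
    unfolding multiplicity_in_def by (rule the_equality[where P = ?P, OF m *])
  moreover have "(\<Sum>g\<in>carrier G. character \<sigma> g * character (\<rho> i) (inv g)) = of_nat (order G) * of_nat (m i)"
    by (rule multiplicity_formula[OF sys \<sigma> conjunct1[OF m] i])
  ultimately show ?thesis
    using N by (simp add: field_simps flip: sum_divide_distrib)
qed

end

section \<open>The regular representation\<close>

context group
begin

text \<open>Permutation matrices of left multiplication, indexed through an enumeration
  \<open>e\<close> of the group; the trace counts fixed points, and only the identity has
  any.\<close>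

lemma regular_representation_exists:
  assumes fin: "finite (carrier G)"
  obtains R where "representation G (order G) R"
    "\<And>g. g \<in> carrier G \<Longrightarrow> character R g = (if g = \<one> then of_nat (order G) else 0)"
proof -
  define N where "N = order G"
  obtain e where e: "bij_betw e {..<N} (carrier G)"
    using ex_bij_betw_nat_finite[OF fin] by (auto simp: N_def order_def atLeast0LessThan)
  then have mem: "e i \<in> carrier G" if "i < N" for i
    using that by (auto simp: bij_betw_def)
  have inj: "e i = e j \<longleftrightarrow> i = j" if "i < N" "j < N" for i j
    using e that by (auto simp: bij_betw_def inj_on_def)
  define R where "R g = mat N N (\<lambda>(i, j). if e i = g \<otimes> e j then 1 else 0 :: complex)" for g
  have "R (g \<otimes> h) = R g * R h" if gh: "g \<in> carrier G" "h \<in> carrier G" for g h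
  proof (rule eq_matI)
    fix i j assume "i < dim_row (R g * R h)" "j < dim_col (R g * R h)"
    then have ij: "i < N" "j < N"
      by (auto simp: R_def)
    then have "h \<otimes> e j \<in> e ` {..<N}"
      using e gh mem by (simp add: bij_betw_def)
    then obtain k where k: "k < N" "h \<otimes> e j = e k"
      by auto
    have "(R g * R h) $$ (i, j) = (\<Sum>l<N. R g $$ (i, l) * R h $$ (l, j))"
      using ij by (intro index_mult_mat_sum[of _ N]) (auto simp: R_def)
    also have "\<dots> = (\<Sum>l<N. if l = k then R g $$ (i, k) else 0)"
      using ij k by (intro sum.cong) (auto simp: R_def inj)
    also have "\<dots> = R (g \<otimes> h) $$ (i, j)"
      using ij k gh mem by (simp add: R_def m_assoc)
    finally show "R (g \<otimes> h) $$ (i, j) = (R g * R h) $$ (i, j)" ..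
  qed (simp_all add: R_def)
  moreover have "R \<one> = 1\<^sub>m N"
    using mem by (intro eq_matI) (auto simp: R_def inj)
  ultimately have "representation G (order G) R"
    unfolding N_def[symmetric] by (intro representationI) (auto simp: R_def)
  moreover have "character R g = (if g = \<one> then of_nat (order G) else 0)" if g: "g \<in> carrier G" for g
  proof -
    have "character R g = (\<Sum>i<N. if e i = g \<otimes> e i then 1 else 0)"
      by (simp add: character_def mat_trace_def R_def)
    also have "\<dots> = (\<Sum>i<N. if g = \<one> then 1 else 0)"
      using g mem by (intro sum.cong) (auto simp: eq_commute[of "e _"] l_cancel_one)
    finally show ?thesis
      by (simp add: N_def)
  qed
  ultimately show thesis
    using that by blast
qed

lemma regular_copies:
  assumes fin: "finite (carrier G)"
  obtains V :: "'c \<Rightarrow> 'a \<Rightarrow> complex mat" where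
    "\<And>n. representation G (a n * order G) (V n)"
    "\<And>n g. g \<in> carrier G \<Longrightarrow> character (V n) g = (if g = \<one> then of_nat (a n) * of_nat (order G) else 0)"
proof -
  obtain R where R: "representation G (order G) R"
    "\<And>g. g \<in> carrier G \<Longrightarrow> character R g = (if g = \<one> then of_nat (order G) else 0)"
    using regular_representation_exists[OF fin] by metis
  \<comment> \<open>The index 0 is a dummy: a list of equal entries with a constant family lets the
    lemmas on diagonal lists handle copies of \<open>R\<close>.\<close>
  define V where "V n g = diag_block_mat (map (\<lambda>i. R g) (replicate (a n) (0 :: nat)))" for n g
  note dim = representationD(4)[OF R(1)]
  have "representation G (a n * order G) (V n)" for n
    using representation_diag_list[of "replicate (a n) (0 :: nat)" "\<lambda>_. R"] R(1)
    by (simp add: V_def[abs_def] dim sum_list_replicate)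
  moreover have "character (V n) g = (if g = \<one> then of_nat (a n) * of_nat (order G) else 0)"
    if "g \<in> carrier G" for n g
    using character_diag_list[of "replicate (a n) (0 :: nat)" "\<lambda>_. R" g] R that
    by (simp add: V_def[abs_def] dim sum_list_replicate)
  ultimately show thesis
    using that by blast
qed

text \<open>Only g = 1 contributes to the multiplicity formula; the group order cancels and the
  character value at 1 is the dimension.\<close>

lemma multiplicity_regular:
  assumes sys: "irreps_system G t \<rho>" and fin: "finite (carrier G)" and i: "i < t"
    and \<sigma>: "representation G (k * order G) \<sigma>"
    and char: "\<And>g. g \<in> carrier G \<Longrightarrow> character \<sigma> g = (if g = \<one> then of_nat k * of_nat (order G) else 0)"
  shows "multiplicity_in G t \<rho> \<sigma> i = k * rep_dim G (\<rho> i)"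
proof -
  have N: "(of_nat (order G) :: complex) \<noteq> 0"
    using fin by (simp add: order_gt_0_iff_finite)
  have "of_nat (multiplicity_in G t \<rho> \<sigma> i) =
      (\<Sum>g\<in>carrier G. if g = \<one> then character (\<rho> i) \<one> * of_nat k else 0)"
    unfolding multiplicity_in_eq[OF sys fin \<sigma> i] using N by (intro sum.cong) (auto simp: char)
  also have "\<dots> = character (\<rho> i) \<one> * of_nat k"
    using fin by (simp add: sum.delta)
  also have "character (\<rho> i) \<one> = of_nat (rep_dim G (\<rho> i))"
    unfolding character_def representationD(3)[OF irreps_systemD(2)[OF sys i]] by (simp add: mat_trace_one)
  finally have "of_nat (multiplicity_in G t \<rho> \<sigma> i) = (of_nat (k * rep_dim G (\<rho> i)) :: complex)"
    by (simp add: mult.commute)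
  then show ?thesis
    by (simp only: of_nat_eq_iff)
qed

end

section \<open>Width s and asymptotic regularity\<close>

context group
begin

text \<open>The values of the Frobenius characters do not depend on n and enter the series only as
  constant coefficients. Their recursion is therefore never unfolded, and the argument is the same
  for tuples of every length.\<close>

lemma weak_moonshine_imp_width:
  assumes sys: "irreps_system G t \<rho>" and fin: "finite (carrier G)" and moonshine: "weak_moonshine G d V"
  shows "width_weak_moonshine G t \<rho> s d V"
proof -
  have module: "infinite_graded_module G d V"
    and modular: "\<And>g. g \<in> carrier G \<Longrightarrow> q_series_modular d (\<lambda>n. mat_trace (V n g))"
    using moonshine by (auto simp: weak_moonshine_def)
  have "q_series_modular d (Frob G t \<rho> V gs)" for gs
  proof (rule q_series_modular_cong)
    let ?k = "\<lambda>g. \<Sum>i<t. character (\<rho> i) (inv g) / of_nat (order G) * frobenius_character G (character (\<rho> i)) gs"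
    show "q_series_modular d (\<lambda>n. \<Sum>g\<in>carrier G. ?k g * mat_trace (V n g))"
      using fin modular by (rule q_series_modular_sum)
    fix n assume "n \<in> degrees d"
    then have V: "representation G (rep_dim G (V n)) (V n)"
      using module by (simp add: infinite_graded_module_def)
    have "Frob G t \<rho> V gs n = (\<Sum>i<t. \<Sum>g\<in>carrier G. character (\<rho> i) (inv g) / of_nat (order G) *
        character (V n) g * frobenius_character G (character (\<rho> i)) gs)"
      by (simp add: Frob_def multiplicity_in_eq[OF sys fin V] sum_distrib_right)
    also have "\<dots> = (\<Sum>g\<in>carrier G. ?k g * mat_trace (V n g))"
      by (subst sum.swap) (simp add: sum_distrib_left sum_distrib_right character_def mult_ac)
    finally show "(\<Sum>g\<in>carrier G. ?k g * mat_trace (V n g)) = Frob G t \<rho> V gs n" ..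
  qed
  with module show ?thesis
    by (simp add: width_weak_moonshine_def)
qed

lemma exists_asymptotically_regular_weak_moonshine:
  assumes sys: "irreps_system G t \<rho>" and fin: "finite (carrier G)"
  shows "\<exists>d V. weak_moonshine G d V \<and> asymptotically_regular G t \<rho> V"
proof -
  obtain a :: "int \<Rightarrow> nat" where a: "\<And>n. n \<ge> 2 \<Longrightarrow> a n > 0"
    and modular: "q_series_modular 1 (\<lambda>n. of_nat (a n))"
    using exists_positive_modular_q_series by metis
  obtain V where V: "\<And>n. representation G (a n * order G) (V n)"
    and char: "\<And>n g. g \<in> carrier G \<Longrightarrow>
      character (V n) g = (if g = \<one> then of_nat (a n) * of_nat (order G) else 0)"
    using regular_copies[OF fin, of a] by metis
  have N: "order G > 0"
    using fin by (simp add: order_gt_0_iff_finite)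
  have "infinite_graded_module G 1 V"
  proof -
    have "{2..} \<subseteq> {n \<in> degrees 1. rep_dim G (V n) > 0}"
      using a N by (auto simp: degrees_def representationD(4)[OF V])
    then have "infinite {n \<in> degrees 1. rep_dim G (V n) > 0}"
      using infinite_Ici infinite_super by blast
    then show ?thesis
      using V by (simp add: infinite_graded_module_def representationD(4)[OF V])
  qed
  moreover have "q_series_modular 1 (\<lambda>n. mat_trace (V n g))" if "g \<in> carrier G" for g
  proof (rule q_series_modular_cong)
    show "q_series_modular 1 (\<lambda>n. (if g = \<one> then of_nat (order G) else 0) * of_nat (a n))"
      by (rule q_series_modular_cmult[OF modular])
    show "(if g = \<one> then of_nat (order G) else 0) * of_nat (a n) = mat_trace (V n g)" for n
      using char[OF that, of n] by (simp add: character_def)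
  qed
  ultimately have "weak_moonshine G 1 V"
    by (simp add: weak_moonshine_def)
  moreover have "asymptotically_regular G t \<rho> V"
    unfolding asymptotically_regular_def
  proof (intro allI impI)
    fix i assume i: "i < t"
    \<comment> \<open>The common factor \<open>a (int n)\<close> is positive from n = 2 on and
      cancels, so the quotient already equals its limit there. For smaller n it may be the default
      value of 0 / 0, which the limit ignores.\<close>
    have "real (multiplicity_in G t \<rho> (V (int n)) i) / (\<Sum>j<t. real (multiplicity_in G t \<rho> (V (int n)) j)) =
        real (rep_dim G (\<rho> i)) / (\<Sum>j<t. real (rep_dim G (\<rho> j)))" if "n \<ge> 2" for n
    proof -
      have "multiplicity_in G t \<rho> (V (int n)) j = a (int n) * rep_dim G (\<rho> j)" if "j < t" for j
        by (rule multiplicity_regular[OF sys fin that V char])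
      then show ?thesis
        using i a[of "int n"] that by (simp flip: sum_distrib_left)
    qed
    then show "(\<lambda>n. real (multiplicity_in G t \<rho> (V (int n)) i) /
        (\<Sum>j<t. real (multiplicity_in G t \<rho> (V (int n)) j)))
      \<longlonglongrightarrow> real (rep_dim G (\<rho> i)) / (\<Sum>j<t. real (rep_dim G (\<rho> j)))"
      by (intro tendsto_eventually) (auto simp: eventually_sequentially)
  qed
  ultimately show ?thesis
    by blast
qed

end

theorem theorem1p1:
  fixes G :: "('g, 'b) monoid_scheme"
    and t s :: nat
    and \<rho> :: "nat \<Rightarrow> 'g \<Rightarrow> complex mat"
  assumes "group G"
    and "finite (carrier G)"
    and "irreps_system G t \<rho>"
    and "s \<ge> 1"
  shows "(\<forall>d V. weak_moonshine G d V \<longrightarrow> width_weak_moonshine G t \<rho> s d V) \<and>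
         (\<exists>d V. weak_moonshine G d V \<and> asymptotically_regular G t \<rho> V \<and>
                width_weak_moonshine G t \<rho> s d V)"
  using group.weak_moonshine_imp_width[OF assms(1,3,2)]
    group.exists_asymptotically_regular_weak_moonshine[OF assms(1,3,2)] by blast

end
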